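(* Let $k$ be an algebraically closed field with $\operatorname{char}(k)\ne2$, let $A=A(\alpha,\beta,\gamma)$ be a 4-dimensional Sklyanin algebra over $k$ whose associated automorphism $\sigma$ has infinite order, and let $B^{G,\mu}$ be the cocycle twist of $B=A/(\Omega_1,\Omega_2)$ described in the context. Then the centre of $B^{G,\mu}$ is trivial, that is, $Z(B^{G,\mu})=k$.
   Context: Write $[x,y]=xy-yx$, $[x,y]_+=xy+yx$. The parameters satisfy $\alpha+\beta+\gamma+\alpha\beta\gamma=0$, $\{\alpha,\beta,\gamma\}\cap\{0,\pm1\}=\emptyset$; $A$ is generated by $x_0,\dots,x_3$ (degree 1) with relations $[x_0,x_1]-\alpha[x_2,x_3]_+$, $[x_0,x_1]_+-[x_2,x_3]$, $[x_0,x_2]-\beta[x_3,x_1]_+$, $[x_0,x_2]_+-[x_3,x_1]$, $[x_0,x_3]-\gamma[x_1,x_2]_+$, $[x_0,x_3]_+-[x_1,x_2]$. Associated geometry: the elliptic curve $E\subset\mathbb{P}^3_k$, $y_0^2+y_1^2+y_2^2+y_3^2=0$, $y_3^2+\frac{1-\gamma}{1+\alpha}y_1^2+\frac{1+\gamma}{1-\beta}y_2^2=0$, parameterises (with four extra points) the point modules over $A$ (cyclic $\mathbb{N}$-graded right modules with Hilbert series $1/(1-t)$); $\sigma$ is the translation automorphism of $E$ with $M_p[1]_{\ge0}\cong M_{\sigma(p)}$, where $M_p$ is the point module of $p\in E$. $\Omega_1=-x_0^2+x_1^2+x_2^2+x_3^2$ and $\Omega_2=x_1^2+\frac{1+\alpha}{1-\beta}x_2^2+\frac{1-\alpha}{1+\gamma}x_3^2$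 are central in $A$, and $B=A/(\Omega_1,\Omega_2)\cong B(E,\mathcal{O}_E(1),\sigma)$ is a twisted homogeneous coordinate ring. $G=\langle g_1,g_2\rangle\cong(C_2)^2$ acts on $B$ by $x_0^{g_1}=x_0$, $x_1^{g_1}=x_1$, $x_2^{g_1}=-x_2$, $x_3^{g_1}=-x_3$, $x_i^{g_2}=(-1)^ix_i$, inducing a $G$-grading with $x_0,x_1,x_2,x_3$ in degrees $e,g_1,g_2,g_1g_2$. With $\mu(g_1^pg_2^q,g_1^rg_2^s)=(-1)^{ps}$ ($p,q,r,s\in\{0,1\}$), $B^{G,\mu}$ is $B$ with multiplication $a\ast_\mu b=\mu(g,h)ab$ for $a\in B_g,b\in B_h$. *)

theory Defs
  imports
    "HOL-Algebra.QuotRing"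
    "HOL-Computational_Algebra.Polynomial"
    "HOL-Library.Poly_Mapping"
    "HOL-Library.Product_Plus"
    "HOL-Library.Z2"
begin

section \<open>The Sklyanin algebra and its quotient B\<close>

datatype gen = X0 | X1 | X2 | X3

text \<open>Words under concatenation. With this instance the convolution product on
  \<open>gen list \<Rightarrow>\<^sub>0 'k\<close> makes it the free associative \<open>'k\<close>-algebra on \<open>gen\<close>.\<close>

instantiation list :: (type) monoid_add
begin
definition zero_list :: "'a list" where "zero_list = []"
definition plus_list :: "'a list \<Rightarrow> 'a list \<Rightarrow> 'a list" where "plus_list = (@)"
instance by standard (simp_all add: zero_list_def plus_list_def)
end

type_synonym 'k fa = "gen list \<Rightarrow>\<^sub>0 'k"
type_synonym 'k elA = "'k fa set"
type_synonym 'k elB = "'k fa set set"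

definition free_alg :: "'k::field fa ring" where
  "free_alg = \<lparr>carrier = UNIV, monoid.mult = (*), one = 1, zero = 0, add = (+)\<rparr>"

definition var :: "gen \<Rightarrow> 'k::field fa" where
  "var i = Poly_Mapping.single [i] 1"

definition const :: "'k::field \<Rightarrow> 'k fa" where
  "const c = Poly_Mapping.single [] c"

definition comm :: "'k::field fa \<Rightarrow> 'k fa \<Rightarrow> 'k fa" where
  "comm a b = a * b - b * a"

definition acomm :: "'k::field fa \<Rightarrow> 'k fa \<Rightarrow> 'k fa" where
  "acomm a b = a * b + b * a"

definition sklyanin_parameters :: "'k::field \<Rightarrow> 'k \<Rightarrow> 'k \<Rightarrow> bool" where
  "sklyanin_parameters \<alpha> \<beta> \<gamma> \<longleftrightarrow>
     \<alpha> + \<beta> + \<gamma> + \<alpha> * \<beta> * \<gamma> = 0 \<and> {\<alpha>, \<beta>, \<gamma>} \<inter> {0, 1, - 1} = {}"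

definition sklyanin_relations :: "'k::field \<Rightarrow> 'k \<Rightarrow> 'k \<Rightarrow> 'k fa set" where
  "sklyanin_relations \<alpha> \<beta> \<gamma> =
     {comm (var X0) (var X1) - const \<alpha> * acomm (var X2) (var X3),
      acomm (var X0) (var X1) - comm (var X2) (var X3),
      comm (var X0) (var X2) - const \<beta> * acomm (var X3) (var X1),
      acomm (var X0) (var X2) - comm (var X3) (var X1),
      comm (var X0) (var X3) - const \<gamma> * acomm (var X1) (var X2),
      acomm (var X0) (var X3) - comm (var X1) (var X2)}"

definition sklyanin_ideal :: "'k::field \<Rightarrow> 'k \<Rightarrow> 'k \<Rightarrow> 'k fa set" where
  "sklyanin_ideal \<alpha> \<beta> \<gamma> = Idl\<^bsub>free_alg\<^esub> (sklyanin_relations \<alpha> \<beta> \<gamma>)"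

definition algA :: "'k::field \<Rightarrow> 'k \<Rightarrow> 'k \<Rightarrow> 'k elA ring" where
  "algA \<alpha> \<beta> \<gamma> = free_alg Quot (sklyanin_ideal \<alpha> \<beta> \<gamma>)"

definition clsA :: "'k::field \<Rightarrow> 'k \<Rightarrow> 'k \<Rightarrow> 'k fa \<Rightarrow> 'k elA" where
  "clsA \<alpha> \<beta> \<gamma> f = sklyanin_ideal \<alpha> \<beta> \<gamma> +>\<^bsub>free_alg\<^esub> f"

definition Omega1 :: "'k::field fa" where
  "Omega1 = - (var X0)\<^sup>2 + (var X1)\<^sup>2 + (var X2)\<^sup>2 + (var X3)\<^sup>2"

definition Omega2 :: "'k::field \<Rightarrow> 'k \<Rightarrow> 'k \<Rightarrow> 'k fa" where
  "Omega2 \<alpha> \<beta> \<gamma> =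
     (var X1)\<^sup>2 + const ((1 + \<alpha>) / (1 - \<beta>)) * (var X2)\<^sup>2
       + const ((1 - \<alpha>) / (1 + \<gamma>)) * (var X3)\<^sup>2"

definition omega_ideal :: "'k::field \<Rightarrow> 'k \<Rightarrow> 'k \<Rightarrow> 'k elA set" where
  "omega_ideal \<alpha> \<beta> \<gamma> =
     Idl\<^bsub>algA \<alpha> \<beta> \<gamma>\<^esub> {clsA \<alpha> \<beta> \<gamma> Omega1, clsA \<alpha> \<beta> \<gamma> (Omega2 \<alpha> \<beta> \<gamma>)}"

definition algB :: "'k::field \<Rightarrow> 'k \<Rightarrow> 'k \<Rightarrow> 'k elB ring" where
  "algB \<alpha> \<beta> \<gamma> = algA \<alpha> \<beta> \<gamma> Quot (omega_ideal \<alpha> \<beta> \<gamma>)"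

definition clsB :: "'k::field \<Rightarrow> 'k \<Rightarrow> 'k \<Rightarrow> 'k fa \<Rightarrow> 'k elB" where
  "clsB \<alpha> \<beta> \<gamma> f = omega_ideal \<alpha> \<beta> \<gamma> +>\<^bsub>algA \<alpha> \<beta> \<gamma>\<^esub> clsA \<alpha> \<beta> \<gamma> f"


section \<open>The cocycle twist\<close>

text \<open>\<open>C\<^sub>2 \<times> C\<^sub>2\<close> written additively: \<open>g\<^sub>1\<^sup>p g\<^sub>2\<^sup>q\<close> is the pair \<open>(p, q)\<close>.\<close>

type_synonym G = "bit \<times> bit"

definition sign :: "bit \<Rightarrow> 'k::field" where
  "sign e = (if e = 1 then - 1 else 1)"

text \<open>The scalar by which \<open>g\<close> acts on a generator.\<close>

fun gen_sign :: "G \<Rightarrow> gen \<Rightarrow> 'k::field" where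
  "gen_sign (p, q) X0 = 1"
| "gen_sign (p, q) X1 = sign q"
| "gen_sign (p, q) X2 = sign p"
| "gen_sign (p, q) X3 = sign (p + q)"

definition act_free :: "G \<Rightarrow> 'k::field fa \<Rightarrow> 'k fa" where
  "act_free g = Poly_Mapping.mapp (\<lambda>w c. prod_list (map (gen_sign g) w) * c)"

text \<open>The ideals are stable under the action, so the image of a coset is the coset of the image.\<close>

definition actB :: "G \<Rightarrow> 'k::field elB \<Rightarrow> 'k elB" where
  "actB g b = (\<lambda>a. act_free g ` a) ` b"

text \<open>The grading is induced by an isomorphism \<open>h \<mapsto> \<chi>\<^sub>h\<close> of \<open>G\<close> with its dual: the part of
  degree \<open>h\<close> is the \<open>\<chi>\<^sub>h\<close>-isotypic part.  This isomorphism is the one that puts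
  \<open>x\<^sub>0, x\<^sub>1, x\<^sub>2, x\<^sub>3\<close> in degrees \<open>e, g\<^sub>1, g\<^sub>2, g\<^sub>1g\<^sub>2\<close>.\<close>

fun chi :: "G \<Rightarrow> G \<Rightarrow> 'k::field" where
  "chi (p, q) (r, s) = sign (p * s + q * r)"

definition partB :: "'k::field \<Rightarrow> 'k \<Rightarrow> 'k \<Rightarrow> G \<Rightarrow> 'k elB set" where
  "partB \<alpha> \<beta> \<gamma> h =
     {b \<in> carrier (algB \<alpha> \<beta> \<gamma>).
        \<forall>g. actB g b = clsB \<alpha> \<beta> \<gamma> (const (chi h g)) \<otimes>\<^bsub>algB \<alpha> \<beta> \<gamma>\<^esub> b}"

definition components :: "'k::field \<Rightarrow> 'k \<Rightarrow> 'k \<Rightarrow> 'k elB \<Rightarrow> G \<Rightarrow> 'k elB" where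
  "components \<alpha> \<beta> \<gamma> b =
     (THE c. (\<forall>h. c h \<in> partB \<alpha> \<beta> \<gamma> h) \<and> b = (\<Oplus>\<^bsub>algB \<alpha> \<beta> \<gamma>\<^esub>h\<in>UNIV. c h))"

fun mu :: "G \<Rightarrow> G \<Rightarrow> 'k::field" where
  "mu (p, q) (r, s) = sign (p * s)"

definition twisted_mult :: "'k::field \<Rightarrow> 'k \<Rightarrow> 'k \<Rightarrow> 'k elB \<Rightarrow> 'k elB \<Rightarrow> 'k elB" where
  "twisted_mult \<alpha> \<beta> \<gamma> a b =
     (\<Oplus>\<^bsub>algB \<alpha> \<beta> \<gamma>\<^esub>g\<in>UNIV. \<Oplus>\<^bsub>algB \<alpha> \<beta> \<gamma>\<^esub>h\<in>UNIV.
        clsB \<alpha> \<beta> \<gamma> (const (mu g h)) \<otimes>\<^bsub>algB \<alpha> \<beta> \<gamma>\<^esub>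
          (components \<alpha> \<beta> \<gamma> a g \<otimes>\<^bsub>algB \<alpha> \<beta> \<gamma>\<^esub> components \<alpha> \<beta> \<gamma> b h))"

definition twistB :: "'k::field \<Rightarrow> 'k \<Rightarrow> 'k \<Rightarrow> 'k elB ring" where
  "twistB \<alpha> \<beta> \<gamma> = (algB \<alpha> \<beta> \<gamma>)\<lparr>monoid.mult := twisted_mult \<alpha> \<beta> \<gamma>\<rparr>"

definition centre :: "('a, 'm) ring_scheme \<Rightarrow> 'a set" where
  "centre R = {z \<in> carrier R. \<forall>w \<in> carrier R. z \<otimes>\<^bsub>R\<^esub> w = w \<otimes>\<^bsub>R\<^esub> z}"


section \<open>Graded right modules\<close>

text \<open>The fields \<open>mult\<close> and \<open>one\<close> inherited from the ring record are ignored.\<close>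

record ('r, 'm) grmod = "'m ring" +
  ract :: "'m \<Rightarrow> 'r \<Rightarrow> 'm"
  hpart :: "nat \<Rightarrow> 'm set"

definition right_module :: "'r ring \<Rightarrow> ('r, 'm) grmod \<Rightarrow> bool" where
  "right_module R M \<longleftrightarrow>
     ring R \<and> abelian_group M \<and>
     (\<forall>m \<in> carrier M. \<forall>r \<in> carrier R. ract M m r \<in> carrier M) \<and>
     (\<forall>m \<in> carrier M. \<forall>m' \<in> carrier M. \<forall>r \<in> carrier R.
        ract M (m \<oplus>\<^bsub>M\<^esub> m') r = ract M m r \<oplus>\<^bsub>M\<^esub> ract M m' r) \<and>
     (\<forall>m \<in> carrier M. \<forall>r \<in> carrier R. \<forall>s \<in> carrier R.
        ract M m (r \<oplus>\<^bsub>R\<^esub> s) = ract M m r \<oplus>\<^bsub>M\<^esub> ract M m s) \<and>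
     (\<forall>m \<in> carrier M. \<forall>r \<in> carrier R. \<forall>s \<in> carrier R.
        ract M m (r \<otimes>\<^bsub>R\<^esub> s) = ract M (ract M m r) s) \<and>
     (\<forall>m \<in> carrier M. ract M m \<one>\<^bsub>R\<^esub> = m)"

definition graded_right_module ::
  "'r ring \<Rightarrow> (nat \<Rightarrow> 'r set) \<Rightarrow> ('r, 'm) grmod \<Rightarrow> bool" where
  "graded_right_module R Rh M \<longleftrightarrow>
     right_module R M \<and>
     (\<forall>n. additive_subgroup (hpart M n) M) \<and>
     (\<forall>m \<in> carrier M. \<exists>!c. (\<forall>n. c n \<in> hpart M n) \<and> finite {n. c n \<noteq> \<zero>\<^bsub>M\<^esub>} \<and>
        m = (\<Oplus>\<^bsub>M\<^esub>n\<in>{n. c n \<noteq> \<zero>\<^bsub>M\<^esub>}. c n)) \<and>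
     (\<forall>i j. \<forall>m \<in> hpart M i. \<forall>r \<in> Rh j. ract M m r \<in> hpart M (i + j))"

text \<open>\<open>M[1]\<^sub>\<ge>\<^sub>0\<close>: the submodule of \<open>M\<close> spanned by the parts of positive degree, regraded.\<close>

definition shift_trunc :: "('r, 'm) grmod \<Rightarrow> ('r, 'm) grmod" where
  "shift_trunc M = M\<lparr>
     carrier := {(\<Oplus>\<^bsub>M\<^esub>n\<in>N. c n) | N c. finite N \<and> 0 \<notin> N \<and> (\<forall>n \<in> N. c n \<in> hpart M n)},
     hpart := (\<lambda>n. hpart M (Suc n))\<rparr>"

definition graded_iso :: "'r ring \<Rightarrow> ('r, 'm) grmod \<Rightarrow> ('r, 'n) grmod \<Rightarrow> bool" where
  "graded_iso R M N \<longleftrightarrow>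
     (\<exists>f. bij_betw f (carrier M) (carrier N) \<and>
        (\<forall>m \<in> carrier M. \<forall>m' \<in> carrier M. f (m \<oplus>\<^bsub>M\<^esub> m') = f m \<oplus>\<^bsub>N\<^esub> f m') \<and>
        (\<forall>m \<in> carrier M. \<forall>r \<in> carrier R. f (ract M m r) = ract N (f m) r) \<and>
        (\<forall>n. f ` hpart M n = hpart N n))"


section \<open>Point modules, the curve E and the automorphism\<close>

definition partA :: "'k::field \<Rightarrow> 'k \<Rightarrow> 'k \<Rightarrow> nat \<Rightarrow> 'k elA set" where
  "partA \<alpha> \<beta> \<gamma> n =
     clsA \<alpha> \<beta> \<gamma> ` {f. \<forall>w \<in> Poly_Mapping.keys f. length w = n}"

text \<open>A graded module has Hilbert series \<open>1/(1 - t)\<close> iff each of its homogeneous parts has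
  dimension one over \<open>k\<close>.\<close>

definition point_module :: "'k::field \<Rightarrow> 'k \<Rightarrow> 'k \<Rightarrow> ('k elA, 'm) grmod \<Rightarrow> bool" where
  "point_module \<alpha> \<beta> \<gamma> M \<longleftrightarrow>
     graded_right_module (algA \<alpha> \<beta> \<gamma>) (partA \<alpha> \<beta> \<gamma>) M \<and>
     (\<exists>m \<in> hpart M 0. carrier M = ract M m ` carrier (algA \<alpha> \<beta> \<gamma>)) \<and>
     (\<forall>n. \<exists>e. e \<noteq> \<zero>\<^bsub>M\<^esub> \<and> hpart M n = {ract M e (clsA \<alpha> \<beta> \<gamma> (const c)) | c. True})"

type_synonym 'k pt = "(gen \<Rightarrow> 'k) set"

definition proj :: "(gen \<Rightarrow> 'k::field) \<Rightarrow> 'k pt" where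
  "proj v = {(\<lambda>i. c * v i) | c. c \<noteq> 0}"

definition curveE :: "'k::field \<Rightarrow> 'k \<Rightarrow> 'k \<Rightarrow> 'k pt set" where
  "curveE \<alpha> \<beta> \<gamma> =
     {proj y | y. y \<noteq> (\<lambda>i. 0) \<and>
        (y X0)\<^sup>2 + (y X1)\<^sup>2 + (y X2)\<^sup>2 + (y X3)\<^sup>2 = 0 \<and>
        (y X3)\<^sup>2 + (1 - \<gamma>) / (1 + \<alpha>) * (y X1)\<^sup>2 + (1 + \<gamma>) / (1 - \<beta>) * (y X2)\<^sup>2 = 0}"

text \<open>\<open>M\<close> is the point module of \<open>p \<in> P(A\<^sub>1\<^sup>*)\<close> if the linear forms that annihilate \<open>M\<^sub>0\<close> are
  those vanishing at \<open>p\<close>.\<close>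

definition point_module_of ::
  "'k::field \<Rightarrow> 'k \<Rightarrow> 'k \<Rightarrow> 'k pt \<Rightarrow> ('k elA, 'm) grmod \<Rightarrow> bool" where
  "point_module_of \<alpha> \<beta> \<gamma> p M \<longleftrightarrow>
     point_module \<alpha> \<beta> \<gamma> M \<and>
     (\<forall>v \<in> p. \<forall>a0 a1 a2 a3.
        (\<forall>m \<in> hpart M 0. ract M m (clsA \<alpha> \<beta> \<gamma>
            (const a0 * var X0 + const a1 * var X1 + const a2 * var X2 + const a3 * var X3))
          = \<zero>\<^bsub>M\<^esub>)
        \<longleftrightarrow> a0 * v X0 + a1 * v X1 + a2 * v X2 + a3 * v X3 = 0)"

text \<open>\<open>M\<close> chooses a point module for every \<open>p \<in> E\<close>.  As a point module determines its point,
  and the point module of \<open>p \<in> E\<close> is unique up to isomorphism, these conditions determine \<open>\<sigma>\<close>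
  on \<open>E\<close>; it does not depend on the choice of \<open>M\<close>.\<close>

definition associated_automorphism ::
  "'k::field \<Rightarrow> 'k \<Rightarrow> 'k \<Rightarrow> ('k pt \<Rightarrow> ('k elA, 'm) grmod) \<Rightarrow> ('k pt \<Rightarrow> 'k pt) \<Rightarrow> bool" where
  "associated_automorphism \<alpha> \<beta> \<gamma> M \<sigma> \<longleftrightarrow>
     bij_betw \<sigma> (curveE \<alpha> \<beta> \<gamma>) (curveE \<alpha> \<beta> \<gamma>) \<and>
     (\<forall>p \<in> curveE \<alpha> \<beta> \<gamma>. point_module_of \<alpha> \<beta> \<gamma> p (M p) \<and>
        graded_iso (algA \<alpha> \<beta> \<gamma>) (shift_trunc (M p)) (M (\<sigma> p)))"

definition infinite_order_on :: "'p set \<Rightarrow> ('p \<Rightarrow> 'p) \<Rightarrow> bool" where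
  "infinite_order_on S \<sigma> \<longleftrightarrow> (\<forall>n > 0. \<exists>p \<in> S. (\<sigma> ^^ n) p \<noteq> p)"

end

theory Submission
  imports Defs
begin

text \<open>An element \<open>f\<close> of degree \<open>n\<close> of \<open>B\<close> acts on the point module of \<open>p \<in> E\<close> through a scalar \<open>f(p)\<close>, got by
  evaluating \<open>f\<close> on the orbit \<open>p, \<sigma> p, \<dots>, \<sigma>\<^sup>n\<^sup>-\<^sup>1 p\<close>; these scalars determine \<open>f\<close>.  Indeed, if \<open>f\<close> vanishes at the
  four points of \<open>E\<close> with \<open>x\<^sub>1 = 0\<close>, then \<open>f = x\<^sub>1 g\<close> in \<open>B\<close>, and if \<open>f\<close> vanishes everywhere then so does \<open>g\<close>,
  because locally \<open>\<sigma>\<close> is polynomial and \<open>E\<close> is irreducible.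

  Let \<open>z\<close> be central in the twist.  Its component \<open>f\<close> of degree \<open>n > 0\<close> and of a given \<open>G\<close>-degree commutes up to
  sign with every \<open>x\<^sub>i\<close> in \<open>B\<close>, say \<open>f x\<^sub>i = \<epsilon>\<^sub>i x\<^sub>i f\<close>.  Evaluating at a point where \<open>f(p) \<noteq> 0\<close> gives
  \<open>\<sigma>\<^sup>n p = \<epsilon> p\<close>, and then \<open>\<sigma>\<^sup>2\<^sup>n p = p\<close>.  If \<open>f \<noteq> 0\<close>, this closed condition holds on all of \<open>E\<close> by irreducibility,
  contradicting the infinite order of \<open>\<sigma>\<close>.  Hence \<open>z\<close> is a scalar.\<close>

section \<open>The elliptic curve and the bilinear relations\<close>

text \<open>The divisibility f = x1 g concerns all degrees, but it is decided in degree two.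
  Membership in a right ideal generated by linear forms propagates from degree to degree through
  products of two linear forms, and such a product is tested by functionals on B_2, that is, by 4 x
  4 matrices killed by the six relations and both central elements. A matrix supported at a point p
  in its first index is a multiple of p \<otimes> \<sigma>(p); for the two secant lines that occur
  it is a combination of two such tensors. The plane x1 = 0 meets E in the points (+-r, 0, 1, +-s),
  paired by the lines x3 = +-s x2. One pair gives f = x1 g + (x3 - s x2) h, and the other pair
  forces h to vanish at two points whose secant line absorbs the remainder into x1 B. Irreducibility
  is proved for the affine cone: x0^2 and x3^2 are binary quadratic forms in x1, x2 there, so the
  coordinate ring is a biquadratic extension of k[x1, x2] and zero products are detected by norms.
  Formulas for \<sigma> hold only near a point and up to scalars, so every vanishing statement is
  made insensitive to the scaling of an orbit.\<close>

lemma gen_UNIV: "(UNIV :: gen set) = {X0, X1, X2, X3}"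
  using gen.exhaust by auto

locale sklyanin_algebra =
  fixes \<alpha> \<beta> \<gamma> :: "'k :: field"

locale sklyanin = sklyanin_algebra \<alpha> \<beta> \<gamma> for \<alpha> \<beta> \<gamma> :: "'k :: alg_closed_field" +
  assumes char: "CHAR('k) \<noteq> 2"
    and params: "sklyanin_parameters \<alpha> \<beta> \<gamma>"
begin

lemma two_nz [simp]: "(2::'k) \<noteq> 0"
proof
  assume "(2::'k) = 0"
  then have "(of_nat 2 :: 'k) = 0" by simp
  then have "CHAR('k) dvd 2" by (simp only: of_nat_eq_0_iff_char_dvd)
  with char show False
    by (metis CHAR_not_1 One_nat_def dvd_refl prime_nat_iff two_is_prime_nat)
qed

lemma four_nz [simp]: "(4::'k) \<noteq> 0"
proof -
  have "(4::'k) = 2 * 2" by simp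
  then show ?thesis by (metis mult_eq_0_iff two_nz)
qed

lemma param_eq: "\<alpha> + \<beta> + \<gamma> + \<alpha> * \<beta> * \<gamma> = 0"
  using params by (simp add: sklyanin_parameters_def)

lemma param_nz [simp]:
  "\<alpha> \<noteq> 0" "\<beta> \<noteq> 0" "\<gamma> \<noteq> 0" "1 + \<alpha> \<noteq> 0" "1 + \<beta> \<noteq> 0" "1 + \<gamma> \<noteq> 0"
  "1 - \<alpha> \<noteq> 0" "1 - \<beta> \<noteq> 0" "1 - \<gamma> \<noteq> 0"
  "\<alpha> \<noteq> 1" "\<beta> \<noteq> 1" "\<gamma> \<noteq> 1" "\<alpha> \<noteq> - 1" "\<beta> \<noteq> - 1" "\<gamma> \<noteq> - 1"
  using params by (auto simp: sklyanin_parameters_def add_eq_0_iff)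

text \<open>Otherwise the parameter equation would become \<beta> (1 - \<alpha>^2) = 0 or \<alpha>
  (1 - \<beta>^2) = 0.\<close>

lemma param_sum_nz [simp]: "\<alpha> + \<gamma> \<noteq> 0" "\<beta> + \<gamma> \<noteq> 0"
proof -
  show "\<alpha> + \<gamma> \<noteq> 0"
  proof
    assume "\<alpha> + \<gamma> = 0"
    with param_eq have "\<beta> * ((1 - \<alpha>) * (1 + \<alpha>)) = 0" by Groebner_Basis.algebra
    then show False by simp
  qed
  show "\<beta> + \<gamma> \<noteq> 0"
  proof
    assume "\<beta> + \<gamma> = 0"
    with param_eq have "\<alpha> * ((1 - \<beta>) * (1 + \<beta>)) = 0" by Groebner_Basis.algebra
    then show False by simp
  qed
qed

text \<open>Rewritings of the parameter equation, the second one symmetric in the three parameters.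
  They trade factors 1 + \<gamma> in the identities below.\<close>

lemma param_prod:
  "(1 + \<alpha> * \<beta>) * (1 + \<gamma>) = (1 - \<alpha>) * (1 - \<beta>)"
  "(1 + \<alpha>) * (1 + \<beta>) * (1 + \<gamma>) = (1 - \<alpha>) * (1 - \<beta>) * (1 - \<gamma>)"
  using param_eq by Groebner_Basis.algebra+

text \<open>The affine cone over E, origin included, with the denominators of the second equation
  cleared to suit Groebner computations.\<close>

definition cone :: "(gen \<Rightarrow> 'k) \<Rightarrow> bool" where
  "cone v \<longleftrightarrow> (v X0)\<^sup>2 + (v X1)\<^sup>2 + (v X2)\<^sup>2 + (v X3)\<^sup>2 = 0 \<and>
     (1 + \<alpha>) * (1 - \<beta>) * (v X3)\<^sup>2 + (1 - \<gamma>) * (1 - \<beta>) * (v X1)\<^sup>2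
       + (1 + \<gamma>) * (1 + \<alpha>) * (v X2)\<^sup>2 = 0"

text \<open>The six defining relations of A, evaluated bilinearly on a pair of vectors; each
  commutator-anticommutator pair is solved for its two products involving \<open>X0\<close>.\<close>

definition rels :: "(gen \<Rightarrow> 'k) \<Rightarrow> (gen \<Rightarrow> 'k) \<Rightarrow> bool" where
  "rels v w \<longleftrightarrow>
     2 * v X0 * w X1 = (\<alpha> + 1) * v X2 * w X3 + (\<alpha> - 1) * v X3 * w X2 \<and>
     2 * v X1 * w X0 = (1 - \<alpha>) * v X2 * w X3 - (1 + \<alpha>) * v X3 * w X2 \<and>
     2 * v X0 * w X2 = (\<beta> + 1) * v X3 * w X1 + (\<beta> - 1) * v X1 * w X3 \<and>
     2 * v X2 * w X0 = (1 - \<beta>) * v X3 * w X1 - (1 + \<beta>) * v X1 * w X3 \<and>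
     2 * v X0 * w X3 = (\<gamma> + 1) * v X1 * w X2 + (\<gamma> - 1) * v X2 * w X1 \<and>
     2 * v X3 * w X0 = (1 - \<gamma>) * v X1 * w X2 - (1 + \<gamma>) * v X2 * w X1"

lemma cone_y0:
  assumes "cone v"
  shows "(1 + \<alpha>) * (1 - \<beta>) * (v X0)\<^sup>2
    = (\<beta> + \<gamma>) * (1 + \<alpha>) * (v X2)\<^sup>2 - (\<alpha> + \<gamma>) * (1 - \<beta>) * (v X1)\<^sup>2"
  using assms unfolding cone_def by Groebner_Basis.algebra

text \<open>Setting two coordinates to zero leaves a nonsingular linear system for the squares of
  the other two. So at a point of E one of any two coordinates can be divided by.\<close>

lemma cone_two_zeros:
  assumes C: "cone v" and "i \<noteq> j" "v i = 0" "v j = 0"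
  shows "v = (\<lambda>_. 0)"
proof -
  note C1 = C[unfolded cone_def]
  note C2 = cone_y0[OF C]
  have *: "v X0 = 0 \<and> v X1 = 0 \<and> v X2 = 0 \<and> v X3 = 0"
    if "v X1 = 0" "v X2 = 0" using C1 C2 that by simp
  have e: "\<gamma> * (1 + \<alpha>) * (1 - \<beta>) \<noteq> 0" by simp
  consider "v X1 = 0" "v X2 = 0" | "v X0 = 0" "v X1 = 0" | "v X0 = 0" "v X2 = 0"
    | "v X3 = 0" "v X1 = 0" | "v X3 = 0" "v X2 = 0" | "v X0 = 0" "v X3 = 0"
    using assms(2-4) by (cases i; cases j) auto
  then have "v X1 = 0 \<and> v X2 = 0"
  proof cases
    case 6
    have "(1 - \<gamma>) * (1 - \<beta>) * (v X1)\<^sup>2 + (1 + \<gamma>) * (1 + \<alpha>) * (v X2)\<^sup>2 = 0"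
      and "(v X1)\<^sup>2 + (v X2)\<^sup>2 = 0" using C1 6 by auto
    then have "((1 - \<gamma>) * (1 - \<beta>) - (1 + \<gamma>) * (1 + \<alpha>)) * (v X1)\<^sup>2 = 0"
      and v2: "(v X2)\<^sup>2 = - (v X1)\<^sup>2" by Groebner_Basis.algebra+
    moreover have "(1 - \<gamma>) * (1 - \<beta>) - (1 + \<gamma>) * (1 + \<alpha>) = - (\<gamma> * (1 + \<alpha>) * (1 - \<beta>))"
      using param_eq by Groebner_Basis.algebra
    ultimately have "v X1 = 0" using e by auto
    then show ?thesis using v2 by simp
  qed (use C1 C2 in auto)
  then show ?thesis using * by (intro ext, rename_tac i, case_tac i) auto
qed

text \<open>The relations are linear in \<open>w\<close>.  The vectors \<open>Qa\<close>, \<open>Qb\<close>, \<open>Qc\<close>, \<open>Qd\<close> below consist of \<open>3 \<times> 3\<close> minors of the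
  coefficient matrix, hence span its kernel where they do not vanish; \<open>Dm\<close>, \<open>Dp\<close>, \<open>n1\<close>, \<open>n3\<close>, \<open>m0\<close>, \<open>m2\<close> are the
  \<open>2 \<times> 2\<close> minors they are made of.\<close>

definition Dm :: "(gen \<Rightarrow> 'k) \<Rightarrow> 'k" where
  "Dm v = (1 + \<alpha>) * (1 + \<beta>) * v X2 * v X3 - 2 * (1 - \<beta>) * v X0 * v X1"
definition Dp :: "(gen \<Rightarrow> 'k) \<Rightarrow> 'k" where
  "Dp v = (1 + \<alpha>) * (1 + \<beta>) * v X2 * v X3 + 2 * (1 - \<beta>) * v X0 * v X1"

text \<open>Sum and difference of the two minors are nonzero multiples of \<open>v X2 * v X3\<close>
  and \<open>v X0 * v X1\<close>, which cannot vanish together off the origin.\<close>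

lemma Dm_or_Dp:
  assumes "cone v" "v \<noteq> (\<lambda>_. 0)"
  shows "Dm v \<noteq> 0 \<or> Dp v \<noteq> 0"
proof (rule ccontr)
  assume "\<not> ?thesis"
  then have "Dm v = 0" "Dp v = 0" by auto
  moreover have "Dp v + Dm v = 2 * ((1 + \<alpha>) * (1 + \<beta>) * (v X2 * v X3))"
    "Dp v - Dm v = 4 * (1 - \<beta>) * (v X0 * v X1)"
    by (simp_all add: Dm_def Dp_def algebra_simps)
  ultimately have "v X2 = 0 \<or> v X3 = 0" "v X0 = 0 \<or> v X1 = 0" by auto
  then show False using cone_two_zeros[OF assms(1)] assms(2) by blast
qed

definition n1 where "n1 v = (1-\<alpha>)*(1-\<beta>) * v X1 * v X3 + 2*(1+\<alpha>) * v X0 * v X2"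
definition n3 where "n3 v = 4 * (v X0)\<^sup>2 + (1-\<alpha>)*(1+\<beta>) * (v X3)\<^sup>2"

text \<open>\<open>(n1, Dm, n3)\<close> is the cross product of the coefficient vectors of the two
  relations that involve only \<open>w X1\<close>, \<open>w X2\<close>, \<open>w X3\<close>.\<close>

lemma cross_m:
  assumes "rels v w"
  shows "n1 v * w X2 = Dm v * w X1" "n3 v * w X2 = Dm v * w X3" "n1 v * w X3 = n3 v * w X1"
proof -
  have A: "2 * v X0 * w X1 - (\<alpha> + 1) * v X2 * w X3 - (\<alpha> - 1) * v X3 * w X2 = 0" (is "?A = 0")
    and B: "2 * v X0 * w X2 - (\<beta> + 1) * v X3 * w X1 - (\<beta> - 1) * v X1 * w X3 = 0" (is "?B = 0")
    using assms unfolding rels_def by auto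
  have "n1 v * w X2 - Dm v * w X1 = (1 - \<beta>) * v X1 * ?A + (1 + \<alpha>) * v X2 * ?B"
    "n3 v * w X2 - Dm v * w X3 = (1 + \<beta>) * v X3 * ?A + 2 * v X0 * ?B"
    "n1 v * w X3 - n3 v * w X1 = (1 - \<alpha>) * v X3 * ?B - 2 * v X0 * ?A"
    unfolding n1_def n3_def Dm_def by (simp_all add: algebra_simps power2_eq_square)
  then show "n1 v * w X2 = Dm v * w X1" "n3 v * w X2 = Dm v * w X3" "n1 v * w X3 = n3 v * w X1"
    unfolding A B by simp_all
qed

definition m0 where "m0 v = 2*\<beta>*(1+\<alpha>) * v X1 * v X3 - (1-\<alpha>)*(1-\<beta>) * v X0 * v X2"
definition m2 where "m2 v = - (1-\<alpha>)*(1+\<beta>) * (v X2)\<^sup>2 - 4*\<beta> * (v X1)\<^sup>2"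

text \<open>Eliminating \<open>w X1\<close> from the pair of relations for \<open>X0\<close>,
  \<open>X2\<close> gives a relation in \<open>w X0\<close>, \<open>w X2\<close>,
  \<open>w X3\<close>. With the one for \<open>v X1 * w X0\<close> its cross product is
  \<open>(m0, m2, - Dp)\<close>.\<close>

lemma rels_b:
  assumes "rels v w"
  shows "(1+\<beta>) * v X2 * w X0 - (1-\<beta>) * v X0 * w X2 + 2*\<beta> * v X1 * w X3 = 0"
proof -
  have A: "2 * v X0 * w X2 = (\<beta> + 1) * v X3 * w X1 + (\<beta> - 1) * v X1 * w X3"
    and B: "2 * v X2 * w X0 = (1 - \<beta>) * v X3 * w X1 - (1 + \<beta>) * v X1 * w X3"
    using assms unfolding rels_def by auto
  have "2 * ((1+\<beta>) * v X2 * w X0 - (1-\<beta>) * v X0 * w X2 + 2*\<beta> * v X1 * w X3)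
     = (1+\<beta>) * (2 * v X2 * w X0) - (1-\<beta>) * (2 * v X0 * w X2) + 4*\<beta> * v X1 * w X3"
    by (simp add: algebra_simps)
  also have "\<dots> = 0" unfolding A B by (simp add: algebra_simps)
  finally show ?thesis using two_nz mult_eq_0_iff by blast
qed

lemma cross_p:
  assumes "rels v w"
  shows "m0 v * w X2 = m2 v * w X0" "m0 v * w X3 = - Dp v * w X0" "m2 v * w X3 = - Dp v * w X2"
proof -
  have A: "2 * v X1 * w X0 - (1 - \<alpha>) * v X2 * w X3 + (1 + \<alpha>) * v X3 * w X2 = 0" (is "?A = 0")
    using assms unfolding rels_def by auto
  have B: "(1+\<beta>) * v X2 * w X0 - (1-\<beta>) * v X0 * w X2 + 2*\<beta> * v X1 * w X3 = 0" (is "?B = 0")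
    by (rule rels_b[OF assms])
  have "m0 v * w X2 - m2 v * w X0 = 2*\<beta> * v X1 * ?A + (1-\<alpha>) * v X2 * ?B"
    "m0 v * w X3 + Dp v * w X0 = (1-\<beta>) * v X0 * ?A + (1+\<alpha>) * v X3 * ?B"
    "m2 v * w X3 + Dp v * w X2 = (1+\<beta>) * v X2 * ?A - 2 * v X1 * ?B"
    unfolding m0_def m2_def Dp_def by (simp_all add: algebra_simps power2_eq_square)
  then show "m0 v * w X2 = m2 v * w X0" "m0 v * w X3 = - Dp v * w X0" "m2 v * w X3 = - Dp v * w X2"
    unfolding A B by (simp_all add: eq_neg_iff_add_eq_0)
qed

text \<open>Members of the pencil of quadrics through E: those that arise as coefficients when the
  central elements are evaluated on the minor vectors.\<close>

lemma cone_forms: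
  assumes C: "cone v"
  shows "- (1-\<alpha>) * (v X0)\<^sup>2 + \<alpha>*(1+\<beta>) * (v X3)\<^sup>2 + (\<alpha>+\<beta>) * (v X1)\<^sup>2 = 0" (is ?A)
    and "(4 - (1+\<alpha>)*(1-\<beta>)) * (v X0)\<^sup>2 + (1-\<alpha>)*(1-\<beta>)*(v X1)\<^sup>2
       + (1+\<alpha>)*(1+\<beta>)*(v X2)\<^sup>2 + (1-\<alpha>)*(1+\<beta>)*(v X3)\<^sup>2 = 0" (is ?B)
    and "(1-\<beta>)*(1+\<gamma>)*(1-\<alpha>)*(1-\<beta>)*(v X1)\<^sup>2 + (1+\<alpha>)*(1+\<alpha>)*(1+\<gamma>)*(1+\<beta>)*(v X2)\<^sup>2
       + (1-\<alpha>)*(1-\<beta>)*(4*(v X0)\<^sup>2 + (1-\<alpha>)*(1+\<beta>)*(v X3)\<^sup>2) = 0" (is ?C)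
    and "(\<alpha>+\<beta>) * (v X2)\<^sup>2 + (1+\<beta>) * (v X0)\<^sup>2 + \<beta>*(1-\<alpha>) * (v X3)\<^sup>2 = 0" (is ?D)
    and "\<beta>*(1-\<alpha>) * (v X1)\<^sup>2 - \<alpha>*(1+\<beta>) * (v X2)\<^sup>2 - (1+\<alpha>*\<beta>) * (v X0)\<^sup>2 = 0" (is ?F)
    and "((1-\<beta>)*(1+\<alpha>)+4*\<beta>) * (v X1)\<^sup>2 + (1-\<alpha>)*(1+\<beta>) * (v X2)\<^sup>2
       + (1+\<alpha>)*(1+\<beta>) * (v X3)\<^sup>2 - (1-\<alpha>)*(1-\<beta>) * (v X0)\<^sup>2 = 0" (is ?G)
    and "(1+\<beta>) * (v X1)\<^sup>2 + (1-\<alpha>) * (v X2)\<^sup>2 + (1+\<alpha>*\<beta>) * (v X3)\<^sup>2 = 0" (is ?H)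
proof -
  have *: "x = 0" if "(1+\<alpha>)*(1-\<beta>) * x = 0" for x :: 'k using that by simp
  have **: "x = 0" if "(1+\<gamma>)*((1+\<alpha>)*(1-\<beta>) * x) = 0" for x :: 'k using that by simp
  note hyps = C[unfolded cone_def] param_eq
  show ?A by (rule *) (use hyps in Groebner_Basis.algebra)
  show ?B by (rule *) (use hyps in Groebner_Basis.algebra)
  show ?C by (rule *) (use hyps in Groebner_Basis.algebra)
  show ?D by (rule *) (use hyps in Groebner_Basis.algebra)
  show ?F by (rule *) (use hyps in Groebner_Basis.algebra)
  show ?G by (rule *) (use hyps in Groebner_Basis.algebra)
  show ?H by (rule **) (use hyps in Groebner_Basis.algebra)
qed

text \<open>This makes evaluation along orbits descend from A to B. With a minor vector substituted
  for \<open>w\<close>, and a coordinate multiplied in where a relation has to supply the remaining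
  entry of \<open>w\<close>, both expressions become combinations of quadrics vanishing on the cone;
  the multipliers come in pairs without common zero.\<close>

lemma rels_omega:
  assumes r: "rels v w" and C: "cone v" and nz: "v \<noteq> (\<lambda>_. 0)"
  shows "v X1 * w X1 + v X2 * w X2 + v X3 * w X3 - v X0 * w X0 = 0" (is "?O1 = 0")
    and "(1-\<beta>)*(1+\<gamma>) * v X1 * w X1 + (1+\<alpha>)*(1+\<gamma>) * v X2 * w X2
      + (1-\<alpha>)*(1-\<beta>) * v X3 * w X3 = 0" (is "?O2 = 0")
proof -
  let ?f = "(4 - (1+\<alpha>)*(1-\<beta>)) * (v X0)\<^sup>2 + (1-\<alpha>)*(1-\<beta>)*(v X1)\<^sup>2
       + (1+\<alpha>)*(1+\<beta>)*(v X2)\<^sup>2 + (1-\<alpha>)*(1+\<beta>)*(v X3)\<^sup>2"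
  let ?g = "(1-\<beta>)*(1+\<gamma>)*(1-\<alpha>)*(1-\<beta>)*(v X1)\<^sup>2 + (1+\<alpha>)*(1+\<alpha>)*(1+\<gamma>)*(1+\<beta>)*(v X2)\<^sup>2
       + (1-\<alpha>)*(1-\<beta>)*(4*(v X0)\<^sup>2 + (1-\<alpha>)*(1+\<beta>)*(v X3)\<^sup>2)"
  let ?h = "((1-\<beta>)*(1+\<alpha>)+4*\<beta>) * (v X1)\<^sup>2 + (1-\<alpha>)*(1+\<beta>) * (v X2)\<^sup>2
       + (1+\<alpha>)*(1+\<beta>) * (v X3)\<^sup>2 - (1-\<alpha>)*(1-\<beta>) * (v X0)\<^sup>2"
  note F = cone_forms[OF C]
  from r have a: "2 * v X0 * w X1 = (\<alpha> + 1) * v X2 * w X3 + (\<alpha> - 1) * v X3 * w X2"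
    and a': "2 * v X1 * w X0 = (1 - \<alpha>) * v X2 * w X3 - (1 + \<alpha>) * v X3 * w X2"
    and b: "(1+\<beta>) * v X3 * w X1 = 2 * v X0 * w X2 + (1-\<beta>) * v X1 * w X3"
    and b': "2 * v X2 * w X0 = (1 - \<beta>) * v X3 * w X1 - (1 + \<beta>) * v X1 * w X3"
    unfolding rels_def by (auto simp: algebra_simps)
  have "?O1 = 0 \<and> ?O2 = 0"
  proof (cases "Dm v = 0")
    case False
    define t where "t = w X2 / Dm v"
    have w: "w X1 = t * n1 v" "w X2 = t * Dm v" "w X3 = t * n3 v"
      using cross_m[OF r] False by (simp_all add: t_def field_simps)
    have "?O2 = 2 * t * v X3 * ?g - t * v X3 * ?g"
      unfolding w n1_def n3_def Dm_def by (simp add: algebra_simps power2_eq_square)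
    then have O2: "?O2 = 0" unfolding F by simp
    have "v X1 \<noteq> 0 \<or> v X2 \<noteq> 0" using cone_two_zeros[OF C, of X1 X2] nz by auto
    moreover have "2 * v X1 * ?O1 = 0"
    proof -
      have "2 * v X1 * ?O1 = 2 * v X1 * (v X1 * w X1 + v X2 * w X2 + v X3 * w X3) - v X0 * (2 * v X1 * w X0)"
        by (simp add: algebra_simps)
      also have "\<dots> = t * (4 * v X0 * v X2 * (- (1-\<alpha>) * (v X0)\<^sup>2 + \<alpha>*(1+\<beta>) * (v X3)\<^sup>2 + (\<alpha>+\<beta>) * (v X1)\<^sup>2)
        + 2 * v X1 * v X3 * ?f)"
        unfolding a' w n1_def n3_def Dm_def by (simp add: algebra_simps power2_eq_square)
      finally show ?thesis unfolding F by simp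
    qed
    moreover have "2 * v X2 * ?O1 = 0"
    proof -
      have "2 * v X2 * ?O1 = 2 * v X2 * (v X1 * w X1 + v X2 * w X2 + v X3 * w X3) - v X0 * (2 * v X2 * w X0)"
        by (simp add: algebra_simps)
      also have "\<dots> = t * (4 * v X0 * v X1 * ((\<alpha>+\<beta>) * (v X2)\<^sup>2 + (1+\<beta>) * (v X0)\<^sup>2 + \<beta>*(1-\<alpha>) * (v X3)\<^sup>2)
        + 2 * v X2 * v X3 * ?f)"
        unfolding b' w n1_def n3_def Dm_def by (simp add: algebra_simps power2_eq_square)
      finally show ?thesis unfolding F by simp
    qed
    ultimately have "?O1 = 0" by fastforce
    with O2 show ?thesis by simp
  next
    case True
    then have D: "Dp v \<noteq> 0" using Dm_or_Dp[OF C nz] by simp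
    define t where "t = - w X3 / Dp v"
    have w: "w X0 = t * m0 v" "w X2 = t * m2 v" "w X3 = t * - Dp v"
      using cross_p[OF r] D by (simp_all add: t_def field_simps)
    \<comment> \<open>The factor 1 + \<gamma> turns 1 + \<alpha> \<beta> into (1 - \<alpha>)(1 -
      \<beta>), the shape in which these quadrics enter the second expression.\<close>
    have G: "(1-\<beta>)*(1+\<gamma>) * (\<beta>*(1-\<alpha>) * (v X1)\<^sup>2 - \<alpha>*(1+\<beta>) * (v X2)\<^sup>2) = (1-\<alpha>)*(1-\<beta>)*(1-\<beta>) * (v X0)\<^sup>2"
      using F(5) param_prod(1) by Groebner_Basis.algebra
    have H: "(1+\<gamma>) * ((1+\<beta>) * (v X1)\<^sup>2 + (1-\<alpha>) * (v X2)\<^sup>2) = - (1-\<alpha>) * (1-\<beta>) * (v X3)\<^sup>2"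
      using F(7) param_prod(1) by Groebner_Basis.algebra
    have "v X0 \<noteq> 0 \<or> v X3 \<noteq> 0" using cone_two_zeros[OF C, of X0 X3] nz by auto
    moreover have "2 * v X0 * ?O1 = 0"
    proof -
      have "2 * v X0 * ?O1 = v X1 * (2 * v X0 * w X1) + 2 * v X0 * (v X2 * w X2 + v X3 * w X3 - v X0 * w X0)"
        by (simp add: algebra_simps)
      also have "\<dots> = t * (4 * v X1 * v X3 * (\<beta>*(1-\<alpha>) * (v X1)\<^sup>2 - \<alpha>*(1+\<beta>) * (v X2)\<^sup>2 - (1+\<alpha>*\<beta>) * (v X0)\<^sup>2)
        - 2 * v X0 * v X2 * ?h)"
        unfolding a w m0_def m2_def Dp_def by (simp add: algebra_simps power2_eq_square)
      finally show ?thesis unfolding F by simp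
    qed
    moreover have "(1+\<beta>) * v X3 * ?O1 = 0"
    proof -
      have "(1+\<beta>) * v X3 * ?O1 = v X1 * ((1+\<beta>) * v X3 * w X1) + (1+\<beta>) * v X3 * (v X2 * w X2 + v X3 * w X3
        - v X0 * w X0)"
        by (simp add: algebra_simps)
      also have "\<dots> = t * (- (1+\<beta>) * v X2 * v X3 * ?h
        - 2 * (1+\<beta>) * v X0 * v X1 * ((1+\<beta>) * (v X1)\<^sup>2 + (1-\<alpha>) * (v X2)\<^sup>2 + (1+\<alpha>*\<beta>) * (v X3)\<^sup>2))"
        unfolding b w m0_def m2_def Dp_def by (simp add: algebra_simps power2_eq_square)
      finally show ?thesis unfolding F by simp
    qed
    moreover have "2 * v X0 * ?O2 = 0"
    proof -
      have "2 * v X0 * ?O2 = (1-\<beta>)*(1+\<gamma>) * v X1 * (2 * v X0 * w X1)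
          + 2 * v X0 * ((1+\<alpha>)*(1+\<gamma>) * v X2 * w X2 + (1-\<alpha>)*(1-\<beta>) * v X3 * w X3)"
        by (simp add: algebra_simps)
      also have "\<dots> = t * (4 * v X1 * v X3 * ((1-\<beta>)*(1+\<gamma>) * (\<beta>*(1-\<alpha>) * (v X1)\<^sup>2 - \<alpha>*(1+\<beta>) * (v X2)\<^sup>2)
        - (1-\<alpha>)*(1-\<beta>)*(1-\<beta>) * (v X0)\<^sup>2)
        - 2 * (1+\<alpha>) * (1+\<beta>) * v X0 * v X2 * ((1+\<gamma>) * ((1+\<beta>) * (v X1)\<^sup>2 + (1-\<alpha>) * (v X2)\<^sup>2) - - (1-\<alpha>) * (1-\<beta>)
          * (v X3)\<^sup>2))"
        unfolding a w m0_def m2_def Dp_def by (simp add: algebra_simps power2_eq_square)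
      finally show ?thesis unfolding G H by simp
    qed
    moreover have "(1+\<beta>) * v X3 * ?O2 = 0"
    proof -
      have "(1+\<beta>) * v X3 * ?O2 = (1-\<beta>)*(1+\<gamma>) * v X1 * ((1+\<beta>) * v X3 * w X1)
          + (1+\<beta>) * v X3 * ((1+\<alpha>)*(1+\<gamma>) * v X2 * w X2 + (1-\<alpha>)*(1-\<beta>) * v X3 * w X3)"
        by (simp add: algebra_simps)
      also have "\<dots> = - t * (2 * (1-\<beta>) * v X0 * v X1 + (1+\<alpha>) * (1+\<beta>) * v X2 * v X3) * (1+\<beta>)
         * ((1+\<gamma>) * ((1+\<beta>) * (v X1)\<^sup>2 + (1-\<alpha>) * (v X2)\<^sup>2) - - (1-\<alpha>) * (1-\<beta>) * (v X3)\<^sup>2)"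
        unfolding b w m0_def m2_def Dp_def by (simp add: algebra_simps power2_eq_square)
      finally show ?thesis unfolding G H by simp
    qed
    ultimately show ?thesis by fastforce
  qed
  then show "?O1 = 0" "?O2 = 0" by auto
qed

section \<open>Polynomial formulas for the successor of a point\<close>

definition parallel :: "(gen \<Rightarrow> 'k) \<Rightarrow> (gen \<Rightarrow> 'k) \<Rightarrow> bool" where
  "parallel u w \<longleftrightarrow> (\<forall>i j. u i * w j = u j * w i)"

fun Qa where
  "Qa v X0 = (1-\<alpha>) * v X2 * n3 v - (1+\<alpha>) * v X3 * Dm v"
| "Qa v X1 = 2 * v X1 * n1 v"
| "Qa v X2 = 2 * v X1 * Dm v"
| "Qa v X3 = 2 * v X1 * n3 v"

fun Qb where
  "Qb v X0 = (1-\<beta>) * v X3 * n1 v - (1+\<beta>) * v X1 * n3 v"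
| "Qb v X1 = 2 * v X2 * n1 v"
| "Qb v X2 = 2 * v X2 * Dm v"
| "Qb v X3 = 2 * v X2 * n3 v"

fun Qc where
  "Qc v X0 = 2 * v X0 * m0 v"
| "Qc v X1 = (\<alpha>-1) * v X3 * m2 v - (\<alpha>+1) * v X2 * Dp v"
| "Qc v X2 = 2 * v X0 * m2 v"
| "Qc v X3 = - 2 * v X0 * Dp v"

fun Qd where
  "Qd v X0 = (1+\<beta>) * v X3 * m0 v"
| "Qd v X1 = 2 * v X0 * m2 v - (1-\<beta>) * v X1 * Dp v"
| "Qd v X2 = (1+\<beta>) * v X3 * m2 v"
| "Qd v X3 = - (1+\<beta>) * v X3 * Dp v"

lemma parI:
  assumes "u X0 * w X1 = u X1 * w X0" "u X0 * w X2 = u X2 * w X0" "u X0 * w X3 = u X3 * w X0"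
    "u X1 * w X2 = u X2 * w X1" "u X1 * w X3 = u X3 * w X1" "u X2 * w X3 = u X3 * w X2"
  shows "parallel u w"
  unfolding parallel_def
proof (intro allI)
  fix i j show "u i * w j = u j * w i"
    by (cases i; cases j) (use assms in \<open>simp_all add: algebra_simps\<close>)
qed

lemma parallel_Q:
  assumes "rels v w"
  shows "parallel (Qa v) w" "parallel (Qb v) w" "parallel (Qc v) w" "parallel (Qd v) w"
proof -
  note m = cross_m[OF assms] and p = cross_p[OF assms]
  from assms have a: "2 * v X0 * w X1 = (\<alpha> + 1) * v X2 * w X3 + (\<alpha> - 1) * v X3 * w X2"
    and a': "2 * v X1 * w X0 = (1 - \<alpha>) * v X2 * w X3 - (1 + \<alpha>) * v X3 * w X2"
    and b: "(1+\<beta>) * v X3 * w X1 = 2 * v X0 * w X2 + (1-\<beta>) * v X1 * w X3"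
    and b': "2 * v X2 * w X0 = (1 - \<beta>) * v X3 * w X1 - (1 + \<beta>) * v X1 * w X3"
    unfolding rels_def by (auto simp: algebra_simps)
  show "parallel (Qa v) w" by (rule parI; simp; use m a' in Groebner_Basis.algebra)
  show "parallel (Qb v) w" by (rule parI; simp; use m b' in Groebner_Basis.algebra)
  show "parallel (Qc v) w" by (rule parI; simp; use p a in Groebner_Basis.algebra)
  show "parallel (Qd v) w" by (rule parI; simp; use p b in Groebner_Basis.algebra)
qed

text \<open>The zero vector is \<open>parallel\<close> to everything, so a formula is informative
  only where it does not vanish. A nonzero \<open>Dm\<close> or \<open>Dp\<close> times a nonzero
  scaling coordinate always provides one.\<close>

lemma Q_nonzero:
  assumes "cone v" "v \<noteq> (\<lambda>_. 0)"
  shows "Qa v X2 \<noteq> 0 \<or> Qb v X2 \<noteq> 0 \<or> Qc v X3 \<noteq> 0 \<or> Qd v X3 \<noteq> 0"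
  using Dm_or_Dp[OF assms] cone_two_zeros[OF assms(1), of X1 X2] cone_two_zeros[OF assms(1), of X0 X3] assms(2)
  by auto

end

section \<open>Irreducibility of the cone over \<open>E\<close>\<close>

text \<open>Were the field finite, the product of all X - a, plus one, would be a nonconstant
  polynomial without roots.\<close>

lemma infinite_alg_closed: "infinite (UNIV :: 'a :: alg_closed_field set)"
proof
  assume fin: "finite (UNIV :: 'a set)"
  define p :: "'a poly" where "p = (\<Prod>a\<in>UNIV. [:- a, 1:])"
  have "degree p = card (UNIV :: 'a set)"
    unfolding p_def by (subst degree_prod_sum_eq) simp_all
  then have "degree p > 0" using fin by (simp add: card_gt_0_iff)
  then have "degree (p + 1) > 0"
    by (metis degree_1 degree_add_eq_left)
  then obtain x where "poly (p + 1) x = 0" using alg_closed_imp_poly_has_root by blast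
  moreover have "poly p x = 0"
    unfolding p_def poly_prod using fin by (intro prod_zero) auto
  ultimately show False by simp
qed

text \<open>The multiplicity of \<open>r\<close> would be even on the left and odd on the
  right.\<close>

lemma order_odd_not_square:
  fixes u w h :: "'a :: idom poly"
  assumes "u\<^sup>2 = w\<^sup>2 * h" "h \<noteq> 0" "odd (order r h)"
  shows "u = 0 \<and> w = 0"
proof (rule ccontr)
  assume "\<not> ?thesis"
  then have "w \<noteq> 0" "u \<noteq> 0" using assms by auto
  then have "order r (u * u) = order r u + order r u" "order r (w * w * h) = order r w + order r w + order r h"
    using assms(2) by (simp_all add: order_mult)
  moreover have "u * u = w * w * h" using assms(1) by (simp add: power2_eq_square)
  ultimately have "order r u + order r u = order r w + order r w + order r h" by simp
  then show False using assms(3) by presburger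
qed

lemma order_quadratic:
  fixes c r :: "'a :: idom"
  assumes "c \<noteq> 0" "2 * r \<noteq> 0"
  shows "order r (smult c ([:- r, 1:] * [:r, 1:])) = 1"
proof -
  have "poly [:r, 1:] r = 2 * r" by (simp only: poly_pCons poly_0 mult_2) simp
  then have 1: "order r [:r, 1:] = 0" using assms(2) by (intro order_0I) metis
  have 2: "order r [:- r, 1:] = 1" using order_power_n_n[of r 1] by (simp only: power_one_right)
  have "[:- r, 1:] \<noteq> 0" "[:r, 1:] \<noteq> 0" by simp_all
  then have h: "[:- r, 1:] * [:r, 1:] \<noteq> 0" using mult_eq_0_iff by blast
  have "order r ([:- r, 1:] * [:r, 1:]) = order r [:- r, 1:] + order r [:r, 1:]"
    by (rule order_mult[OF h])
  also have "\<dots> = 1"  by (subst 1, subst 2) simp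
  finally show ?thesis unfolding order_smult[OF assms(1)] .
qed

text \<open>A bivariate polynomial is a polynomial in its first variable over k[y]; thus
  \<open>order\<close> at elements of k[y] decides questions about squares.\<close>

definition eval2 :: "'a :: comm_ring_1 poly poly \<Rightarrow> 'a \<Rightarrow> 'a \<Rightarrow> 'a" where
  "eval2 a x y = poly (poly a [:x:]) y"

lemma eval2_simps [simp]:
  "eval2 0 x y = 0" "eval2 1 x y = 1" "eval2 (a + b) x y = eval2 a x y + eval2 b x y"
    "eval2 (a * b) x y = eval2 a x y * eval2 b x y"
  "eval2 (a - b) x y = eval2 a x y - eval2 b x y" "eval2 (a ^ n) x y = eval2 a x y ^ n"
    "eval2 (numeral m) x y = numeral m"
  by (simp_all add: eval2_def)

lemma eval2_zero:
  fixes a :: "'a :: alg_closed_field poly poly"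
  assumes "\<And>x y. eval2 a x y = 0"
  shows "a = 0"
proof (rule ccontr)
  assume "a \<noteq> 0"
  have "poly a [:x:] = 0" for x
  proof (rule ccontr)
    assume "poly a [:x:] \<noteq> 0"
    then have "finite {y. poly (poly a [:x:]) y = 0}" by (rule poly_roots_finite)
    moreover have "{y. poly (poly a [:x:]) y = 0} = UNIV" using assms[of x] by (auto simp: eval2_def)
    ultimately show False using infinite_alg_closed by metis
  qed
  then have "range (\<lambda>x. [:x:]) \<subseteq> {z. poly a z = 0}" by auto
  moreover have "finite {z. poly a z = 0}" using \<open>a \<noteq> 0\<close> by (rule poly_roots_finite)
  ultimately have "finite (range (\<lambda>x :: 'a. [:x:]))" by (rule finite_subset)
  moreover have "inj (\<lambda>x :: 'a. [:x:])" by (auto intro: injI)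
  ultimately show False using infinite_alg_closed finite_imageD by blast
qed

text \<open>Functions instead of formal polynomials: closure under substitution and the existence of
  normal forms on the cone become plain inductions.\<close>

inductive_set polyfun :: "(('i \<Rightarrow> 'a :: comm_ring_1) \<Rightarrow> 'a) set" where
  const: "(\<lambda>v. c) \<in> polyfun"
| coord: "(\<lambda>v. v i) \<in> polyfun"
| add: "F \<in> polyfun \<Longrightarrow> G \<in> polyfun \<Longrightarrow> (\<lambda>v. F v + G v) \<in> polyfun"
| mult: "F \<in> polyfun \<Longrightarrow> G \<in> polyfun \<Longrightarrow> (\<lambda>v. F v * G v) \<in> polyfun"

lemma polyfun_uminus: "F \<in> polyfun \<Longrightarrow> (\<lambda>v. - F v) \<in> polyfun"
  using polyfun.mult[OF polyfun.const[of "- 1"], of F] by simp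

lemma polyfun_diff: "F \<in> polyfun \<Longrightarrow> G \<in> polyfun \<Longrightarrow> (\<lambda>v. F v - G v) \<in> polyfun"
  using polyfun.add[OF _ polyfun_uminus, of F G] by simp

lemma polyfun_power: "F \<in> polyfun \<Longrightarrow> (\<lambda>v. F v ^ n) \<in> polyfun"
  by (induction n) (auto intro: polyfun.intros)

lemma polyfun_sum: "(\<And>x. x \<in> A \<Longrightarrow> F x \<in> polyfun) \<Longrightarrow> (\<lambda>v. \<Sum>x\<in>A. F x v) \<in> polyfun"
  by (induction A rule: infinite_finite_induct) (auto intro: polyfun.intros)

lemma polyfun_comp:
  assumes "F \<in> polyfun" "\<And>i. (\<lambda>v. Q v i) \<in> polyfun"
  shows "(\<lambda>v. F (Q v)) \<in> polyfun"
  using assms(1) by induction (auto intro: polyfun.intros assms(2))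

lemmas polyfun_intros = polyfun.intros polyfun_uminus polyfun_diff polyfun_power polyfun_sum

context sklyanin begin

section \<open>The coordinate ring of the cone\<close>

definition f1 where "f1 = - (\<alpha> + \<gamma>) / (1 + \<alpha>)"
definition f2 where "f2 = (\<beta> + \<gamma>) / (1 - \<beta>)"
definition g1 where "g1 = - (1 - \<gamma>) / (1 + \<alpha>)"
definition g2 where "g2 = - (1 + \<gamma>) / (1 - \<beta>)"

text \<open>The cone equations solved for two squares: two square roots of binary quadratic forms
  are adjoined to k[y1, y2].\<close>

lemma cone_iff:
  "cone v \<longleftrightarrow> (v X0)\<^sup>2 = f1 * (v X1)\<^sup>2 + f2 * (v X2)\<^sup>2 \<and> (v X3)\<^sup>2 = g1 * (v X1)\<^sup>2 + g2 * (v X2)\<^sup>2"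
proof -
  have 1: "(v X3)\<^sup>2 = g1 * (v X1)\<^sup>2 + g2 * (v X2)\<^sup>2 \<longleftrightarrow> (1 + \<alpha>) * (1 - \<beta>) * (v X3)\<^sup>2 + (1 - \<gamma>) * (1 - \<beta>) * (v X1)\<^sup>2
       + (1 + \<gamma>) * (1 + \<alpha>) * (v X2)\<^sup>2 = 0" (is "?L \<longleftrightarrow> ?R")
  proof -
    have "(1 + \<alpha>) * (1 - \<beta>) * ((v X3)\<^sup>2 - (g1 * (v X1)\<^sup>2 + g2 * (v X2)\<^sup>2)) = (1 + \<alpha>) * (1 - \<beta>) * (v X3)\<^sup>2 + (1
      - \<gamma>) * (1 - \<beta>) * (v X1)\<^sup>2
       + (1 + \<gamma>) * (1 + \<alpha>) * (v X2)\<^sup>2"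
      unfolding g1_def g2_def by (simp add: divide_simps) (simp add: algebra_simps)
    then have "?R \<longleftrightarrow> (1 + \<alpha>) * (1 - \<beta>) * ((v X3)\<^sup>2 - (g1 * (v X1)\<^sup>2 + g2 * (v X2)\<^sup>2)) = 0" by simp
    then show ?thesis by simp
  qed
  have fg: "f1 = - 1 - g1" "f2 = - 1 - g2"
    unfolding f1_def g1_def f2_def g2_def by (simp_all add: divide_simps)
  have "(v X0)\<^sup>2 = f1 * (v X1)\<^sup>2 + f2 * (v X2)\<^sup>2 \<longleftrightarrow> (v X0)\<^sup>2 + (v X1)\<^sup>2 + (v X2)\<^sup>2 + (v X3)\<^sup>2 = 0" if ?L
  proof -
    have "(v X0)\<^sup>2 + (v X1)\<^sup>2 + (v X2)\<^sup>2 + (v X3)\<^sup>2 = (v X0)\<^sup>2 - (f1 * (v X1)\<^sup>2 + f2 * (v X2)\<^sup>2)"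
      unfolding that fg by (simp add: algebra_simps)
    then show ?thesis by (simp only: right_minus_eq)
  qed
  then show ?thesis unfolding cone_def using 1 by blast
qed

text \<open>The last inequality says that the two forms have no common root; the difference of its
  sides is \<gamma>.\<close>

lemma fg_nz: "f1 \<noteq> 0" "f2 \<noteq> 0" "g1 \<noteq> 0" "g2 \<noteq> 0" "f1 * g2 \<noteq> g1 * f2"
proof -
  show "f1 \<noteq> 0" "f2 \<noteq> 0" "g1 \<noteq> 0" "g2 \<noteq> 0"
    unfolding f1_def f2_def g1_def g2_def using param_sum_nz param_nz
      by (simp_all only: divide_eq_0_iff neg_equal_0_iff_equal minus_equation_iff) simp_all
  have "f1 * g2 - g1 * f2 = - (1 + g1) * g2 + g1 * (1 + g2)"
    unfolding f1_def g1_def f2_def g2_def by (simp add: divide_simps) (simp add: algebra_simps)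
  also have "\<dots> = g1 - g2" by (simp add: algebra_simps)
  also have "(1 + \<alpha>) * (1 - \<beta>) * (g1 - g2) = \<gamma> * ((1 + \<alpha>) * (1 - \<beta>))"
  proof -
    have "(1 + \<alpha>) * (1 - \<beta>) * (g1 - g2) = (1 + \<gamma>) * (1 + \<alpha>) - (1 - \<gamma>) * (1 - \<beta>)"
      unfolding g1_def g2_def by (simp add: divide_simps) (simp add: algebra_simps)
    also have "\<dots> = \<gamma> * ((1 + \<alpha>) * (1 - \<beta>))" using param_eq by Groebner_Basis.algebra
    finally show ?thesis .
  qed
  then have "g1 - g2 \<noteq> 0" by (metis mult_eq_0_iff param_nz(3,4,8))
  finally show "f1 * g2 \<noteq> g1 * f2" by simp
qed

definition fp :: "'k poly poly" where "fp = [:[:0,0,f2:], 0, [:f1:]:]"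
definition gp :: "'k poly poly" where "gp = [:[:0,0,g2:], 0, [:g1:]:]"

text \<open>The form c X^2 + d Y^2 splits as c (X - t Y)(X + t Y), with distinct roots since 2 is
  invertible; \<open>[:0,t:]\<close> is the root t Y.\<close>

lemma quad_order:
  fixes c d :: 'k
  assumes "c \<noteq> 0" "d \<noteq> 0"
  obtains t where "t \<noteq> 0" "c * t\<^sup>2 + d = 0" "order [:0,t:] [:[:0,0,d:], 0, [:c:]:] = 1"
proof -
  obtain t where t: "t\<^sup>2 = - d / c" using nth_root_exists[of 2 "- d / c"] by auto
  then have t': "c * t\<^sup>2 + d = 0" using assms by (simp add: field_simps)
  have tn: "t \<noteq> 0" using t assms by auto
  have "[:[:0,0,d:], 0, [:c:]:] = smult [:c:] ([:- [:0,t:], 1:] * [:[:0,t:], 1:])"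
    using t' by (simp add: power2_eq_square eq_neg_iff_add_eq_0 add.commute mult.commute)
  moreover have "order [:0,t:] (smult [:c:] ([:- [:0,t:], 1:] * [:[:0,t:], 1:])) = 1"
  proof (rule order_quadratic)
    have "2 * [:0,t:] = [:0, 2*t:]" unfolding mult_2 by (simp only: add_pCons add_0_right)
    moreover have "2 * t \<noteq> 0" using tn by simp
    ultimately show "2 * [:0,t:] \<noteq> 0" by (metis pCons_eq_0_iff)
  qed (use assms in simp)
  ultimately show ?thesis using that tn t' by metis
qed

text \<open>Each of the three polynomials has a root of multiplicity one; for the product, a root of
  \<open>fp\<close> works because it is no root of \<open>gp\<close>.\<close>

lemma not_square:
  fixes u w :: "'k poly poly"
  shows "u\<^sup>2 = w\<^sup>2 * fp \<Longrightarrow> u = 0 \<and> w = 0" "u\<^sup>2 = w\<^sup>2 * gp \<Longrightarrow> u = 0 \<and> w = 0"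
    "u\<^sup>2 = w\<^sup>2 * (fp * gp) \<Longrightarrow> u = 0 \<and> w = 0"
proof -
  have nz: "fp \<noteq> 0" "gp \<noteq> 0" using fg_nz by (auto simp: fp_def gp_def)
  obtain t where t: "t \<noteq> 0" "f1 * t\<^sup>2 + f2 = 0" "order [:0,t:] fp = 1"
    unfolding fp_def using quad_order[OF fg_nz(1,2)] .
  obtain s where s: "order [:0,s:] gp = 1"
    unfolding gp_def using quad_order[OF fg_nz(3,4)] .
  have "g2 + t\<^sup>2 * g1 \<noteq> 0"
  proof
    assume "g2 + t\<^sup>2 * g1 = 0"
    then have "f1 * g2 - g1 * f2 = 0" using t(2) by Groebner_Basis.algebra
    then show False using fg_nz by simp
  qed
  then have "poly gp [:0,t:] \<noteq> 0" by (simp add: gp_def power2_eq_square ac_simps)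
  then have "order [:0,t:] gp = 0" by (rule order_0I)
  then have "order [:0,t:] (fp * gp) = 1" using t nz by (simp add: order_mult)
  then have "odd (order [:0,t:] (fp * gp))" "odd (order [:0,t:] fp)" "odd (order [:0,s:] gp)"
    using t(3) s by presburger+
  moreover have "fp * gp \<noteq> 0" using nz by (simp only: mult_eq_0_iff) blast
  ultimately show "u\<^sup>2 = w\<^sup>2 * fp \<Longrightarrow> u = 0 \<and> w = 0" "u\<^sup>2 = w\<^sup>2 * gp \<Longrightarrow> u = 0 \<and> w = 0"
    "u\<^sup>2 = w\<^sup>2 * (fp * gp) \<Longrightarrow> u = 0 \<and> w = 0"
    using order_odd_not_square nz by blast+
qed

text \<open>The hypotheses say \<open>(a + c * sqrt gp)^2 = fp * (b + d * sqrt gp)^2\<close>.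
  Multiplication by the squared conjugate of \<open>b + d * sqrt gp\<close> yields
  \<open>(a' + c' * sqrt gp)^2 = fp * n^2\<close>, where \<open>n\<close> is a norm. Unless
  \<open>n = 0\<close>, this makes \<open>fp\<close> or \<open>fp * gp\<close> a square of a
  fraction.\<close>

lemma norm_zero:
  fixes a b c d :: "'k poly poly"
  assumes u: "a\<^sup>2 + c\<^sup>2 * gp = (b\<^sup>2 + d\<^sup>2 * gp) * fp" and w: "a * c = b * d * fp"
  shows "a = 0 \<and> b = 0 \<and> c = 0 \<and> d = 0"
proof -
  define n where "n = b\<^sup>2 - d\<^sup>2 * gp"
  define a' where "a' = a * b - c * d * gp"
  define c' where "c' = b * c - a * d"
  have "a' * c' = (a * c) * (b\<^sup>2 + d\<^sup>2 * gp) - b * d * (a\<^sup>2 + c\<^sup>2 * gp)"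
    unfolding a'_def c'_def by (simp add: algebra_simps power2_eq_square)
  also have "\<dots> = 0" unfolding u w by (simp add: algebra_simps)
  finally have 1: "a' * c' = 0" .
  have "a'\<^sup>2 + c'\<^sup>2 * gp = (a\<^sup>2 + c\<^sup>2 * gp) * (b\<^sup>2 + d\<^sup>2 * gp) - 4 * (a * c) * (b * d) * gp"
    unfolding a'_def c'_def by (simp add: algebra_simps power2_eq_square)
  also have "\<dots> = n\<^sup>2 * fp"
    unfolding u w n_def by (simp add: algebra_simps power2_eq_square)
  finally have 2: "a'\<^sup>2 + c'\<^sup>2 * gp = n\<^sup>2 * fp" .
  have "n = 0"
  proof (cases "c' = 0")
    case True
    then show ?thesis using 2 not_square(1)[of a' n] by simp
  next
    case False
    then have "c'\<^sup>2 * gp = n\<^sup>2 * fp" using 1 2 by simp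
    then have "(c'\<^sup>2 * gp) * gp = (n\<^sup>2 * fp) * gp" by simp
    then have "(c' * gp)\<^sup>2 = n\<^sup>2 * (fp * gp)" by (simp add: power2_eq_square algebra_simps)
    then show ?thesis using not_square(3) by blast
  qed
  then have "b\<^sup>2 = d\<^sup>2 * gp" by (simp add: n_def)
  then have bd: "b = 0" "d = 0" using not_square(2) by blast+
  then have "a = 0 \<or> c = 0" "a\<^sup>2 + c\<^sup>2 * gp = 0" using u w by auto
  moreover have "gp \<noteq> 0" using fg_nz by (auto simp: gp_def)
  ultimately show ?thesis using bd by auto
qed

lemma eval2_fg: "eval2 fp x y = f1 * x\<^sup>2 + f2 * y\<^sup>2" "eval2 gp x y = g1 * x\<^sup>2 + g2 * y\<^sup>2"
  by (simp_all add: eval2_def fp_def gp_def power2_eq_square algebra_simps)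

definition cone_nf where
  "cone_nf a b c d v = eval2 a (v X1) (v X2) + eval2 b (v X1) (v X2) * v X0 + eval2 c (v X1) (v X2) * v X3
     + eval2 d (v X1) (v X2) * v X0 * v X3"

lemma polyfun_nf:
  assumes "F \<in> polyfun"
  shows "\<exists>a b c d. \<forall>v. cone v \<longrightarrow> F v = cone_nf a b c d v"
  using assms
proof induction
  case (const k)
  have "\<forall>v. cone v \<longrightarrow> k = cone_nf [:[:k:]:] 0 0 0 v" by (simp add: cone_nf_def eval2_def)
  then show ?case by blast
next
  case (coord i)
  have "\<forall>v. cone v \<longrightarrow> v i = cone_nf (if i = X1 then [:0,1:] else if i = X2 then [:[:0,1:]:] else 0) (if i
    = X0 then 1 else 0) (if i = X3 then 1 else 0) 0 v"
    by (cases i) (simp_all add: cone_nf_def eval2_def)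
  then show ?case by blast
next
  case (add F G)
  then obtain a b c d a' b' c' d' where "\<forall>v. cone v \<longrightarrow> F v = cone_nf a b c d v"
    "\<forall>v. cone v \<longrightarrow> G v = cone_nf a' b' c' d' v" by metis
  then have "\<forall>v. cone v \<longrightarrow> F v + G v = cone_nf (a+a') (b+b') (c+c') (d+d') v"
    by (simp add: cone_nf_def algebra_simps)
  then show ?case by blast
next
  case (mult F G)
  then obtain a b c d a' b' c' d' where FG: "\<forall>v. cone v \<longrightarrow> F v = cone_nf a b c d v"
    "\<forall>v. cone v \<longrightarrow> G v = cone_nf a' b' c' d' v" by metis
  have "F v * G v = cone_nf (a*a' + b*b'*fp + c*c'*gp + d*d'*fp*gp) (a*b'+b*a' + c*d'*gp + d*c'*gp)
     (a*c'+c*a'+b*d'*fp+d*b'*fp) (a*d'+d*a'+b*c'+c*b') v" if "cone v" for v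
  proof -
    have s: "eval2 fp (v X1) (v X2) = v X0 * v X0" "eval2 gp (v X1) (v X2) = v X3 * v X3"
      using that by (simp_all add: cone_iff eval2_fg power2_eq_square)
    show ?thesis unfolding FG(1)[rule_format, OF that] FG(2)[rule_format, OF that]
      unfolding cone_nf_def eval2_simps s by (simp add: algebra_simps)
  qed
  then show ?case by blast
qed

text \<open>Every (x, y) lifts to a point of the cone, so the product of the norms of both normal
  forms is zero. One norm is then zero, and an element of norm zero is zero because neither of the
  adjoined roots is redundant.\<close>

theorem cone_irreducible:
  assumes F: "F \<in> polyfun" and G: "G \<in> polyfun" and FG: "\<And>v. cone v \<Longrightarrow> F v * G v = 0"
  shows "(\<forall>v. cone v \<longrightarrow> F v = 0) \<or> (\<forall>v. cone v \<longrightarrow> G v = 0)"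
proof -
  obtain a b c d where F': "\<And>v. cone v \<Longrightarrow> F v = cone_nf a b c d v" using polyfun_nf[OF F] by metis
  obtain a' b' c' d' where G': "\<And>v. cone v \<Longrightarrow> G v = cone_nf a' b' c' d' v" using polyfun_nf[OF G] by metis
  \<comment> \<open>the norm of the normal form down to \<open>k[y\<^sub>1, y\<^sub>2]\<close>\<close>
  define N where "N a b c d = (a\<^sup>2 + c\<^sup>2 * gp - (b\<^sup>2 + d\<^sup>2 * gp) * fp)\<^sup>2 - (2 * (a * c - b * d * fp))\<^sup>2 * gp"
    for a b c d :: "'k poly poly"
  have N: "\<exists>m. eval2 (N a b c d) (v X1) (v X2) = cone_nf a b c d v * m" if "cone v" for a b c d v
  proof -
    let ?e = "\<lambda>p. eval2 p (v X1) (v X2)"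
    have s: "(v X0)\<^sup>2 = ?e fp" "(v X3)\<^sup>2 = ?e gp"
      using that by (simp_all add: cone_iff eval2_fg)
    \<comment> \<open>The cofactor is the product of the other conjugates: the first bracket changes
      the sign of y0, the second changes the sign of y3 in the resulting partial norm.\<close>
    have "?e (N a b c d) = cone_nf a b c d v * ((?e a - ?e b * v X0 + ?e c * v X3 - ?e d * v X0 * v X3)
      * ((?e a)\<^sup>2 + (?e c)\<^sup>2 * ?e gp - ((?e b)\<^sup>2 + (?e d)\<^sup>2 * ?e gp) * ?e fp - 2 * (?e a * ?e c - ?e b * ?e d
        * ?e fp) * v X3))"
      unfolding cone_nf_def N_def s[symmetric] eval2_simps by (simp add: algebra_simps power2_eq_square)
    then show ?thesis by blast
  qed
  have "eval2 (N a b c d * N a' b' c' d') x y = 0" for x y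
  proof -
    obtain y0 where y0: "y0\<^sup>2 = f1 * x\<^sup>2 + f2 * y\<^sup>2" using nth_root_exists[of 2] by auto
    obtain y3 where y3: "y3\<^sup>2 = g1 * x\<^sup>2 + g2 * y\<^sup>2" using nth_root_exists[of 2] by auto
    define v where "v = (\<lambda>i. case i of X0 \<Rightarrow> y0 | X1 \<Rightarrow> x | X2 \<Rightarrow> y | X3 \<Rightarrow> y3)"
    have C: "cone v" using y0 y3 by (simp add: cone_iff v_def)
    have xy: "v X1 = x" "v X2 = y" by (simp_all add: v_def)
    obtain m where "eval2 (N a b c d) x y = F v * m" using N[OF C] F'[OF C] xy by metis
    moreover obtain m' where "eval2 (N a' b' c' d') x y = G v * m'" using N[OF C] G'[OF C] xy by metis
    ultimately show ?thesis using FG[OF C] by auto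
  qed
  then have "N a b c d * N a' b' c' d' = 0" by (rule eval2_zero)
  then consider "N a b c d = 0" | "N a' b' c' d' = 0" by auto
  moreover have "cone_nf a b c d v = 0" if "N a b c d = 0" for a b c d v
  proof -
    have "(a\<^sup>2 + c\<^sup>2 * gp - (b\<^sup>2 + d\<^sup>2 * gp) * fp)\<^sup>2 = (2 * (a * c - b * d * fp))\<^sup>2 * gp"
      using that by (simp add: N_def)
    from not_square(2)[OF this]
    have 1: "a\<^sup>2 + c\<^sup>2 * gp - (b\<^sup>2 + d\<^sup>2 * gp) * fp = 0" "2 * (a * c - b * d * fp) = 0" by blast+
    have "(2 :: 'k poly poly) \<noteq> 0" by (metis eval2_simps(1,7) two_nz)
    with 1 have "a = 0 \<and> b = 0 \<and> c = 0 \<and> d = 0" by (intro norm_zero) auto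
    then show ?thesis by (simp add: cone_nf_def)
  qed
  ultimately show ?thesis using F' G' by metis
qed

end

section \<open>The free algebra and the ideal defining \<open>B\<close>\<close>

type_synonym word = "gen list"

abbreviation wmono :: "word \<Rightarrow> 'k::field \<Rightarrow> 'k fa" where "wmono \<equiv> Poly_Mapping.single"

lemma mono_mult [simp]: "wmono u a * wmono w b = wmono (u @ w) (a * b)"
  by (simp add: mult_single plus_list_def)

lemma fa_sum_mono: "f = (\<Sum>w\<in>Poly_Mapping.keys f. wmono w (Poly_Mapping.lookup f w))"
  by (rule poly_mapping_eqI)
    (simp add: lookup_sum lookup_single when_def in_keys_iff sum.delta)

lemma fa_induct [case_names zero wmono add]:
  assumes "P 0" "\<And>w c. P (wmono w c)" "\<And>f g. P f \<Longrightarrow> P g \<Longrightarrow> P (f + g)"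
  shows "P (f :: 'k::field fa)"
proof -
  have "P (\<Sum>w\<in>A. wmono w (Poly_Mapping.lookup f w))" if "finite A" for A
    using that by induction (auto intro: assms)
  then show ?thesis by (subst fa_sum_mono) simp
qed

lemma const_simps [simp]:
  "const 0 = 0" "const 1 = 1" "const (a + b) = const a + const b" "const (a * b) = const a * const b"
  "const (- a) = - const a" "const (a - b) = const a - const b"
  by (simp_all add: const_def single_add single_uminus single_diff) (simp flip: zero_list_def)

lemma const_mono: "const a * wmono w b = wmono w (a * b)"
  by (simp add: const_def)

lemma const_central: "const a * f = f * const a"
  by (induction f rule: fa_induct) (simp_all add: const_def algebra_simps)

lemma mono_Cons: "wmono (i # w) c = var i * wmono w c"
  by (simp add: var_def)

section \<open>Multilinear evaluation of noncommutative polynomials\<close>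

definition lin_ext :: "(word \<Rightarrow> 'k) \<Rightarrow> 'k::field fa \<Rightarrow> 'k" where
  "lin_ext \<phi> f = (\<Sum>w\<in>Poly_Mapping.keys f. Poly_Mapping.lookup f w * \<phi> w)"

lemma lin_ext_add [simp]: "lin_ext \<phi> (f + g) = lin_ext \<phi> f + lin_ext \<phi> g"
  unfolding lin_ext_def by (rule setsum_keys_plus_distrib) (simp_all add: algebra_simps)

lemma lin_ext_mono [simp]: "lin_ext \<phi> (wmono w c) = c * \<phi> w"
  by (simp add: lin_ext_def)

lemma lin_ext_zero [simp]: "lin_ext \<phi> 0 = 0"
  by (simp add: lin_ext_def)

lemma lin_ext_uminus [simp]: "lin_ext \<phi> (- f) = - lin_ext \<phi> f"
  using lin_ext_add[of \<phi> f "- f"] by (simp add: eq_neg_iff_add_eq_0 add.commute)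

lemma lin_ext_diff [simp]: "lin_ext \<phi> (f - g) = lin_ext \<phi> f - lin_ext \<phi> g"
  using lin_ext_add[of \<phi> f "- g"] by simp

lemma lin_ext_sum: "lin_ext \<phi> (sum F A) = (\<Sum>x\<in>A. lin_ext \<phi> (F x))"
  by (induction A rule: infinite_finite_induct) auto

lemma lin_ext_const_mult [simp]: "lin_ext \<phi> (const c * f) = c * lin_ext \<phi> f"
  by (induction f rule: fa_induct) (simp_all add: const_mono algebra_simps)

fun ev_word :: "(nat \<Rightarrow> gen \<Rightarrow> 'k::field) \<Rightarrow> word \<Rightarrow> 'k" where
  "ev_word u [] = 1"
| "ev_word u (i # w) = u 0 i * ev_word (\<lambda>j. u (Suc j)) w"

lemma ev_word_append: "ev_word u (a @ b) = ev_word u a * ev_word (\<lambda>j. u (length a + j)) b"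
  by (induction a arbitrary: u) simp_all

text \<open>The multilinear form of the degree \<open>n\<close> component at the first
  \<open>n\<close> points of \<open>u\<close>. Words of other lengths contribute zero, which makes
  it a linear functional on the whole free algebra.\<close>

definition ev_seq :: "(nat \<Rightarrow> gen \<Rightarrow> 'k::field) \<Rightarrow> nat \<Rightarrow> 'k fa \<Rightarrow> 'k" where
  "ev_seq u n = lin_ext (\<lambda>w. if length w = n then ev_word u w else 0)"

lemma ev_seq_simps [simp]:
  "ev_seq u n 0 = 0" "ev_seq u n (f + g) = ev_seq u n f + ev_seq u n g"
    "ev_seq u n (f - g) = ev_seq u n f - ev_seq u n g"
  "ev_seq u n (- f) = - ev_seq u n f" "ev_seq u n (const c * f) = c * ev_seq u n f"
  "ev_seq u n (wmono w c) = (if length w = n then c * ev_word u w else 0)"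
  by (simp_all add: ev_seq_def)

lemma ev_seq_sum: "ev_seq u n (sum F A) = (\<Sum>x\<in>A. ev_seq u n (F x))"
  by (simp add: ev_seq_def lin_ext_sum)

lemma ev_seq_mono_mult:
  "ev_seq u n (wmono w c * f) = (if length w \<le> n then c * ev_word u w * ev_seq (\<lambda>j. u (length w + j)) (n
    - length w) f else 0)"
  by (induction f rule: fa_induct) (auto simp: ev_word_append algebra_simps)

lemma ev_seq_mult_mono:
  "ev_seq u n (f * wmono w c) = (if length w \<le> n then ev_seq u (n - length w) f * ev_word (\<lambda>j. u (n - length w
    + j)) w * c else 0)"
proof (induction f rule: fa_induct)
  case (wmono w' d)
  have "length w' + length w = n \<longleftrightarrow> length w \<le> n \<and> length w' = n - length w" by auto
  then show ?case by (auto simp: ev_word_append)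
qed (auto simp: algebra_simps)

lemma ev_seq_var_mult: "ev_seq u (Suc n) (var i * f) = u 0 i * ev_seq (\<lambda>j. u (Suc j)) n f"
  by (simp add: var_def ev_seq_mono_mult)

lemma ev_seq_mult_var: "ev_seq u (Suc n) (f * var i) = ev_seq u n f * u n i"
  by (simp add: var_def ev_seq_mult_mono)

lemma ev_word_scale:
  "(\<And>j i. j < length w \<Longrightarrow> u j i = c j * u' j i) \<Longrightarrow> ev_word u w = (\<Prod>j<length w. c j) * ev_word u' w"
proof (induction w arbitrary: u u' c)
  case (Cons i w)
  have "ev_word (\<lambda>j. u (Suc j)) w = (\<Prod>j<length w. c (Suc j)) * ev_word (\<lambda>j. u' (Suc j)) w"
    by (rule Cons.IH) (use Cons.prems in auto)
  then show ?case using Cons.prems[of 0 i] by (simp add: prod.lessThan_Suc_shift del: prod.lessThan_Suc)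
qed simp

text \<open>Multilinearity: vanishing does not depend on the representatives of the points. A factor
  \<open>c j\<close> may be zero, as happens for local formulas away from their point.\<close>

lemma ev_seq_scale:
  assumes "\<And>j i. j < n \<Longrightarrow> u j i = c j * u' j i"
  shows "ev_seq u n f = (\<Prod>j<n. c j) * ev_seq u' n f"
proof (induction f rule: fa_induct)
  case (wmono w d)
  then show ?case using ev_word_scale[of w u c u'] assms by auto
qed (simp_all add: algebra_simps)

lemma polyfun_evw:
  assumes "\<And>j i. (\<lambda>v. T v j i) \<in> polyfun"
  shows "(\<lambda>v. ev_word (T v) w) \<in> polyfun"
  using assms by (induction w arbitrary: T) (auto intro!: polyfun_intros)

lemma polyfun_EV:
  assumes "\<And>j i. (\<lambda>v. T v j i) \<in> polyfun"
  shows "(\<lambda>v. ev_seq (T v) n f) \<in> polyfun"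
proof (induction f rule: fa_induct)
  case (wmono w c)
  show ?case by (cases "length w = n") (auto intro!: polyfun_intros polyfun_evw assms)
qed (auto intro!: polyfun_intros)

lemma finite_gen [simp]: "finite (UNIV :: gen set)"
  by (simp add: gen_UNIV)

definition homog :: "nat \<Rightarrow> 'k::field fa \<Rightarrow> bool" where
  "homog n f \<longleftrightarrow> (\<forall>w\<in>Poly_Mapping.keys f. length w = n)"

lemma homog_zero [simp]: "homog n 0" by (simp add: homog_def)

lemma homog_mono: "homog n (wmono w c) \<longleftrightarrow> c = 0 \<or> length w = n" by (simp add: homog_def)

lemma homog_add: "homog n f \<Longrightarrow> homog n g \<Longrightarrow> homog n (f + g)"
  using keys_add[of f g] by (auto simp: homog_def)

lemma homog_sum: "(\<And>x. x \<in> A \<Longrightarrow> homog n (F x)) \<Longrightarrow> homog n (sum F A)"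
  by (induction A rule: infinite_finite_induct) (auto intro: homog_add)

lemma homog_mult: "homog m f \<Longrightarrow> homog n g \<Longrightarrow> homog (m + n) (f * g)"
  using keys_mult[of f g] by (auto simp: homog_def plus_list_def)

lemma homog_const: "homog 0 (const c)" by (simp add: const_def homog_mono)

lemma homog_var: "homog 1 (var i)" by (simp add: var_def homog_mono)

lemma homog_const_mult: "homog n f \<Longrightarrow> homog n (const c * f)"
  using homog_mult[OF homog_const] by fastforce

lemma homog_0E: assumes "homog 0 f" obtains c where "f = const c"
proof
  show "f = const (Poly_Mapping.lookup f [])"
  proof (rule poly_mapping_eqI)
    fix w
    show "Poly_Mapping.lookup f w = Poly_Mapping.lookup (const (Poly_Mapping.lookup f [])) w"
      using assms by (cases "w = []") (auto simp: homog_def const_def lookup_single in_keys_iff when_def)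
  qed
qed

lemma ev_seq_const [simp]: "ev_seq u n (const c) = (if n = 0 then c else 0)"
  by (auto simp: const_def)

lemma homog_SucE:
  assumes "homog (Suc n) f"
  obtains g where "\<And>i. homog n (g i)" "f = (\<Sum>i\<in>UNIV. var i * g i)"
proof -
  define g where "g i = (\<Sum>w | w \<in> Poly_Mapping.keys f \<and> hd w = i. wmono (tl w) (Poly_Mapping.lookup f w))" for i
  have ne: "w \<noteq> []" if "w \<in> Poly_Mapping.keys f" for w using assms that by (auto simp: homog_def)
  have "homog n (g i)" for i
    unfolding g_def using assms by (intro homog_sum) (auto simp: homog_def)
  moreover have "f = (\<Sum>i\<in>UNIV. var i * g i)"
  proof -
    have "(\<Sum>i\<in>UNIV. var i * g i) = (\<Sum>i\<in>UNIV. \<Sum>w | w \<in> Poly_Mapping.keys f \<and> hd w = i. wmono w (Poly_Mapping.lookup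
      f w))"
      unfolding g_def sum_distrib_left
      by (intro sum.cong refl) (auto simp: mono_Cons[symmetric] dest: ne)
    also have "\<dots> = (\<Sum>w\<in>Poly_Mapping.keys f. wmono w (Poly_Mapping.lookup f w))"
      by (rule sum.group) (use finite_gen in auto)
    finally show ?thesis using fa_sum_mono by metis
  qed
  ultimately show ?thesis using that by blast
qed

definition lpart :: "nat \<Rightarrow> 'k::field fa \<Rightarrow> 'k fa" where
  "lpart n f = (\<Sum>w | w \<in> Poly_Mapping.keys f \<and> length w = n. wmono w (Poly_Mapping.lookup f w))"

lemma homog_lpart: "homog n (lpart n f)"
  unfolding lpart_def by (rule homog_sum) (auto simp: homog_mono)

lemma ev_seq_lpart: "ev_seq u n (lpart n f) = ev_seq u n f"
proof -
  have "ev_seq u n (lpart n f) = (\<Sum>w | w \<in> Poly_Mapping.keys f \<and> length w = n. Poly_Mapping.lookup f w * ev_word u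
    w)"
    unfolding lpart_def ev_seq_sum by (rule sum.cong) auto
  also have "\<dots> = ev_seq u n f"
    unfolding ev_seq_def lin_ext_def by (rule sum.mono_neutral_cong_left) auto
  finally show ?thesis .
qed

lemma sum_lpart: "\<exists>N. f = (\<Sum>n<N. lpart n f) \<and> (\<forall>n\<ge>N. lpart n f = 0)"
proof -
  define N where "N = Suc (Max (length ` Poly_Mapping.keys f))"
  have len: "length w < N" if "w \<in> Poly_Mapping.keys f" for w
    using that by (auto simp: N_def less_Suc_eq_le)
  then have "(\<Sum>n<N. lpart n f) = (\<Sum>w\<in>Poly_Mapping.keys f. wmono w (Poly_Mapping.lookup f w))"
    unfolding lpart_def by (intro sum.group) auto
  moreover have "lpart n f = 0" if "n \<ge> N" for n
    unfolding lpart_def using len that by (intro sum.neutral) force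
  ultimately show ?thesis using fa_sum_mono by metis
qed

section \<open>Two-sided ideals of the free algebra\<close>

definition twosided :: "'k::field fa set \<Rightarrow> bool" where
  "twosided J \<longleftrightarrow> 0 \<in> J \<and> (\<forall>f\<in>J. \<forall>g\<in>J. f + g \<in> J) \<and> (\<forall>f\<in>J. \<forall>g. g * f \<in> J \<and> f * g \<in> J)"

lemma twosidedD:
  assumes "twosided J"
  shows "0 \<in> J" "f \<in> J \<Longrightarrow> g \<in> J \<Longrightarrow> f + g \<in> J" "f \<in> J \<Longrightarrow> g * f \<in> J" "f \<in> J \<Longrightarrow> f * g \<in> J"
    "f \<in> J \<Longrightarrow> - f \<in> J" "f \<in> J \<Longrightarrow> g \<in> J \<Longrightarrow> f - g \<in> J"
proof -
  show "0 \<in> J" "f \<in> J \<Longrightarrow> g \<in> J \<Longrightarrow> f + g \<in> J" "f \<in> J \<Longrightarrow> g * f \<in> J" "f \<in> J \<Longrightarrow> f * g \<in> J"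
    using assms by (auto simp: twosided_def)
  have *: "- f \<in> J" if "f \<in> J" for f
    using that assms unfolding twosided_def by (metis mult_minus_left mult_1)
  then show "f \<in> J \<Longrightarrow> - f \<in> J" .
  show "f \<in> J \<Longrightarrow> g \<in> J \<Longrightarrow> f - g \<in> J"
    using *[of g] assms unfolding twosided_def by (metis diff_conv_add_uminus)
qed

lemma twosidedI_mono:
  assumes "0 \<in> J" "\<And>f g. f \<in> J \<Longrightarrow> g \<in> J \<Longrightarrow> f + g \<in> J"
    "\<And>f w c. f \<in> J \<Longrightarrow> wmono w c * f \<in> J" "\<And>f w c. f \<in> J \<Longrightarrow> f * wmono w c \<in> J"
  shows "twosided J"
proof -
  have "g * f \<in> J \<and> f * g \<in> J" if "f \<in> J" for f g
    by (induction g rule: fa_induct) (auto simp: algebra_simps intro: assms that)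
  then show ?thesis using assms by (auto simp: twosided_def)
qed

lemma free_alg_simps [simp]:
  "carrier free_alg = UNIV" "x \<otimes>\<^bsub>free_alg\<^esub> y = x * y" "x \<oplus>\<^bsub>free_alg\<^esub> y = x + y"
  "\<one>\<^bsub>free_alg\<^esub> = 1" "\<zero>\<^bsub>free_alg\<^esub> = 0"
  by (simp_all add: free_alg_def)

lemma ring_free_alg: "ring (free_alg :: 'k::field fa ring)"
proof (rule ringI)
  show "abelian_group (free_alg :: 'k fa ring)"
    by (rule abelian_groupI) (auto simp: algebra_simps intro: exI[of _ "- _"])
  show "Group.monoid (free_alg :: 'k fa ring)"
    by (rule monoidI) (auto simp: algebra_simps)
qed (auto simp: algebra_simps)

interpretation FA: ring "free_alg :: 'k::field fa ring" by (rule ring_free_alg)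

lemma free_alg_uminus [simp]: "\<ominus>\<^bsub>free_alg\<^esub> x = - x"
  by (rule FA.minus_equality) auto

lemma free_alg_minus [simp]: "x \<ominus>\<^bsub>free_alg\<^esub> y = x - y"
  by (simp add: a_minus_def)

lemma ideal_iff_twosided: "ideal J free_alg \<longleftrightarrow> twosided J"
proof
  assume "ideal J free_alg"
  then interpret ideal J free_alg .
  show "twosided J" unfolding twosided_def
    using I_l_closed I_r_closed additive_subgroup.zero_closed[OF additive_subgroup_axioms]
      additive_subgroup.a_closed[OF additive_subgroup_axioms] by auto
next
  assume J: "twosided J"
  note D = twosidedD[OF J]
  show "ideal J free_alg"
  proof (rule idealI[OF ring_free_alg])
    show "subgroup J (add_monoid free_alg)"
      by (rule FA.add.subgroupI) (use D in \<open>auto simp flip: a_inv_def\<close>)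
  qed (use D in auto)
qed

section \<open>B as a quotient of the free algebra by one ideal\<close>

context sklyanin_algebra begin

abbreviation "\<A> \<equiv> algA \<alpha> \<beta> \<gamma>"
abbreviation "\<B> \<equiv> algB \<alpha> \<beta> \<gamma>"
abbreviation "\<T> \<equiv> twistB \<alpha> \<beta> \<gamma>"
abbreviation "\<S> \<equiv> sklyanin_ideal \<alpha> \<beta> \<gamma>"
abbreviation "\<W> \<equiv> omega_ideal \<alpha> \<beta> \<gamma>"
abbreviation "\<R> \<equiv> sklyanin_relations \<alpha> \<beta> \<gamma>"
abbreviation "gens \<equiv> \<R> \<union> {Omega1, Omega2 \<alpha> \<beta> \<gamma>}"
abbreviation "clA \<equiv> clsA \<alpha> \<beta> \<gamma>"
abbreviation "clB \<equiv> clsB \<alpha> \<beta> \<gamma>"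

lemma twosided_sklyanin_ideal: "twosided (\<S>)"
  unfolding ideal_iff_twosided[symmetric] sklyanin_ideal_def by (rule FA.genideal_ideal) simp

lemma sklyanin_relations_sub: "\<R> \<subseteq> \<S>"
  unfolding sklyanin_ideal_def by (rule FA.genideal_self) simp

lemma sklyanin_ideal_min: "twosided J \<Longrightarrow> \<R> \<subseteq> J \<Longrightarrow> \<S> \<subseteq> J"
  unfolding sklyanin_ideal_def ideal_iff_twosided[symmetric] by (rule FA.genideal_minimal)

lemma ring_algA: "ring (\<A>)"
  unfolding algA_def
  by (rule ideal.quotient_is_ring) (simp add: ideal_iff_twosided twosided_sklyanin_ideal)

lemma clsA_hom: "clA \<in> ring_hom free_alg (\<A>)"
proof -
  have "(+>\<^bsub>free_alg\<^esub>) (\<S>) \<in> ring_hom free_alg (\<A>)"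
    unfolding algA_def by (rule ideal.rcos_ring_hom) (simp add: ideal_iff_twosided twosided_sklyanin_ideal)
  then show ?thesis by (simp add: clsA_def[abs_def] eta_contract_eq)
qed

lemma clsA_eq: "clA f = clA g \<longleftrightarrow> f - g \<in> \<S>"
  unfolding clsA_def
  using FA.quotient_eq_iff_same_a_r_cos[of "\<S>" f g]
  by (simp add: ideal_iff_twosided twosided_sklyanin_ideal)

lemma carrier_algA: "carrier (\<A>) = range (clA)"
  unfolding algA_def clsA_def FactRing_def by (auto simp: A_RCOSETS_def' a_r_coset_def')

lemma clsA_simps:
  "clA f \<otimes>\<^bsub>\<A>\<^esub> clA g = clA (f * g)"
  "clA f \<oplus>\<^bsub>\<A>\<^esub> clA g = clA (f + g)"
  "\<one>\<^bsub>\<A>\<^esub> = clA 1"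
  using ring_hom_mult[OF clsA_hom, of f g] ring_hom_add[OF clsA_hom, of f g]
    ring_hom_one[OF clsA_hom] by simp_all

lemma clsA_zero: "\<zero>\<^bsub>\<A>\<^esub> = clA 0"
  using ring_hom_zero[OF clsA_hom ring_free_alg ring_algA] by simp

lemma clsA_in [simp]: "clA f \<in> carrier (\<A>)"
  by (simp add: carrier_algA)

lemma ideal_omega: "ideal (\<W>) (\<A>)"
  unfolding omega_ideal_def by (rule ring.genideal_ideal[OF ring_algA]) simp

lemma ring_algB: "ring (\<B>)"
  unfolding algB_def by (rule ideal.quotient_is_ring[OF ideal_omega])

lemma clsB_hom: "clB \<in> ring_hom free_alg (\<B>)"
proof -
  have "(+>\<^bsub>\<A>\<^esub>) (\<W>) \<in> ring_hom (\<A>) (\<B>)"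
    unfolding algB_def by (rule ideal.rcos_ring_hom[OF ideal_omega])
  from ring_hom_trans[OF clsA_hom this] show ?thesis
    by (simp add: clsB_def[abs_def] comp_def)
qed

lemma clsB_simps:
  "clB f \<otimes>\<^bsub>\<B>\<^esub> clB g = clB (f * g)"
  "clB f \<oplus>\<^bsub>\<B>\<^esub> clB g = clB (f + g)"
  "\<one>\<^bsub>\<B>\<^esub> = clB 1"
  using ring_hom_mult[OF clsB_hom, of f g] ring_hom_add[OF clsB_hom, of f g]
    ring_hom_one[OF clsB_hom] by simp_all

lemma clsB_zero: "\<zero>\<^bsub>\<B>\<^esub> = clB 0"
  using ring_hom_zero[OF clsB_hom ring_free_alg ring_algB] by simp

lemma carrier_algB: "carrier (\<B>) = range (clB)"
proof -
  have "carrier (\<B>) = (\<lambda>a. \<W> +>\<^bsub>\<A>\<^esub> a) ` carrier (\<A>)"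
    unfolding algB_def FactRing_def by (auto simp: A_RCOSETS_def' a_r_coset_def')
  then show ?thesis by (auto simp: carrier_algA clsB_def)
qed

lemma clsB_in [simp]: "clB f \<in> carrier (\<B>)"
  by (simp add: carrier_algB)

text \<open>The kernel of \<open>clB\<close>. Elements of B are cosets of cosets; this ideal turns
  equations in B into memberships in the free algebra.\<close>

definition relI :: "'k fa set" where
  "relI = {f. clA f \<in> \<W>}"

lemma twosided_relI: "twosided (relI)"
proof -
  interpret ideal "\<W>" "\<A>" by (rule ideal_omega)
  show ?thesis unfolding twosided_def relI_def
    using additive_subgroup.zero_closed[OF additive_subgroup_axioms]
      additive_subgroup.a_closed[OF additive_subgroup_axioms] I_l_closed I_r_closed
    by (auto simp: clsA_zero clsA_simps(1,2)[symmetric])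
qed

lemma clsB_eq: "clB f = clB g \<longleftrightarrow> f - g \<in> relI"
proof -
  interpret ring "\<A>" by (rule ring_algA)
  have "\<ominus>\<^bsub>\<A>\<^esub> clA g = clA (- g)"
    by (rule minus_equality) (simp_all add: clsA_simps clsA_zero)
  then have "clA f \<ominus>\<^bsub>\<A>\<^esub> clA g = clA (f - g)"
    by (simp add: a_minus_def clsA_simps)
  then show ?thesis
    unfolding clsB_def relI_def using quotient_eq_iff_same_a_r_cos[OF ideal_omega, of "clA f" "clA g"] by simp
qed

lemma sklyanin_sub_relI: "\<S> \<subseteq> relI"
proof
  fix f assume "f \<in> \<S>"
  then have "clA f = clA 0" by (simp add: clsA_eq)
  then show "f \<in> relI"
    using twosidedD(1)[OF twosided_relI] by (simp add: relI_def)
qed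

lemma relI_gens: "gens \<subseteq> relI"
proof -
  have "{clA Omega1, clA (Omega2 \<alpha> \<beta> \<gamma>)} \<subseteq> \<W>"
    unfolding omega_ideal_def by (rule ring.genideal_self[OF ring_algA]) simp
  then show ?thesis using sklyanin_sub_relI sklyanin_relations_sub by (fastforce simp: relI_def)
qed

text \<open>The image of \<open>J\<close> in A is an ideal containing the generators of
  \<open>\<W>\<close>, and preimages are unique up to \<open>\<S>\<close>, which \<open>J\<close>
  contains. This serves as the induction principle for \<open>relI\<close>.\<close>

lemma relI_min:
  assumes J: "twosided J" and sub: "gens \<subseteq> J"
  shows "relI \<subseteq> J"
proof
  interpret A: ring "\<A>" by (rule ring_algA)
  note D = twosidedD[OF J]
  have uminus: "\<ominus>\<^bsub>\<A>\<^esub> clA g = clA (- g)" for g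
    by (rule A.minus_equality) (simp_all add: clsA_simps clsA_zero)
  have "ideal (clA ` J) (\<A>)"
  proof (rule idealI[OF ring_algA])
    show "subgroup (clA ` J) (add_monoid (\<A>))"
      by (rule A.add.subgroupI) (use D in \<open>auto simp: clsA_simps uminus simp flip: a_inv_def\<close>)
  qed (use D in \<open>auto simp: carrier_algA clsA_simps\<close>)
  moreover have "{clA Omega1, clA (Omega2 \<alpha> \<beta> \<gamma>)} \<subseteq> clA ` J"
    using sub by auto
  ultimately have *: "\<W> \<subseteq> clA ` J"
    unfolding omega_ideal_def by (rule A.genideal_minimal)
  have S: "\<S> \<subseteq> J" using sub by (intro sklyanin_ideal_min J) auto
  fix f assume "f \<in> relI"
  with * obtain g where "g \<in> J" "clA f = clA g" by (auto simp: relI_def)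
  then have "f - g \<in> J" "g \<in> J" using S by (auto simp: clsA_eq)
  then show "f \<in> J" using D(2)[of "f - g" g] by simp
qed

text \<open>An explicit form of the nested coset, required because \<open>actB\<close> acts
  elementwise on both levels.\<close>

lemma clsB_coset:
  "clB f = clA ` {g. g - f \<in> relI}"
proof -
  interpret A: ring "\<A>" by (rule ring_algA)
  have sub: "\<W> \<subseteq> range (clA)"
    using ideal.Icarr[OF ideal_omega] by (auto simp: carrier_algA)
  show ?thesis
  proof (intro equalityI subsetI)
    fix x assume "x \<in> clB f"
    then obtain h where "h \<in> \<W>" "x = h \<oplus>\<^bsub>\<A>\<^esub> clA f"
      by (auto simp: clsB_def a_r_coset_def')
    with sub obtain i where "i \<in> relI" "x = clA (i + f)"
      by (fastforce simp: relI_def clsA_simps)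
    then show "x \<in> clA ` {g. g - f \<in> relI}" by auto
  next
    fix x assume "x \<in> clA ` {g. g - f \<in> relI}"
    then obtain g where g: "g - f \<in> relI" "x = clA g" by auto
    then have "x = clA (g - f) \<oplus>\<^bsub>\<A>\<^esub> clA f" by (simp add: clsA_simps)
    with g(1) show "x \<in> clB f" by (auto simp: clsB_def a_r_coset_def' relI_def)
  qed
qed

end

section \<open>Points of E and their successors\<close>

context sklyanin begin

lemma cone_point: "\<exists>y. cone y \<and> y X1 \<noteq> 0"
proof -
  obtain y0 where y0: "y0\<^sup>2 = f1" using nth_root_exists[of 2] by auto
  obtain y3 where y3: "y3\<^sup>2 = g1" using nth_root_exists[of 2] by auto
  define y where "y = (\<lambda>i. case i of X0 \<Rightarrow> y0 | X1 \<Rightarrow> 1 | X2 \<Rightarrow> 0 | X3 \<Rightarrow> y3)"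
  have y: "cone y" "y X1 \<noteq> 0" using y0 y3 by (simp_all add: cone_iff y_def)
  then show ?thesis by blast
qed

text \<open>The origin gives no point of E, so the product is controlled only away from it. A factor
  \<open>v X1\<close> covers the origin and is removed by a second use of irreducibility.\<close>

lemma cone_irreducible_nz:
  assumes F: "F \<in> polyfun" and G: "G \<in> polyfun"
    and FG: "\<And>v. cone v \<Longrightarrow> v \<noteq> (\<lambda>_. 0) \<Longrightarrow> F v * G v = 0"
  shows "(\<forall>v. cone v \<longrightarrow> F v = 0) \<or> (\<forall>v. cone v \<longrightarrow> G v = 0)"
proof -
  obtain y where y: "cone y" "y X1 \<noteq> 0" using cone_point by blast
  have "(\<forall>v. cone v \<longrightarrow> F v * v X1 = 0) \<or> (\<forall>v. cone v \<longrightarrow> G v = 0)"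
  proof (rule cone_irreducible)
    fix v assume v: "cone v"
    show "F v * v X1 * G v = 0" using FG[OF v] by (cases "v = (\<lambda>_. 0)") auto
  qed (intro polyfun_intros F G)+
  moreover have "(\<forall>v. cone v \<longrightarrow> F v = 0) \<or> (\<forall>v. cone v \<longrightarrow> v X1 = 0)"
    if "\<forall>v. cone v \<longrightarrow> F v * v X1 = 0"
    using that by (intro cone_irreducible F polyfun_intros) auto
  ultimately show ?thesis using y by blast
qed

lemma parD:
  assumes "parallel u w" "w \<noteq> (\<lambda>_. 0)"
  shows "\<exists>c. u = (\<lambda>i. c * w i)"
proof -
  obtain j where j: "w j \<noteq> 0" using assms(2) by auto
  have "u i = u j / w j * w i" for i
    using assms(1)[unfolded parallel_def, rule_format, of i j] j by (simp add: field_simps)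
  then show ?thesis by blast
qed

lemma polyfun_Q:
  "(\<lambda>v. Qa v i) \<in> polyfun" "(\<lambda>v. Qb v i) \<in> polyfun" "(\<lambda>v. Qc v i) \<in> polyfun" "(\<lambda>v. Qd v i) \<in> polyfun"
  by (cases i; simp add: n1_def n3_def Dm_def Dp_def m0_def m2_def; intro polyfun_intros)+

text \<open>One formula serves all \<open>v'\<close>, but it is known to be nonzero only at
  \<open>v\<close>: this is the sense in which \<sigma> is polynomial near \<open>v\<close>.\<close>

lemma local_Q:
  assumes "cone v" "v \<noteq> (\<lambda>_. 0)"
  shows "\<exists>Q. (\<forall>i. (\<lambda>v. Q v i) \<in> polyfun) \<and> Q v \<noteq> (\<lambda>_. 0) \<and> (\<forall>v' w. rels v' w \<longrightarrow> parallel (Q v') w)"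
  using Q_nonzero[OF assms]
proof (elim disjE)
  assume "Qa v X2 \<noteq> 0" then have "Qa v \<noteq> (\<lambda>_. 0)" by metis
  then show ?thesis using polyfun_Q parallel_Q by blast
next
  assume "Qb v X2 \<noteq> 0" then have "Qb v \<noteq> (\<lambda>_. 0)" by metis
  then show ?thesis using polyfun_Q parallel_Q by blast
next
  assume "Qc v X3 \<noteq> 0" then have "Qc v \<noteq> (\<lambda>_. 0)" by metis
  then show ?thesis using polyfun_Q parallel_Q by blast
next
  assume "Qd v X3 \<noteq> 0" then have "Qd v \<noteq> (\<lambda>_. 0)" by metis
  then show ?thesis using polyfun_Q parallel_Q by blast
qed

lemma rels_unique:
  assumes "cone v" "v \<noteq> (\<lambda>_. 0)" "rels v w" "rels v w'" "w' \<noteq> (\<lambda>_. 0)"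
  shows "\<exists>c. w = (\<lambda>i. c * w' i)"
proof -
  obtain Q where Q: "Q v \<noteq> (\<lambda>_. 0)" "parallel (Q v) w" "parallel (Q v) w'"
    using local_Q[OF assms(1,2)] assms(3,4) by blast
  have "parallel w (Q v)" using Q(2) by (auto simp: parallel_def mult.commute)
  then obtain c where "w = (\<lambda>i. c * Q v i)" using parD Q(1) by blast
  moreover obtain d where "Q v = (\<lambda>i. d * w' i)" using parD Q(3) assms(5) by blast
  ultimately have "w = (\<lambda>i. (c * d) * w' i)" by (simp add: mult.assoc)
  then show ?thesis by blast
qed

lemma rels_scale: "rels v w \<Longrightarrow> rels (\<lambda>i. c * v i) (\<lambda>i. d * w i)"
proof -
  assume "rels v w"
  then show ?thesis unfolding rels_def
    by (elim conjE, intro conjI; Groebner_Basis.algebra)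
qed

lemma rels_commutators:
  assumes "rels v w"
  shows "v X0 * w X1 - v X1 * w X0 = \<alpha> * (v X2 * w X3 + v X3 * w X2)"
    "v X0 * w X1 + v X1 * w X0 = v X2 * w X3 - v X3 * w X2"
    "v X0 * w X2 - v X2 * w X0 = \<beta> * (v X3 * w X1 + v X1 * w X3)"
    "v X0 * w X2 + v X2 * w X0 = v X3 * w X1 - v X1 * w X3"
    "v X0 * w X3 - v X3 * w X0 = \<gamma> * (v X1 * w X2 + v X2 * w X1)"
    "v X0 * w X3 + v X3 * w X0 = v X1 * w X2 - v X2 * w X1"
proof -
  have h: "x = y" if "2 * x = 2 * y" for x y :: 'k using that by simp
  show "v X0 * w X1 - v X1 * w X0 = \<alpha> * (v X2 * w X3 + v X3 * w X2)"
    by (rule h) (use assms[unfolded rels_def] in Groebner_Basis.algebra)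
  show "v X0 * w X1 + v X1 * w X0 = v X2 * w X3 - v X3 * w X2"
    by (rule h) (use assms[unfolded rels_def] in Groebner_Basis.algebra)
  show "v X0 * w X2 - v X2 * w X0 = \<beta> * (v X3 * w X1 + v X1 * w X3)"
    by (rule h) (use assms[unfolded rels_def] in Groebner_Basis.algebra)
  show "v X0 * w X2 + v X2 * w X0 = v X3 * w X1 - v X1 * w X3"
    by (rule h) (use assms[unfolded rels_def] in Groebner_Basis.algebra)
  show "v X0 * w X3 - v X3 * w X0 = \<gamma> * (v X1 * w X2 + v X2 * w X1)"
    by (rule h) (use assms[unfolded rels_def] in Groebner_Basis.algebra)
  show "v X0 * w X3 + v X3 * w X0 = v X1 * w X2 - v X2 * w X1"
    by (rule h) (use assms[unfolded rels_def] in Groebner_Basis.algebra)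
qed

abbreviation "E \<equiv> curveE \<alpha> \<beta> \<gamma>"
abbreviation "I \<equiv> relI"

lemma cone_scale: "cone v \<Longrightarrow> cone (\<lambda>i. c * v i)"
  unfolding cone_iff by (auto simp: power_mult_distrib algebra_simps)

lemma cone_iff_curve:
  "cone y \<longleftrightarrow> (y X0)\<^sup>2 + (y X1)\<^sup>2 + (y X2)\<^sup>2 + (y X3)\<^sup>2 = 0 \<and>
        (y X3)\<^sup>2 + (1 - \<gamma>) / (1 + \<alpha>) * (y X1)\<^sup>2 + (1 + \<gamma>) / (1 - \<beta>) * (y X2)\<^sup>2 = 0"
proof -
  have "(1 + \<alpha>) * (1 - \<beta>) * ((y X3)\<^sup>2 + (1 - \<gamma>) / (1 + \<alpha>) * (y X1)\<^sup>2 + (1 + \<gamma>) / (1 - \<beta>) * (y X2)\<^sup>2)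
    = (1 + \<alpha>) * (1 - \<beta>) * (y X3)\<^sup>2 + (1 - \<gamma>) * (1 - \<beta>) * (y X1)\<^sup>2 + (1 + \<gamma>) * (1 + \<alpha>) * (y X2)\<^sup>2"
    by (simp add: divide_simps) (simp add: algebra_simps)
  then show ?thesis unfolding cone_def
    by (metis mult_eq_0_iff param_nz(4,8))
qed

lemma proj_in_E: "cone v \<Longrightarrow> v \<noteq> (\<lambda>_. 0) \<Longrightarrow> proj v \<in> E"
  by (auto simp: curveE_def cone_iff_curve)

lemma self_in_proj: "v \<in> proj v"
  unfolding proj_def by (auto intro!: exI[of _ 1])

lemma proj_scale:
  assumes "c \<noteq> 0"
  shows "proj (\<lambda>i. c * v i) = proj v"
proof
  show "proj (\<lambda>i. c * v i) \<subseteq> proj v"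
  proof
    fix x assume "x \<in> proj (\<lambda>i. c * v i)"
    then obtain d where "d \<noteq> 0" "x = (\<lambda>i. d * (c * v i))" by (auto simp: proj_def)
    then have "x = (\<lambda>i. (d * c) * v i)" "d * c \<noteq> 0" using assms by (auto simp: mult.assoc)
    then show "x \<in> proj v" unfolding proj_def by blast
  qed
  show "proj v \<subseteq> proj (\<lambda>i. c * v i)"
  proof
    fix x assume "x \<in> proj v"
    then obtain d where "d \<noteq> 0" "x = (\<lambda>i. d * v i)" by (auto simp: proj_def)
    then have "x = (\<lambda>i. (d / c) * (c * v i))" "d / c \<noteq> 0" using assms by auto
    then show "x \<in> proj (\<lambda>i. c * v i)" unfolding proj_def by blast
  qed
qed

lemma E_memD:
  assumes "p \<in> E" "v \<in> p"
  shows "cone v" "v \<noteq> (\<lambda>_. 0)" "p = proj v"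
proof -
  obtain y where y: "p = proj y" "y \<noteq> (\<lambda>_. 0)" "cone y"
    using assms(1) by (auto simp: curveE_def cone_iff_curve)
  then obtain c where c: "c \<noteq> 0" "v = (\<lambda>i. c * y i)" using assms(2) by (auto simp: proj_def)
  show "cone v" using y c cone_scale by blast
  show "v \<noteq> (\<lambda>_. 0)" using y(2) c by (auto simp: fun_eq_iff)
  show "p = proj v" unfolding c(2) y(1) by (rule proj_scale[OF c(1), symmetric])
qed

definition rep :: "'k pt \<Rightarrow> gen \<Rightarrow> 'k" where "rep p = (SOME v. v \<in> p)"

lemma rep:
  assumes "p \<in> E"
  shows "rep p \<in> p" "cone (rep p)" "rep p \<noteq> (\<lambda>_. 0)" "proj (rep p) = p"
proof -
  have "\<exists>v. v \<in> p" using assms self_in_proj by (auto simp: curveE_def)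
  then show "rep p \<in> p" unfolding rep_def by (rule someI_ex)
  from E_memD[OF assms this] show "cone (rep p)" "rep p \<noteq> (\<lambda>_. 0)" "proj (rep p) = p" by auto
qed

lemma rep_proj:
  assumes "cone v" "v \<noteq> (\<lambda>_. 0)"
  obtains c where "c \<noteq> 0" "rep (proj v) = (\<lambda>i. c * v i)"
  using rep(1)[OF proj_in_E[OF assms]] by (auto simp: proj_def)

lemmas relI_closed = twosidedD[OF twosided_relI]

end

section \<open>Evaluation along orbits\<close>

text \<open>The interface to the point modules: \<open>rels_step\<close> is what they contribute to
  the evaluation argument.\<close>

locale sklyanin_translation = sklyanin +
  fixes \<sigma> :: "'a pt \<Rightarrow> 'a pt"
  assumes bij: "bij_betw \<sigma> (curveE \<alpha> \<beta> \<gamma>) (curveE \<alpha> \<beta> \<gamma>)"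
    and rels_step: "\<And>p v w. p \<in> curveE \<alpha> \<beta> \<gamma> \<Longrightarrow> v \<in> p \<Longrightarrow> w \<in> \<sigma> p \<Longrightarrow> rels v w"
begin

lemma sigma_E: "p \<in> E \<Longrightarrow> \<sigma> p \<in> E"
  using bij by (auto simp: bij_betw_def)

lemma sigma_pow_E: "p \<in> E \<Longrightarrow> (\<sigma> ^^ n) p \<in> E"
  by (induction n) (auto intro: sigma_E)

lemma sigma_surj: "p \<in> E \<Longrightarrow> \<exists>q\<in>E. \<sigma> q = p"
  using bij by (metis bij_betw_iff_bijections)

lemma sigma_inj: "p \<in> E \<Longrightarrow> q \<in> E \<Longrightarrow> \<sigma> p = \<sigma> q \<Longrightarrow> p = q"
  using bij by (auto simp: bij_betw_def inj_on_def)

definition orbit :: "'a pt \<Rightarrow> nat \<Rightarrow> gen \<Rightarrow> 'a" where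
  "orbit p j = rep ((\<sigma> ^^ j) p)"

lemma orbit:
  assumes "p \<in> E"
  shows "cone (orbit p j)" "orbit p j \<noteq> (\<lambda>_. 0)" "proj (orbit p j) = (\<sigma> ^^ j) p"
  using rep[OF sigma_pow_E[OF assms]] by (auto simp: orbit_def)

lemma orbit_shift: "orbit p (m + j) = orbit ((\<sigma> ^^ m) p) j" "orbit p (j + m) = orbit ((\<sigma> ^^ m) p) j"
proof -
  have "(\<sigma> ^^ (j + m)) p = (\<sigma> ^^ j) ((\<sigma> ^^ m) p)" by (simp add: funpow_add)
  then show "orbit p (m + j) = orbit ((\<sigma> ^^ m) p) j" "orbit p (j + m) = orbit ((\<sigma> ^^ m) p) j"
    unfolding orbit_def by (simp_all only: add.commute)
qed

lemma orbit_rels: "p \<in> E \<Longrightarrow> rels (orbit p j) (orbit p (Suc j))"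
  using rels_step[OF sigma_pow_E, of p "orbit p j" j "orbit p (Suc j)"] rep(1)[OF sigma_pow_E, of p]
    rep(1)[OF sigma_E[OF sigma_pow_E], of p j]
  by (simp add: orbit_def)

text \<open>The elements vanishing along all orbits in all degrees form a two-sided ideal: a left
  factor moves the starting point along the orbit, a right factor is evaluated further on. The
  generators are checked in degree two.\<close>

lemma ev_seq_relI:
  assumes "p \<in> E" "f \<in> I"
  shows "ev_seq (orbit p) n f = 0"
proof -
  define J where "J = {f. \<forall>p\<in>E. \<forall>n. ev_seq (orbit p) n f = 0}"
  have "twosided J"
  proof (rule twosidedI_mono)
    fix f w and c :: 'a assume "f \<in> J"
    then show "wmono w c * f \<in> J" "f * wmono w c \<in> J"
      unfolding J_def using sigma_pow_E by (auto simp: ev_seq_mono_mult ev_seq_mult_mono orbit_shift)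
  qed (auto simp: J_def)
  moreover have "gens \<subseteq> J"
  proof -
    have "ev_seq (orbit p) n r = 0" if p: "p \<in> E" and r: "r \<in> gens" for p n r
    proof (cases "n = 2")
      case True
      define v w where "v = orbit p 0" and "w = orbit p 1"
      have rl: "rels v w" using orbit_rels[OF p, of 0] by (simp add: v_def w_def)
      note O = rels_omega[OF rl orbit(1,2)[OF p, of 0, folded v_def]]
      have e: "ev_seq (orbit p) n (var i * var j) = v i * w j" for i j
        by (simp add: var_def True v_def w_def numeral_2_eq_2)
      note R = rels_commutators[OF rl]
      have O2: "v X1 * w X1 + (1 + \<alpha>) / (1 - \<beta>) * (v X2 * w X2) + (1 - \<alpha>) / (1 + \<gamma>) * (v X3 * w X3) = 0"
      proof -
        have "(1 - \<beta>) * (1 + \<gamma>) * (v X1 * w X1 + (1 + \<alpha>) / (1 - \<beta>) * (v X2 * w X2) + (1 - \<alpha>) / (1 + \<gamma>) * (v X3 * w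
          X3))
          = (1-\<beta>)*(1+\<gamma>) * v X1 * w X1 + (1+\<alpha>)*(1+\<gamma>) * v X2 * w X2 + (1-\<alpha>)*(1-\<beta>) * v X3 * w X3"
          by (simp add: divide_simps) (simp add: algebra_simps)
        also note O(2)
        finally show ?thesis by (metis mult_eq_0_iff param_nz(6,8))
      qed
      have O1: "v X1 * w X1 - v X0 * w X0 + v X2 * w X2 + v X3 * w X3 = 0"
        using O(1) by Groebner_Basis.algebra
      show ?thesis using r R O1 O2
        unfolding sklyanin_relations_def Omega1_def Omega2_def comm_def acomm_def power2_eq_square
        by (auto simp: e mult.assoc[symmetric] simp del: const_simps) (simp_all add: e mult.assoc)
    next
      case False
      then show ?thesis using r
        unfolding sklyanin_relations_def Omega1_def Omega2_def comm_def acomm_def power2_eq_square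
        by (auto simp: var_def simp del: const_simps)
    qed
    then show ?thesis by (auto simp: J_def)
  qed
  ultimately have "I \<subseteq> J" by (rule relI_min)
  then have "f \<in> J" using assms(2) by (rule subsetD)
  then show ?thesis using assms(1) by (simp add: J_def)
qed

text \<open>Near any point of the cone the iterates of \<open>\<sigma>\<close> are given by polynomials, up to scalars that may vanish elsewhere.\<close>

lemma local_orbit:
  assumes "cone v" "v \<noteq> (\<lambda>_. 0)"
  shows "\<exists>T. (\<forall>j i. (\<lambda>v. T v j i) \<in> polyfun) \<and> (\<forall>v. T v 0 = v) \<and>
    (\<forall>v' j. cone v' \<longrightarrow> v' \<noteq> (\<lambda>_. 0) \<longrightarrow> (\<exists>c. T v' j = (\<lambda>i. c * orbit (proj v') j i))) \<and>
    (\<forall>j. T v j \<noteq> (\<lambda>_. 0))"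
proof -
  define Qs where "Qs x = (SOME Q. (\<forall>i. (\<lambda>v. Q v i) \<in> polyfun) \<and> Q x \<noteq> (\<lambda>_. 0) \<and> (\<forall>v' w. rels v' w
    \<longrightarrow> parallel (Q v') w))" for x
  have Qs: "(\<forall>i. (\<lambda>v. Qs x v i) \<in> polyfun) \<and> Qs x x \<noteq> (\<lambda>_. 0) \<and> (\<forall>v' w. rels v' w \<longrightarrow> parallel (Qs x v') w)"
    if "cone x" "x \<noteq> (\<lambda>_. 0)" for x
    unfolding Qs_def by (rule someI_ex[OF local_Q[OF that]])
  \<comment> \<open>\<open>t\<close> runs along the orbit of \<open>v\<close> and records at which
    points the local formulas are chosen; \<open>T\<close> applies these same formulas to any
    starting vector, hence is polynomial in it.\<close>
  define t where "t = rec_nat v (\<lambda>_ x. Qs x x)"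
  have t: "t 0 = v" "\<And>j. t (Suc j) = Qs (t j) (t j)" by (simp_all add: t_def)
  define T where "T y = rec_nat y (\<lambda>j x. Qs (t j) x)" for y
  have T: "\<And>y. T y 0 = y" "\<And>y j. T y (Suc j) = Qs (t j) (T y j)" by (simp_all add: T_def)
  have Tv: "T v j = t j" for j by (induction j) (simp_all add: t T)
  have step: "\<exists>c. Qs (t j) x = (\<lambda>i. c * orbit p (Suc j) i)"
    if tj: "cone (t j)" "t j \<noteq> (\<lambda>_. 0)" and p: "p \<in> E" and x: "x = (\<lambda>i. c * orbit p j i)" for j x p c
  proof -
    have "rels x (orbit p (Suc j))"
      unfolding x using rels_scale[OF orbit_rels[OF p, of j], of c 1] by simp
    then have "parallel (Qs (t j) x) (orbit p (Suc j))" using Qs[OF tj] by blast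
    then show ?thesis by (rule parD) (rule orbit(2)[OF p])
  qed
  have tt: "cone (t j) \<and> t j \<noteq> (\<lambda>_. 0) \<and> (\<exists>c. t j = (\<lambda>i. c * orbit (proj v) j i))" for j
  proof (induction j)
    case 0
    obtain c where "c \<noteq> 0" "rep (proj v) = (\<lambda>i. c * v i)" using rep_proj[OF assms] .
    then have "v = (\<lambda>i. 1 / c * orbit (proj v) 0 i)" by (simp add: orbit_def)
    then show ?case using assms t(1) by metis
  next
    case (Suc j)
    then obtain c where c: "t (Suc j) = (\<lambda>i. c * orbit (proj v) (Suc j) i)"
      using step[OF _ _ proj_in_E[OF assms]] t(2) by metis
    moreover have "t (Suc j) \<noteq> (\<lambda>_. 0)" using Qs[of "t j"] Suc t(2) by metis
    ultimately show ?case using cone_scale orbit(1)[OF proj_in_E[OF assms]] by metis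
  qed
  have "\<exists>c. T v' j = (\<lambda>i. c * orbit (proj v') j i)" if v': "cone v'" "v' \<noteq> (\<lambda>_. 0)" for v' j
  proof (induction j)
    case 0
    obtain c where "c \<noteq> 0" "rep (proj v') = (\<lambda>i. c * v' i)" using rep_proj[OF v'] .
    then have "v' = (\<lambda>i. 1 / c * orbit (proj v') 0 i)" by (simp add: orbit_def)
    then show ?case using T(1) by metis
  next
    case (Suc j)
    then show ?case using step[OF _ _ proj_in_E[OF v']] tt[of j] T(2) by metis
  qed
  moreover have "(\<lambda>v. T v j i) \<in> polyfun" for j i
  proof (induction j arbitrary: i)
    case 0 show ?case using T(1) by (simp add: polyfun.coord)
  next
    case (Suc j)
    have "(\<lambda>v. Qs (t j) (T v j) i) \<in> polyfun"
      by (rule polyfun_comp[where F = "\<lambda>x. Qs (t j) x i"]) (use Qs tt Suc in auto)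
    then show ?case by (simp add: T(2))
  qed
  moreover have "T v j \<noteq> (\<lambda>_. 0)" for j using tt Tv by metis
  ultimately show ?thesis using T(1) by (intro exI[of _ T]) blast
qed

text \<open>Zariski density. With the local formulas at \<open>p\<close> the evaluation becomes a
  polynomial function up to scalars, and its product with \<open>F\<close> vanishes on the
  cone.\<close>

lemma ev_seq_dense:
  assumes F: "F \<in> polyfun" "cone v0" "F v0 \<noteq> 0"
    and z: "\<And>v. cone v \<Longrightarrow> v \<noteq> (\<lambda>_. 0) \<Longrightarrow> F v \<noteq> 0 \<Longrightarrow> ev_seq (orbit (proj v)) n f = 0"
    and p: "p \<in> E"
  shows "ev_seq (orbit p) n f = 0"
proof -
  note r = rep[OF p]
  obtain T where T: "\<And>j i. (\<lambda>v. T v j i) \<in> polyfun" "\<And>v. T v 0 = v"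
    "\<And>v' j. cone v' \<Longrightarrow> v' \<noteq> (\<lambda>_. 0) \<Longrightarrow> \<exists>c. T v' j = (\<lambda>i. c * orbit (proj v') j i)"
    "\<And>j. T (rep p) j \<noteq> (\<lambda>_. 0)"
    using local_orbit[OF r(2,3)] by blast
  have sc: "\<exists>c. (\<forall>j i. T v j i = c j * orbit (proj v) j i)" if "cone v" "v \<noteq> (\<lambda>_. 0)" for v
  proof -
    have "\<forall>j. \<exists>c. T v j = (\<lambda>i. c * orbit (proj v) j i)" using T(3)[OF that] by blast
    from choice[OF this] obtain c where "\<And>j. T v j = (\<lambda>i. c j * orbit (proj v) j i)" by blast
    then have "\<forall>j i. T v j i = c j * orbit (proj v) j i" by simp
    then show ?thesis by blast
  qed
  have "(\<forall>v. cone v \<longrightarrow> F v = 0) \<or> (\<forall>v. cone v \<longrightarrow> ev_seq (T v) n f = 0)"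
  proof (rule cone_irreducible_nz[OF F(1) polyfun_EV[OF T(1)]])
    fix v assume v: "cone v" "v \<noteq> (\<lambda>_. 0)"
    obtain c where "\<forall>j i. T v j i = c j * orbit (proj v) j i" using sc[OF v] by blast
    then have "ev_seq (T v) n f = (\<Prod>j<n. c j) * ev_seq (orbit (proj v)) n f" by (intro ev_seq_scale) auto
    then show "F v * ev_seq (T v) n f = 0" using z[OF v] by (cases "F v = 0") auto
  qed
  with F have "ev_seq (T (rep p)) n f = 0" using r(2) by blast
  moreover obtain c where c: "\<forall>j i. T (rep p) j i = c j * orbit p j i" using sc[OF r(2,3)] unfolding r(4) by blast
  have "c j \<noteq> 0" for j using T(4)[of j] c by (auto simp: fun_eq_iff)
  moreover have "ev_seq (T (rep p)) n f = (\<Prod>j<n. c j) * ev_seq (orbit p) n f" using c by (intro ev_seq_scale) auto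
  ultimately show ?thesis by simp
qed

end

section \<open>Faithfulness of the point modules\<close>

text \<open>A basis of \<open>J\<close> stays independent when \<open>t\<close> is added; the
  functional with value 1 at \<open>t\<close> and 0 on the basis is recovered from its values on
  words.\<close>

lemma separating_functional:
  fixes t :: "'k::field fa"
  assumes J: "0 \<in> J" "\<And>f g. f \<in> J \<Longrightarrow> g \<in> J \<Longrightarrow> f + g \<in> J" "\<And>c f. f \<in> J \<Longrightarrow> const c * f \<in> J"
    and t: "t \<notin> J"
  shows "\<exists>\<phi>. (\<forall>f\<in>J. lin_ext \<phi> f = 0) \<and> lin_ext \<phi> t \<noteq> 0"
proof -
  interpret vs: vector_space "\<lambda>(c::'k) f. const c * f"
    by unfold_locales (simp_all add: algebra_simps)
  interpret ks: vector_space "(*) :: 'k \<Rightarrow> 'k \<Rightarrow> 'k"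
    by unfold_locales (simp_all add: algebra_simps)
  interpret vp: vector_space_pair "\<lambda>(c::'k) f. const c * f" "(*) :: 'k \<Rightarrow> 'k \<Rightarrow> 'k" ..
  have sub: "vs.subspace J" unfolding vs.subspace_def using J by blast
  obtain B where B: "B \<subseteq> J" "vs.independent B" "J \<subseteq> vs.span B"
    using vs.maximal_independent_subset[of J] by blast
  have sp: "vs.span B \<subseteq> J" using B(1) sub by (rule vs.span_minimal)
  then have tB: "t \<notin> vs.span B" using t by blast
  then have "vs.independent (insert t B)" using B(2) by (simp add: vs.independent_insert)
  then obtain g where g: "Vector_Spaces.linear (\<lambda>(c::'k) f. const c * f) (*) g"
      "\<forall>x\<in>insert t B. g x = (if x = t then 1 else 0)"
    using vp.linear_independent_extend[of "insert t B" "\<lambda>x. if x = t then 1 else 0"] by blast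
  interpret g: Vector_Spaces.linear "\<lambda>(c::'k) f. const c * f" "(*)" g by (rule g(1))
  have "t \<notin> B" using tB vs.span_base by blast
  then have gB: "g x = 0" if "x \<in> B" for x using g(2) that by auto
  have "lin_ext (\<lambda>w. g (wmono w 1)) f = g f" for f
  proof (induction f rule: fa_induct)
    case (wmono w c)
    have "g (const c * wmono w 1) = c * g (wmono w 1)" by (rule g.scale)
    then show ?case by (simp add: const_mono)
  qed (simp_all add: g.zero g.add)
  moreover have "g f = 0" if "f \<in> J" for f
    using vp.linear_eq_0_on_span[OF g(1) gB] B(3) that by blast
  moreover have "g t = 1" using g(2) by simp
  ultimately show ?thesis by (metis zero_neq_one)
qed

definition lform :: "(gen \<Rightarrow> 'k::field) \<Rightarrow> 'k fa" where "lform a = (\<Sum>i\<in>UNIV. const (a i) * var i)"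
definition dot :: "(gen \<Rightarrow> 'k::field) \<Rightarrow> (gen \<Rightarrow> 'k) \<Rightarrow> 'k" where "dot a v = (\<Sum>i\<in>UNIV. a i * v i)"
definition perp :: "(gen \<Rightarrow> 'k::field) set \<Rightarrow> (gen \<Rightarrow> 'k) set" where "perp V = {a. \<forall>v\<in>V. dot a v = 0}"
definition unit :: "gen \<Rightarrow> gen \<Rightarrow> 'k::field" where "unit i j = (if i = j then 1 else 0)"

lemma sum_gen: "(\<Sum>i\<in>UNIV. f i) = f X0 + f X1 + f X2 + (f X3 :: 'a :: comm_monoid_add)"
  by (simp add: gen_UNIV add.assoc)

lemma dot_simps: "dot a v = a X0 * v X0 + a X1 * v X1 + a X2 * v X2 + a X3 * v X3"
  by (simp add: dot_def sum_gen)

lemma lform_unit: "lform (unit i) = var i"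
  by (cases i) (simp_all add: lform_def unit_def sum_gen)

lemma ev_seq_lform_mult: "ev_seq u (Suc n) (lform a * f) = dot a (u 0) * ev_seq (\<lambda>j. u (Suc j)) n f"
  by (simp add: lform_def sum_distrib_right ev_seq_sum mult.assoc ev_seq_var_mult dot_def)

lemma homog_lform: "homog 1 (lform a)"
  unfolding lform_def by (intro homog_sum homog_const_mult homog_var)

lemma lform_diff: "lform (\<lambda>k. a k - c * b k) = lform a - const c * lform b"
  by (simp add: lform_def sum_subtractf sum_distrib_left algebra_simps)

text \<open>For suitable \<open>u\<close>, \<open>u'\<close> and coefficients, the forms in the
  first sum are those vanishing at a given point or on a given line.\<close>

lemma forms_split:
  "(\<Sum>i\<in>UNIV. var i * g i) = (\<Sum>i\<in>UNIV. lform (\<lambda>k. unit i k - c i * u k - d i * u' k) * g i)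
     + lform u * (\<Sum>i\<in>UNIV. const (c i) * g i) + lform u' * (\<Sum>i\<in>UNIV. const (d i) * g i)"
proof -
  have "lform (\<lambda>k. unit i k - c i * u k - d i * u' k) * g i
      = var i * g i - lform u * (const (c i) * g i) - lform u' * (const (d i) * g i)" for i
    unfolding lform_diff lform_unit by (simp add: left_diff_distrib const_central[of _ "lform _"] mult.assoc)
  then show ?thesis by (simp add: sum_subtractf sum_distrib_left)
qed

section \<open>Right ideals and functionals in degree two\<close>

context sklyanin begin

text \<open>Matrices of values on the products x_i x_j of functionals killing the degree two part of
  \<open>I\<close>. On a tensor they say \<open>rels\<close> together with the two central
  elements.\<close>

definition mat_rels :: "(gen \<Rightarrow> gen \<Rightarrow> 'k) \<Rightarrow> bool" where
  "mat_rels M \<longleftrightarrow>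
     2 * M X0 X1 = (\<alpha> + 1) * M X2 X3 + (\<alpha> - 1) * M X3 X2 \<and>
     2 * M X1 X0 = (1 - \<alpha>) * M X2 X3 - (1 + \<alpha>) * M X3 X2 \<and>
     2 * M X0 X2 = (\<beta> + 1) * M X3 X1 + (\<beta> - 1) * M X1 X3 \<and>
     2 * M X2 X0 = (1 - \<beta>) * M X3 X1 - (1 + \<beta>) * M X1 X3 \<and>
     2 * M X0 X3 = (\<gamma> + 1) * M X1 X2 + (\<gamma> - 1) * M X2 X1 \<and>
     2 * M X3 X0 = (1 - \<gamma>) * M X1 X2 - (1 + \<gamma>) * M X2 X1 \<and>
     M X1 X1 + M X2 X2 + M X3 X3 = M X0 X0 \<and>
     (1-\<beta>)*(1+\<gamma>) * M X1 X1 + (1+\<alpha>)*(1+\<gamma>) * M X2 X2 + (1-\<alpha>)*(1-\<beta>) * M X3 X3 = 0"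

lemma mat_rels_comb: "mat_rels M \<Longrightarrow> mat_rels N \<Longrightarrow> mat_rels (\<lambda>i j. s * M i j + t * N i j)"
  unfolding mat_rels_def by (elim conjE, intro conjI; Groebner_Basis.algebra)

lemma mat_rels_tensor: "rels v w \<Longrightarrow> cone v \<Longrightarrow> v \<noteq> (\<lambda>_. 0) \<Longrightarrow> mat_rels (\<lambda>i j. v i * w j)"
  using rels_omega[of v w] unfolding mat_rels_def rels_def by (simp add: mult.assoc)

text \<open>Degree n + 1 of the right ideal of B generated by the forms in \<open>A\<close>, lifted
  to the free algebra by adding all of \<open>I\<close>. The index is the degree of the cofactors,
  one less than that of the products.\<close>

inductive_set rspan :: "(gen \<Rightarrow> 'k) set \<Rightarrow> nat \<Rightarrow> 'k fa set" for A n where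
  rel: "f \<in> I \<Longrightarrow> f \<in> rspan A n"
| gen: "a \<in> A \<Longrightarrow> homog n g \<Longrightarrow> lform a * g \<in> rspan A n"
| add: "f \<in> rspan A n \<Longrightarrow> g \<in> rspan A n \<Longrightarrow> f + g \<in> rspan A n"

lemma rspan_mult: "f \<in> rspan A m \<Longrightarrow> homog n g \<Longrightarrow> f * g \<in> rspan A (m + n)"
  by (induction rule: rspan.induct)
    (auto simp: mult.assoc distrib_right intro: rspan.intros relI_closed homog_mult)

lemma rspan_const: "f \<in> rspan A n \<Longrightarrow> const c * f \<in> rspan A n"
proof (induction rule: rspan.induct)
  case (gen a g)
  have "const c * (lform a * g) = lform a * (const c * g)"
    by (metis const_central mult.assoc)
  then show ?case using gen by (simp add: rspan.gen homog_const_mult)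
qed (auto simp: distrib_left intro: rspan.intros relI_closed)

text \<open>The passage from degree two to all degrees: right cofactors are carried along
  unchanged.\<close>

lemma rspan_lift:
  assumes "\<And>b. b \<in> B \<Longrightarrow> lform l * lform b \<in> rspan A 1" "f \<in> rspan B n"
  shows "lform l * f \<in> rspan A (Suc n)"
  using assms(2)
proof (induction rule: rspan.induct)
  case (gen b g)
  then show ?case using rspan_mult[OF assms(1)[OF gen(1)] gen(2)] by (simp add: mult.assoc)
qed (auto simp: distrib_left intro: rspan.intros relI_closed)

lemma rspan_sum: "(\<And>x. x \<in> X \<Longrightarrow> F x \<in> rspan A n) \<Longrightarrow> sum F X \<in> rspan A n"
  by (induction X rule: infinite_finite_induct) (auto intro: rspan.intros relI_closed)

text \<open>A degree two element lies in the right ideal iff every linear functional killing the ideal kills it;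
  such a functional is the matrix \<open>M\<close> of its values on the products \<open>x\<^sub>i x\<^sub>j\<close>.\<close>

lemma rspan_functional:
  assumes "\<And>M. mat_rels M \<Longrightarrow> (\<And>a j. a \<in> A \<Longrightarrow> dot a (\<lambda>i. M i j) = 0) \<Longrightarrow> dot l (\<lambda>i. dot b (M i)) = 0"
  shows "lform l * lform b \<in> rspan A 1"
proof (rule ccontr)
  assume "lform l * lform b \<notin> rspan A 1"
  then obtain \<phi> where phi: "\<And>f. f \<in> rspan A 1 \<Longrightarrow> lin_ext \<phi> f = 0" "lin_ext \<phi> (lform l * lform b) \<noteq> 0"
    using separating_functional[of "rspan A 1" "lform l * lform b"] rspan_const rspan.add rspan.rel[OF
      relI_closed(1)]
    by blast
  define M where "M i j = lin_ext \<phi> (var i * var j)" for i j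
  have lin2: "lin_ext \<phi> (lform a * lform b) = dot a (\<lambda>i. dot b (M i))" for a b
  proof -
    have "lin_ext \<phi> (lform a * lform b) = (\<Sum>i\<in>UNIV. \<Sum>j\<in>UNIV. lin_ext \<phi> (const (a i) * (const (b j) * (var i * var
      j))))"
      unfolding lform_def sum_product lin_ext_sum
      by (intro sum.cong refl arg_cong[of _ _ "lin_ext \<phi>"]) (metis const_central mult.assoc)
    then show ?thesis by (simp add: dot_def M_def sum_distrib_left)
  qed
  have r: "lin_ext \<phi> f = 0" if "f \<in> gens" for f
    using relI_gens that by (intro phi(1) rspan.rel) blast
  note defs = sklyanin_relations_def Omega1_def Omega2_def comm_def acomm_def power2_eq_square
  have 1: "M X0 X1 - M X1 X0 = \<alpha> * (M X2 X3 + M X3 X2)" "M X0 X1 + M X1 X0 = M X2 X3 - M X3 X2"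
    "M X0 X2 - M X2 X0 = \<beta> * (M X3 X1 + M X1 X3)" "M X0 X2 + M X2 X0 = M X3 X1 - M X1 X3"
    "M X0 X3 - M X3 X0 = \<gamma> * (M X1 X2 + M X2 X1)" "M X0 X3 + M X3 X0 = M X1 X2 - M X2 X1"
    "- M X0 X0 + M X1 X1 + M X2 X2 + M X3 X3 = 0"
    "M X1 X1 + (1 + \<alpha>) / (1 - \<beta>) * M X2 X2 + (1 - \<alpha>) / (1 + \<gamma>) * M X3 X3 = 0"
    using r[of "comm (var X0) (var X1) - const \<alpha> * acomm (var X2) (var X3)"]
      r[of "acomm (var X0) (var X1) - comm (var X2) (var X3)"]
      r[of "comm (var X0) (var X2) - const \<beta> * acomm (var X3) (var X1)"]
      r[of "acomm (var X0) (var X2) - comm (var X3) (var X1)"]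
      r[of "comm (var X0) (var X3) - const \<gamma> * acomm (var X1) (var X2)"]
      r[of "acomm (var X0) (var X3) - comm (var X1) (var X2)"] r[of Omega1] r[of "Omega2 \<alpha> \<beta> \<gamma>"]
    unfolding defs M_def by (simp_all add: mult.assoc del: const_simps)
  have "(1-\<beta>)*(1+\<gamma>) * M X1 X1 + (1+\<alpha>)*(1+\<gamma>) * M X2 X2 + (1-\<alpha>)*(1-\<beta>) * M X3 X3
    = (1-\<beta>)*(1+\<gamma>) * (M X1 X1 + (1 + \<alpha>) / (1 - \<beta>) * M X2 X2 + (1 - \<alpha>) / (1 + \<gamma>) * M X3 X3)"
    by (simp add: divide_simps) (simp add: algebra_simps)
  then have "(1-\<beta>)*(1+\<gamma>) * M X1 X1 + (1+\<alpha>)*(1+\<gamma>) * M X2 X2 + (1-\<alpha>)*(1-\<beta>) * M X3 X3 = 0"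
    unfolding 1(8) by simp
  then have "mat_rels M" unfolding mat_rels_def using 1(1-7)
    by (intro conjI; Groebner_Basis.algebra)
  moreover have "dot a (\<lambda>i. M i j) = 0" if "a \<in> A" for a j
    using phi(1)[OF rspan.gen[OF that homog_lform[of "unit j"]]] unfolding lin2
    by (cases j) (simp_all add: dot_simps unit_def)
  ultimately show False using assms phi(2) lin2 by metis
qed

lemma nonzero_coord: "v \<noteq> (\<lambda>_. 0) \<Longrightarrow> \<exists>t. v t \<noteq> (0::'k)"
  by auto

end

section \<open>The right ideals of a point and of a secant line\<close>

context sklyanin_translation begin

lemma orbit_Suc: "(\<lambda>j. orbit p (Suc j)) = orbit (\<sigma> p)"
  using orbit_shift(1)[of p 1] by (simp add: fun_eq_iff)

lemma ev_seq_orb_lform: "ev_seq (orbit p) (Suc n) (lform a * f) = dot a (orbit p 0) * ev_seq (orbit (\<sigma> p)) n f"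
  by (simp add: ev_seq_lform_mult orbit_Suc)

text \<open>A functional killing the forms through \<open>p\<close> in its first slot is a tensor
  \<open>v \<otimes> \<psi>\<close>, and the relations make \<psi> a multiple of the successor of
  \<open>v\<close>, where \<open>b\<close> vanishes.\<close>

lemma vanish_point_step:
  assumes p: "p \<in> E" and b: "dot b (orbit (\<sigma> p) 0) = 0"
  shows "lform l * lform b \<in> rspan (perp {orbit p 0}) 1"
proof (rule rspan_functional)
  fix M assume M: "mat_rels M" and A: "\<And>a j. a \<in> perp {orbit p 0} \<Longrightarrow> dot a (\<lambda>i. M i j) = 0"
  define v w where "v = orbit p 0" and "w = orbit (\<sigma> p) 0"
  have v: "cone v" "v \<noteq> (\<lambda>_. 0)" "w \<noteq> (\<lambda>_. 0)" and vw: "rels v w"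
    using orbit[OF p] orbit[OF sigma_E[OF p]] orbit_rels[OF p, of 0] orbit_shift(1)[of p 1 0]
    by (auto simp: v_def w_def)
  obtain t where t: "v t \<noteq> 0" using nonzero_coord[OF v(2)] by blast
  define \<psi> where "\<psi> j = M t j / v t" for j
  have Mv: "M i j = v i * \<psi> j" for i j
  proof -
    have "dot (\<lambda>k. unit i k * v t - unit t k * v i) v = 0"
      by (cases i; cases t) (simp_all add: dot_simps unit_def)
    then have "dot (\<lambda>k. unit i k * v t - unit t k * v i) (\<lambda>i. M i j) = 0"
      by (intro A) (simp add: perp_def v_def)
    then have "M i j * v t = M t j * v i"
      by (cases i; cases t) (simp_all add: dot_simps unit_def mult.commute)
    then show ?thesis using t by (simp add: \<psi>_def field_simps)
  qed
  have "rels v \<psi>" using M unfolding mat_rels_def rels_def Mv by (simp add: mult.assoc)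
  then obtain c where "\<psi> = (\<lambda>i. c * w i)" using rels_unique[OF v(1,2) _ vw v(3)] by blast
  moreover have "dot b w = 0" using b by (simp add: w_def)
  ultimately have "dot b \<psi> = 0" by (simp add: dot_def sum_distrib_left[symmetric] mult.left_commute)
  moreover have "dot b (M i) = v i * dot b \<psi>" for i
    by (simp add: dot_def Mv sum_distrib_left mult.left_commute)
  ultimately show "dot l (\<lambda>i. dot b (M i)) = 0" by (simp add: dot_def)
qed

text \<open>Modulo forms vanishing at p, \<open>f\<close> is x_t h with a coordinate t that is
  nonzero at p. Then \<open>h\<close> vanishes at \<sigma> p, so induction applies to it and
  \<open>rspan_lift\<close> returns to p.\<close>

lemma vanish_point:
  assumes "p \<in> E" "homog (Suc n) f" "ev_seq (orbit p) (Suc n) f = 0"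
  shows "f \<in> rspan (perp {orbit p 0}) n"
  using assms
proof (induction n arbitrary: p f rule: less_induct)
  case (less n p f)
  define v where "v = orbit p 0"
  obtain t where t: "v t \<noteq> 0" using nonzero_coord[OF orbit(2)[OF less(2), of 0]] by (auto simp: v_def)
  obtain g where g: "\<And>i. homog n (g i)" "f = (\<Sum>i\<in>UNIV. var i * g i)" using homog_SucE[OF less(3)] by metis
  define h where "h = (\<Sum>i\<in>UNIV. const (v i / v t) * g i)"
  have h: "homog n h" unfolding h_def by (intro homog_sum homog_const_mult g)
  \<comment> \<open>Only one form is split off; the second one and its coefficients are zero, which
    leaves the term \<open>0 * 0\<close>.\<close>
  define r where "r = (\<Sum>i\<in>UNIV. lform (\<lambda>k. unit i k - v i / v t * unit t k - 0 * (0::'a)) * g i)"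
  have fr: "f = r + lform (unit t) * h"
    unfolding g(2) forms_split[of g "\<lambda>i. v i / v t" "unit t" "\<lambda>_. 0" "\<lambda>_. 0"] r_def h_def by simp
  have perp: "(\<lambda>k. unit i k - v i / v t * unit t k - 0 * 0) \<in> perp {v}" for i
    using t by (cases i; cases t) (simp_all add: perp_def dot_simps unit_def)
  have r: "r \<in> rspan (perp {v}) n"
    unfolding r_def by (intro rspan_sum rspan.gen perp g)
  have "ev_seq (orbit p) (Suc n) r = 0"
    unfolding r_def ev_seq_sum ev_seq_orb_lform using perp by (intro sum.neutral) (simp add: perp_def v_def)
  then have "dot (unit t) v * ev_seq (orbit (\<sigma> p)) n h = 0"
    using less(4) unfolding fr ev_seq_simps ev_seq_orb_lform v_def by simp
  moreover have "dot (unit t) v = v t" by (cases t) (simp_all add: dot_simps unit_def)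
  ultimately have hz: "ev_seq (orbit (\<sigma> p)) n h = 0" using t by simp
  have "lform (unit t) * h \<in> rspan (perp {v}) n"
  proof (cases n)
    case 0
    then obtain c where "h = const c" using homog_0E h by metis
    then have "h = 0" using hz 0 by simp
    then show ?thesis by (simp add: rspan.rel relI_closed(1))
  next
    case (Suc m)
    then have "h \<in> rspan (perp {orbit (\<sigma> p) 0}) m"
      using less(1)[of m "\<sigma> p" h] sigma_E[OF less(2)] h hz by simp
    then have "lform (unit t) * h \<in> rspan (perp {v}) (Suc m)" unfolding v_def
      by (rule rspan_lift[rotated]) (rule vanish_point_step[OF less(2)], simp add: perp_def)
    then show ?thesis using Suc by simp
  qed
  then show ?case using r unfolding fr v_def[symmetric] by (intro rspan.add)
qed

text \<open>By \<open>T\<close> the functionals killing the forms on the line are determined by two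
  entries, hence are spanned by \<open>v \<otimes> w\<close> and \<open>v' \<otimes> w'\<close>.
  Forms dual to \<open>v\<close>, \<open>v'\<close> then separate the claim into one use of
  \<open>vanish_point\<close> at each image point.\<close>

lemma vanish_line:
  assumes q: "q \<in> E" "q' \<in> E" "q \<noteq> q'"
    and T: "\<And>M. mat_rels M \<Longrightarrow> (\<And>a j. a \<in> perp {orbit q 0, orbit q' 0} \<Longrightarrow> dot a (\<lambda>i. M i j) = 0)
      \<Longrightarrow> M i1 j1 = 0 \<Longrightarrow> M i2 j2 = 0 \<Longrightarrow> (\<forall>i j. M i j = 0)"
    and f: "homog (Suc n) f" "ev_seq (orbit q) (Suc n) f = 0" "ev_seq (orbit q') (Suc n) f = 0"
  shows "f \<in> rspan (perp {orbit q 0, orbit q' 0}) n"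
proof -
  define v v' w w' where "v = orbit q 0" and "v' = orbit q' 0" and "w = orbit (\<sigma> q) 0" and "w' = orbit (\<sigma> q') 0"
  note vs = v_def v'_def w_def w'_def
  let ?S = "perp {v, v'}"
  have v: "cone v" "v \<noteq> (\<lambda>_. 0)" "w \<noteq> (\<lambda>_. 0)" "rels v w"
    using orbit[OF q(1)] orbit[OF sigma_E[OF q(1)]] orbit_rels[OF q(1), of 0] orbit_shift(1)[of q 1 0]
      by (auto simp: vs)
  have v': "cone v'" "v' \<noteq> (\<lambda>_. 0)" "w' \<noteq> (\<lambda>_. 0)" "rels v' w'"
    using orbit[OF q(2)] orbit[OF sigma_E[OF q(2)]] orbit_rels[OF q(2), of 0] orbit_shift(1)[of q' 1 0]
      by (auto simp: vs)
  have npar: "\<not> parallel v v'"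
  proof
    assume "parallel v v'"
    then obtain c where c: "v = (\<lambda>i. c * v' i)" using parD v'(2) by blast
    then have "c \<noteq> 0" using v(2) by auto
    then have "proj v = proj v'" using proj_scale c by blast
    then show False using orbit(3)[OF q(1), of 0] orbit(3)[OF q(2), of 0] q(3) by (simp add: vs)
  qed
  then obtain i0 j0 where ij: "v i0 * v' j0 - v j0 * v' i0 \<noteq> 0" by (auto simp: parallel_def)
  define D where "D = v i0 * v' j0 - v j0 * v' i0"
  \<comment> \<open>\<open>u\<close>, \<open>u'\<close> is the basis dual to \<open>v\<close>,
    \<open>v'\<close>, obtained from a nonzero 2 x 2 minor by Cramer's rule.\<close>
  define u where "u k = (v' j0 * unit i0 k - v' i0 * unit j0 k) / D" for k
  define u' where "u' k = (v i0 * unit j0 k - v j0 * unit i0 k) / D" for k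
  have du: "dot u x = (v' j0 * x i0 - v' i0 * x j0) / D" "dot u' x = (v i0 * x j0 - v j0 * x i0) / D" for x
    unfolding u_def u'_def by (cases i0; cases j0; simp add: dot_simps unit_def; simp add: field_simps
      add_divide_distrib diff_divide_distrib)+
  have D: "D \<noteq> 0" using ij by (simp add: D_def)
  have u: "dot u v = 1" "dot u v' = 0" "dot u' v = 0" "dot u' v' = 1"
    using D unfolding du by (simp_all add: D_def mult.commute)
  have perp: "(\<lambda>k. unit i k - v i * u k - v' i * u' k) \<in> ?S" for i
  proof -
    have "dot (\<lambda>k. unit i k - v i * u k - v' i * u' k) x = x i - v i * dot u x - v' i * dot u' x" for x
      by (cases i) (simp_all add: dot_simps unit_def algebra_simps)
    then show ?thesis using u by (simp add: perp_def)
  qed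
  have tens: "dot a (\<lambda>i. v i * w j) = 0" "dot a (\<lambda>i. v' i * w' j) = 0" if "a \<in> ?S" for a j
  proof -
    have "dot a (\<lambda>i. x i * c) = dot a x * c" for x c by (simp add: dot_simps algebra_simps)
    then show "dot a (\<lambda>i. v i * w j) = 0" "dot a (\<lambda>i. v' i * w' j) = 0" using that by (simp_all add: perp_def)
  qed
  have step: "lform u * lform b \<in> rspan ?S 1" "lform u' * lform b' \<in> rspan ?S 1" if b: "dot b w = 0"
    "dot b' w' = 0" for b b'
  proof -
    have ex: "\<exists>x y. \<forall>i j. M i j = x * (v i * w j) + y * (v' i * w' j)"
      if M: "mat_rels M" "\<And>a j. a \<in> ?S \<Longrightarrow> dot a (\<lambda>i. M i j) = 0" for M
    proof -
      have Q: "mat_rels (\<lambda>i j. v i * w j)" "mat_rels (\<lambda>i j. v' i * w' j)"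
        using mat_rels_tensor v v' by blast+
      have Z: "\<forall>i j. r * M i j + (x * (v i * w j) + y * (v' i * w' j)) = 0"
        if "r * M i1 j1 + (x * (v i1 * w j1) + y * (v' i1 * w' j1)) = 0"
          "r * M i2 j2 + (x * (v i2 * w j2) + y * (v' i2 * w' j2)) = 0" for r x y
      proof (rule T)
        show "mat_rels (\<lambda>i j. r * M i j + (x * (v i * w j) + y * (v' i * w' j)))"
          using mat_rels_comb[OF M(1) mat_rels_comb[OF Q, of x y], of r 1] by simp
        fix a j assume "a \<in> perp {orbit q 0, orbit q' 0}"
        then have a: "a \<in> ?S" by (simp add: vs)
        have "dot a (\<lambda>i. r * M i j + (x * (v i * w j) + y * (v' i * w' j)))
          = r * dot a (\<lambda>i. M i j) + x * dot a (\<lambda>i. v i * w j) + y * dot a (\<lambda>i. v' i * w' j)"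
          by (simp add: dot_simps algebra_simps)
        then show "dot a (\<lambda>i. r * M i j + (x * (v i * w j) + y * (v' i * w' j))) = 0"
          using M(2)[OF a] tens[OF a] by simp
      qed (use that in auto)
      obtain k where k: "w k \<noteq> 0" using nonzero_coord v(3) by blast
      obtain k' where k': "w' k' \<noteq> 0" using nonzero_coord v'(3) by blast
      have indep: "x = 0 \<and> y = 0" if xy: "\<forall>i j. x * (v i * w j) + y * (v' i * w' j) = 0" for x y
      proof -
        have e: "x * w j * dot a v + y * w' j * dot a v' = 0" for a j
        proof -
          have "x * w j * dot a v + y * w' j * dot a v' = dot a (\<lambda>i. x * (v i * w j) + y * (v' i * w' j))"
            by (simp add: dot_simps algebra_simps)
          then show ?thesis using xy by (simp add: dot_simps)
        qed
        show ?thesis using e[of k u] e[of k' u'] u k k' by simp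
      qed
      define a1 a2 b1 b2 where "a1 = v i1 * w j1" and "a2 = v i2 * w j2" and "b1 = v' i1 * w' j1"
        and "b2 = v' i2 * w' j2"
      \<comment> \<open>Otherwise a nontrivial combination of the two tensors vanishes at both test
        entries, hence everywhere by \<open>T\<close>, against their independence.\<close>
      have dn: "a1 * b2 - b1 * a2 \<noteq> 0"
      proof
        assume d0: "a1 * b2 - b1 * a2 = 0"
        have "b1 = 0 \<and> - a1 = 0"
          by (rule indep) (use Z[of 0 b1 "- a1"] d0 in \<open>simp add: a1_def a2_def b1_def b2_def algebra_simps\<close>)
        moreover have "b2 = 0 \<and> - a2 = 0"
          by (rule indep) (use Z[of 0 b2 "- a2"] d0 in \<open>simp add: a1_def a2_def b1_def b2_def algebra_simps\<close>)
        ultimately have "\<forall>i j. 0 * M i j + (1 * (v i * w j) + 1 * (v' i * w' j)) = 0"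
          by (intro Z) (auto simp: a1_def a2_def b1_def b2_def)
        then show False using indep[of 1 1] by simp
      qed
      define x where "x = (M i1 j1 * b2 - b1 * M i2 j2) / (a1 * b2 - b1 * a2)"
      define y where "y = (a1 * M i2 j2 - M i1 j1 * a2) / (a1 * b2 - b1 * a2)"
      have xy1: "x * a1 + y * b1 = M i1 j1"
      proof -
        have "(a1 * b2 - b1 * a2) * (x * a1 + y * b1) = (a1 * b2 - b1 * a2) * M i1 j1"
          using dn by (simp add: x_def y_def distrib_left) (simp add: algebra_simps)
        then show ?thesis using dn by simp
      qed
      have xy2: "x * a2 + y * b2 = M i2 j2"
      proof -
        have "(a1 * b2 - b1 * a2) * (x * a2 + y * b2) = (a1 * b2 - b1 * a2) * M i2 j2"
          using dn by (simp add: x_def y_def distrib_left) (simp add: algebra_simps)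
        then show ?thesis using dn by simp
      qed
      have "\<forall>i j. (- 1) * M i j + (x * (v i * w j) + y * (v' i * w' j)) = 0"
        using xy1 xy2 by (intro Z) (simp_all add: a1_def a2_def b1_def b2_def)
      then show ?thesis by (intro exI[of _ x] exI[of _ y]) (simp add: eq_neg_iff_add_eq_0 add.commute
        neg_eq_iff_add_eq_0)
    qed
    have ev: "dot l (\<lambda>i. dot b (M i)) = x * (dot l v * dot b w) + y * (dot l v' * dot b w')"
      if "\<forall>i j. M i j = x * (v i * w j) + y * (v' i * w' j)" for M x y l b
    proof -
      have "dot b (M i) = (x * dot b w) * v i + (y * dot b w') * v' i" for i
        using that by (simp add: dot_simps algebra_simps)
      then show ?thesis by (simp add: dot_simps algebra_simps)
    qed
    show "lform u * lform b \<in> rspan ?S 1"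
    proof (rule rspan_functional)
      fix M assume "mat_rels M" "\<And>a j. a \<in> ?S \<Longrightarrow> dot a (\<lambda>i. M i j) = 0"
      then obtain x y where "\<forall>i j. M i j = x * (v i * w j) + y * (v' i * w' j)" using ex by blast
      from ev[OF this] show "dot u (\<lambda>i. dot b (M i)) = 0" using u b by simp
    qed
    show "lform u' * lform b' \<in> rspan ?S 1"
    proof (rule rspan_functional)
      fix M assume "mat_rels M" "\<And>a j. a \<in> ?S \<Longrightarrow> dot a (\<lambda>i. M i j) = 0"
      then obtain x y where "\<forall>i j. M i j = x * (v i * w j) + y * (v' i * w' j)" using ex by blast
      from ev[OF this] show "dot u' (\<lambda>i. dot b' (M i)) = 0" using u b by simp
    qed
  qed
  obtain g where g: "\<And>i. homog n (g i)" "f = (\<Sum>i\<in>UNIV. var i * g i)" using homog_SucE[OF f(1)] by metis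
  define h where "h = (\<Sum>i\<in>UNIV. const (v i) * g i)"
  define h' where "h' = (\<Sum>i\<in>UNIV. const (v' i) * g i)"
  have h: "homog n h" "homog n h'" unfolding h_def h'_def by (intro homog_sum homog_const_mult g)+
  define r where "r = (\<Sum>i\<in>UNIV. lform (\<lambda>k. unit i k - v i * u k - v' i * u' k) * g i)"
  have fr: "f = r + lform u * h + lform u' * h'"
    unfolding g(2) forms_split[of g v u v' u'] r_def h_def h'_def by simp
  have r: "r \<in> rspan ?S n" unfolding r_def by (intro rspan_sum rspan.gen perp g)
  have rz: "ev_seq (orbit q) (Suc n) r = 0" "ev_seq (orbit q') (Suc n) r = 0"
    unfolding r_def ev_seq_sum ev_seq_orb_lform using perp by (auto intro!: sum.neutral simp: perp_def vs)
  \<comment> \<open>At \<open>q\<close> the form \<open>u\<close> is 1 and \<open>u'\<close> is 0,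
    at \<open>q'\<close> the reverse, so each cofactor is seen alone.\<close>
  have hz: "ev_seq (orbit (\<sigma> q)) n h = 0" "ev_seq (orbit (\<sigma> q')) n h' = 0"
    using f(2,3) rz u unfolding fr ev_seq_simps ev_seq_orb_lform vs by simp_all
  have "lform u * h \<in> rspan ?S n \<and> lform u' * h' \<in> rspan ?S n"
  proof (cases n)
    case 0
    then obtain c c' where "h = const c" "h' = const c'" using homog_0E h by metis
    then have "h = 0" "h' = 0" using hz 0 by simp_all
    then show ?thesis by (simp add: rspan.rel relI_closed(1))
  next
    case (Suc m)
    have "h \<in> rspan (perp {w}) m" "h' \<in> rspan (perp {w'}) m"
      using vanish_point[of "\<sigma> q" m h] vanish_point[of "\<sigma> q'" m h'] sigma_E q h hz Suc by (simp_all add: vs)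
    moreover have "lform u * lform b \<in> rspan ?S 1" if "b \<in> perp {w}" for b
      using step(1)[of b "\<lambda>_. 0"] that by (simp add: perp_def dot_def)
    moreover have "lform u' * lform b \<in> rspan ?S 1" if "b \<in> perp {w'}" for b
      using step(2)[of "\<lambda>_. 0" b] that by (simp add: perp_def dot_def)
    ultimately show ?thesis using Suc rspan_lift by metis
  qed
  then show ?thesis using r unfolding fr vs[symmetric] by (intro rspan.add) auto
qed

text \<open>\<open>z\<close> and \<open>z'\<close> are the points of E on the line x1 = x3 - s x2 =
  0. A functional killing both forms is determined by its rows \<open>X0\<close> and
  \<open>X2\<close>, and the relations leave \<open>M X2 X1\<close> and \<open>M X2 X2\<close> as
  the only free entries.\<close>

lemma vanish_line1:
  assumes z: "cone z" "cone z'" "z X1 = 0" "z' X1 = 0" "z X2 = 1" "z' X2 = 1" "z X3 = s" "z' X3 = s"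
    "z' X0 = - z X0" "z X0 \<noteq> 0" and s: "(1-\<beta>) * s\<^sup>2 = - (1+\<gamma>)"
    and f: "homog (Suc n) f" "ev_seq (orbit (proj z)) (Suc n) f = 0" "ev_seq (orbit (proj z')) (Suc n) f = 0"
  shows "\<exists>g h. homog n g \<and> homog n h \<and> f - (var X1 * g + lform (\<lambda>k. unit X3 k - s * unit X2 k) * h) \<in> I"
proof -
  let ?l = "\<lambda>k. unit X3 k - s * unit X2 k"
  have nz: "z \<noteq> (\<lambda>_. 0)" "z' \<noteq> (\<lambda>_. 0)" using z by (auto simp: fun_eq_iff intro!: exI[of _ X2])
  obtain c where c: "c \<noteq> 0" "orbit (proj z) 0 = (\<lambda>i. c * z i)" using rep_proj[OF z(1) nz(1)]
    by (auto simp: orbit_def)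
  obtain c' where c': "c' \<noteq> 0" "orbit (proj z') 0 = (\<lambda>i. c' * z' i)" using rep_proj[OF z(2) nz(2)]
    by (auto simp: orbit_def)
  have E: "proj z \<in> E" "proj z' \<in> E" using proj_in_E z nz by blast+
  have ne: "proj z \<noteq> proj z'"
  proof
    assume "proj z = proj z'"
    then obtain d where "z = (\<lambda>i. d * z' i)" using self_in_proj[of z] by (auto simp: proj_def[of z'])
    then have "z X2 = d * z' X2" "z X0 = d * z' X0" by metis+
    then have "2 * z X0 = 0" using z by simp
    then show False using z(10) two_nz mult_eq_0_iff by blast
  qed
  let ?S = "perp {orbit (proj z) 0, orbit (proj z') 0}"
  have S1: "unit X1 \<in> ?S" "?l \<in> ?S"
    using z unfolding perp_def c c' by (simp_all add: dot_simps unit_def)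
  have "f \<in> rspan ?S n"
  proof (rule vanish_line[OF E ne _ f])
    fix M assume M: "mat_rels M" and A: "\<And>a j. a \<in> ?S \<Longrightarrow> dot a (\<lambda>i. M i j) = 0"
      and T: "M X2 X1 = 0" "M X2 X2 = 0"
    have 1: "M X1 j = 0" for j using A[OF S1(1), of j] by (simp add: dot_simps unit_def)
    have 3: "M X3 j = s * M X2 j" for j using A[OF S1(2), of j] by (simp add: dot_simps unit_def)
    have 2: "(1 - \<alpha>) * M X2 X3 = 0" "2 * M X2 X0 = 0" using M T unfolding mat_rels_def 1 3 by auto
    then have 2: "M X2 j = 0" for j using T by (cases j) simp_all
    have "2 * M X0 X1 = 0" "2 * M X0 X2 = 0" "2 * M X0 X3 = 0" "M X0 X0 = 0"
      using M unfolding mat_rels_def 1 3 2 by auto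
    then have "M X0 j = 0" for j by (cases j) simp_all
    then have "M i j = 0" for i j using 1 2 3 by (cases i) simp_all
    then show "\<forall>i j. M i j = 0" by blast
  qed
  then show ?thesis
  proof (induction rule: rspan.induct)
    case (rel f)
    have "homog n (0 :: 'a fa)" "f - (var X1 * 0 + lform ?l * 0) \<in> I" using rel by simp_all
    then show ?case by blast
  next
    case (gen a g)
    have "dot a z = 0" "dot a z' = 0"
    proof -
      have "c * dot a z = 0" "c' * dot a z' = 0" using gen(1)
        unfolding perp_def c c' by (simp_all add: dot_simps algebra_simps)
      then show "dot a z = 0" "dot a z' = 0" using c c' by simp_all
    qed
    then have e: "a X0 * z X0 + a X2 + a X3 * s = 0" "- (a X0 * z X0) + a X2 + a X3 * s = 0"
      using z by (simp_all add: dot_simps)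
    \<comment> \<open>The points differ in the sign of x0 alone, so vanishing at both removes x0
      from the form.\<close>
    then have "2 * (a X0 * z X0) = 0" by Groebner_Basis.algebra
    then have a0: "a X0 = 0" using z(10) by simp
    then have a2: "a X2 = - a X3 * s" using e by (simp add: eq_neg_iff_add_eq_0)
    have "lform a = const (a X1) * var X1 + const (a X3) * lform ?l"
      unfolding lform_diff lform_unit unfolding lform_def sum_gen a0 a2
      by (simp add: algebra_simps) (metis const_central mult.assoc)
    then have "lform a * g = var X1 * (const (a X1) * g) + lform ?l * (const (a X3) * g)"
      by (simp add: distrib_right const_central mult.assoc)
    then have "lform a * g - (var X1 * (const (a X1) * g) + lform ?l * (const (a X3) * g)) \<in> I"
      by (simp add: relI_closed(1))
    then show ?case using homog_const_mult[OF gen(2)] by blast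
  next
    case (add f f')
    then obtain g h g' h' where "homog n g" "homog n h" "homog n g'" "homog n h'"
      and "f - (var X1 * g + lform ?l * h) \<in> I"
        "f' - (var X1 * g' + lform ?l * h') \<in> I" by blast
    then have "homog n (g + g')" "homog n (h + h')"
      "f + f' - (var X1 * (g + g') + lform ?l * (h + h')) \<in> I"
      using relI_closed(2)[of "f - (var X1 * g + lform ?l * h)" "f' - (var X1 * g' + lform ?l * h')"]
      by (auto intro: homog_add simp: algebra_simps)
    then show ?case by blast
  qed
qed

text \<open>These are the two coefficients, up to nonzero factors, of \<open>line2_relation\<close>.
  As one is nonzero, that relation determines \<open>M X2 X3\<close> from \<open>M X2 X2\<close> or
  conversely, which gives \<open>vanish_line\<close> its two test entries on the second
  line.\<close>

lemma line2_nondegenerate: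
  "(1-\<beta>)\<^sup>2 * (1-\<alpha>)\<^sup>2 + 4*\<beta>*(1+\<alpha>)\<^sup>2 \<noteq> 0 \<or> (1+\<gamma>)\<^sup>2 * (1+\<alpha>)\<^sup>2 - 4*\<gamma>*(1-\<alpha>)\<^sup>2 \<noteq> 0"
proof (rule ccontr)
  assume "\<not> ?thesis"
  then have a: "(1-\<beta>)\<^sup>2 * (1-\<alpha>)\<^sup>2 + 4*\<beta>*(1+\<alpha>)\<^sup>2 = 0" and b: "(1+\<gamma>)\<^sup>2 * (1+\<alpha>)\<^sup>2 - 4*\<gamma>*(1-\<alpha>)\<^sup>2 = 0" by auto
  note m = param_prod(2)
  \<comment> \<open>Multiplied by (1 - \<gamma>)^2 and (1 + \<beta>)^2 respectively, the two
    equations acquire by this identity the factors (1 + \<alpha>)^2 and (1 - \<alpha>)^2, which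
    cancel.\<close>
  have m2: "((1+\<alpha>) * (1+\<beta>) * (1+\<gamma>))\<^sup>2 = ((1-\<alpha>) * (1-\<beta>) * (1-\<gamma>))\<^sup>2" using m by simp
  have "(1+\<alpha>)\<^sup>2 * ((1+\<beta>)\<^sup>2*(1+\<gamma>)\<^sup>2 + 4*\<beta>*(1-\<gamma>)\<^sup>2) = 0"
    using a m2 by Groebner_Basis.algebra
  then have a': "(1+\<beta>)\<^sup>2*(1+\<gamma>)\<^sup>2 = - 4*\<beta>*(1-\<gamma>)\<^sup>2" by (simp add: eq_neg_iff_add_eq_0)
  have "(1-\<alpha>)\<^sup>2 * ((1-\<beta>)\<^sup>2*(1-\<gamma>)\<^sup>2 - 4*\<gamma>*(1+\<beta>)\<^sup>2) = 0"
    using b m2 by Groebner_Basis.algebra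
  then have b': "(1-\<beta>)\<^sup>2*(1-\<gamma>)\<^sup>2 = 4*\<gamma>*(1+\<beta>)\<^sup>2" by simp
  have "2 * ((1+\<beta>)\<^sup>2 * (1-\<gamma>)\<^sup>2) = 0" using a' b' by Groebner_Basis.algebra
  then show False by simp
qed

text \<open>The \<open>\<sigma>\<close>-images of the two points of \<open>E\<close> on the line \<open>x\<^sub>1 = x\<^sub>3 + s x\<^sub>2 = 0\<close> span the line
  \<open>x\<^sub>3 + \<kappa> x\<^sub>2 = x\<^sub>0 + \<eta> x\<^sub>1 = 0\<close>.\<close>

lemma line2_relation:
  assumes M: "mat_rels M" and 3: "\<And>j. M X3 j = - \<kappa> * M X2 j" and 0: "\<And>j. M X0 j = - \<eta> * M X1 j"
    and k: "(1-\<alpha>) * \<kappa> = s * (1+\<alpha>)" and l: "2 * \<eta> = s * (1-\<beta>)" and s: "(1-\<beta>) * s\<^sup>2 = - (1+\<gamma>)"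
  shows "s * (1+\<gamma>) * ((1-\<beta>)\<^sup>2 * (1-\<alpha>)\<^sup>2 + 4*\<beta>*(1+\<alpha>)\<^sup>2) * M X2 X3
    = (1-\<beta>) * ((1+\<gamma>)\<^sup>2 * (1+\<alpha>)\<^sup>2 - 4*\<gamma>*(1-\<alpha>)\<^sup>2) * M X2 X2"
proof -
  define y2 y3 where "y2 = M X2 X2" and "y3 = M X2 X3"
  have e: "2 * M X1 X0 = (1-\<alpha>) * y3 + (1+\<alpha>) * \<kappa> * y2" "M X1 X1 + y2 - \<kappa> * y3 = - \<eta> * M X1 X0"
    "(1-\<beta>)*(1+\<gamma>) * M X1 X1 + (1+\<alpha>)*(1+\<gamma>) * y2 - (1-\<alpha>)*(1-\<beta>) * \<kappa> * y3 = 0"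
    using M[unfolded mat_rels_def 3 0] unfolding y2_def y3_def by Groebner_Basis.algebra+
  have "- 2*(1+\<gamma>)*(\<alpha>+\<beta>) * y2 - 2*(1-\<beta>)*(\<alpha>+\<gamma>) * \<kappa> * y3
      + \<eta>*(1-\<beta>)*(1+\<gamma>) * ((1-\<alpha>) * y3 + (1+\<alpha>) * \<kappa> * y2) = 0"
    using e by Groebner_Basis.algebra
  \<comment> \<open>After eliminating \<open>M X1 X0\<close> and \<open>M X1 X1\<close>, this factor
    produces (1 - \<alpha>) \<kappa> and 2 \<eta>, which \<open>k\<close> and \<open>l\<close>
    replace by multiples of s.\<close>
  then have "2 * (1-\<alpha>) * (- 2*(1+\<gamma>)*(\<alpha>+\<beta>) * y2 - 2*(1-\<beta>)*(\<alpha>+\<gamma>) * \<kappa> * y3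
      + \<eta>*(1-\<beta>)*(1+\<gamma>) * ((1-\<alpha>) * y3 + (1+\<alpha>) * \<kappa> * y2)) = 0" by simp
  also have "2 * (1-\<alpha>) * (- 2*(1+\<gamma>)*(\<alpha>+\<beta>) * y2 - 2*(1-\<beta>)*(\<alpha>+\<gamma>) * \<kappa> * y3
      + \<eta>*(1-\<beta>)*(1+\<gamma>) * ((1-\<alpha>) * y3 + (1+\<alpha>) * \<kappa> * y2))
    = - 4*(1-\<alpha>)*(1+\<gamma>)*(\<alpha>+\<beta>) * y2 - 4*(1-\<beta>)*(\<alpha>+\<gamma>) * ((1-\<alpha>)*\<kappa>) * y3
      + (1-\<beta>)*(1+\<gamma>)*(1-\<alpha>)\<^sup>2 * (2*\<eta>) * y3 + (1-\<beta>)*(1+\<gamma>)*(1+\<alpha>) * (2*\<eta>) * ((1-\<alpha>)*\<kappa>) * y2"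
    by (simp add: algebra_simps power2_eq_square)
  also have "\<dots> = - 4*(1-\<alpha>)*(1+\<gamma>)*(\<alpha>+\<beta>) * y2 - 4*(1-\<beta>)*(\<alpha>+\<gamma>) * (s * (1+\<alpha>)) * y3
      + (1-\<beta>)*(1+\<gamma>)*(1-\<alpha>)\<^sup>2 * (s * (1-\<beta>)) * y3 + (1-\<beta>)*(1+\<gamma>)*(1+\<alpha>)\<^sup>2 * ((1-\<beta>) * s\<^sup>2) * y2"
    unfolding k l by (simp add: algebra_simps power2_eq_square)
  also have "\<dots> = s * (1-\<beta>) * ((1-\<beta>)*(1+\<gamma>)*(1-\<alpha>)\<^sup>2 - 4*(1+\<alpha>)*(\<alpha>+\<gamma>)) * y3
      - (1+\<gamma>) * ((1+\<gamma>)*(1+\<alpha>)\<^sup>2*(1-\<beta>) + 4*(1-\<alpha>)*(\<alpha>+\<beta>)) * y2"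
    unfolding s by (simp add: algebra_simps power2_eq_square)
  finally have e1: "s * (1-\<beta>) * ((1-\<beta>)*(1+\<gamma>)*(1-\<alpha>)\<^sup>2 - 4*(1+\<alpha>)*(\<alpha>+\<gamma>)) * y3 = (1+\<gamma>) * ((1+\<gamma>)*(1+\<alpha>)\<^sup>2*(1-\<beta>)
    + 4*(1-\<alpha>)*(\<alpha>+\<beta>)) * y2" by simp
  have P: "(1-\<beta>) * ((1-\<beta>)*(1+\<gamma>)*(1-\<alpha>)\<^sup>2 - 4*(1+\<alpha>)*(\<alpha>+\<gamma>)) = (1+\<gamma>) * ((1-\<beta>)\<^sup>2 * (1-\<alpha>)\<^sup>2 + 4*\<beta>*(1+\<alpha>)\<^sup>2)"
    using param_eq by Groebner_Basis.algebra
  have Q: "(1+\<gamma>) * ((1+\<gamma>)*(1+\<alpha>)\<^sup>2*(1-\<beta>) + 4*(1-\<alpha>)*(\<alpha>+\<beta>)) = (1-\<beta>) * ((1+\<gamma>)\<^sup>2 * (1+\<alpha>)\<^sup>2 - 4*\<gamma>*(1-\<alpha>)\<^sup>2)"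
    using param_eq by Groebner_Basis.algebra
  have "s * (1+\<gamma>) * ((1-\<beta>)\<^sup>2 * (1-\<alpha>)\<^sup>2 + 4*\<beta>*(1+\<alpha>)\<^sup>2) * y3 = s * ((1+\<gamma>) * ((1-\<beta>)\<^sup>2 * (1-\<alpha>)\<^sup>2 + 4*\<beta>*(1+\<alpha>)\<^sup>2)) * y3"
    by (simp only: mult.assoc)
  also have "\<dots> = s * (1-\<beta>) * ((1-\<beta>)*(1+\<gamma>)*(1-\<alpha>)\<^sup>2 - 4*(1+\<alpha>)*(\<alpha>+\<gamma>)) * y3"
    unfolding P[symmetric] by (simp only: mult.assoc)
  also note e1
  also note Q
  finally show ?thesis unfolding y2_def y3_def .
qed

text \<open>The delicate entry is \<open>M X1 X3\<close>: going round its relations with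
  \<open>M X1 X2\<close> and \<open>M X2 X0\<close>, and using the product form of the parameter
  equation, returns it with the opposite sign.\<close>

lemma line2_zero:
  assumes M: "mat_rels M" and 3: "\<And>j. M X3 j = - \<kappa> * M X2 j" and 0: "\<And>j. M X0 j = - \<eta> * M X1 j"
    and k: "(1-\<alpha>) * \<kappa> = s * (1+\<alpha>)" and l: "2 * \<eta> = s * (1-\<beta>)" and s: "(1-\<beta>) * s\<^sup>2 = - (1+\<gamma>)"
    and z: "M X2 X1 = 0" "M X2 X2 = 0" "M X2 X3 = 0"
  shows "M i j = 0"
proof -
  have s0: "s \<noteq> 0" using s by auto
  have l0: "\<eta> \<noteq> 0" using l s0 by auto
  have e: "2 * M X2 X0 = - (1+\<beta>) * M X1 X3" "- 2 * \<eta> * M X1 X3 = (\<gamma>+1) * M X1 X2"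
    "- 2 * \<kappa> * M X2 X0 = (1-\<gamma>) * M X1 X2"
    "2 * \<eta> * M X1 X1 = 0" "2 * M X1 X0 = 0"
    using M[unfolded mat_rels_def 3 0] z by Groebner_Basis.algebra+
  have "(1-\<alpha>) * (4 * \<eta> * (1-\<gamma>) * M X1 X3) = 0"
  proof -
    have a: "\<kappa> * (1+\<beta>) * M X1 X3 = (1-\<gamma>) * M X1 X2" using e(1,3) by Groebner_Basis.algebra
    have "s * (1+\<alpha>) * (1+\<beta>) * M X1 X3 = (1-\<alpha>) * (1-\<gamma>) * M X1 X2"
      using a k by Groebner_Basis.algebra
    then have "s * ((1+\<alpha>) * (1+\<beta>) * (1+\<gamma>)) * M X1 X3 = - ((1-\<alpha>) * (1-\<gamma>) * (2 * \<eta> * M X1 X3))"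
      using e(2) by Groebner_Basis.algebra
    then have "(s * (1-\<beta>)) * ((1-\<alpha>) * (1-\<gamma>) * M X1 X3) = - ((1-\<alpha>) * (1-\<gamma>) * (2 * \<eta> * M X1 X3))"
      unfolding param_prod(2) by Groebner_Basis.algebra
    then show ?thesis unfolding l[symmetric] by Groebner_Basis.algebra
  qed
  then have x3: "M X1 X3 = 0" using l0 by simp
  then have "M X1 X2 = 0" "M X2 X0 = 0" using e by simp_all
  moreover have "M X1 X1 = 0" "M X1 X0 = 0" using e l0 by simp_all
  ultimately have "M X1 j = 0" "M X2 j = 0" for j using x3 z by (cases j; simp)+
  then show ?thesis using 3 0 by (cases i) simp_all
qed

text \<open>\<open>z X0\<close> does not enter, so both points of the second pair have their images
  on one line.\<close>

lemma rels_line2: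
  assumes "rels z w" "z X1 = 0" "z X2 = 1" "z X3 = - s"
    and k: "(1-\<alpha>) * \<kappa> = s * (1+\<alpha>)" and l: "2 * \<eta> = s * (1-\<beta>)"
  shows "w X3 = - \<kappa> * w X2" "w X0 = - \<eta> * w X1"
proof -
  have e: "(1-\<alpha>) * w X3 + (1+\<alpha>) * s * w X2 = 0" "2 * w X0 = - (1-\<beta>) * s * w X1"
    using assms(1)[unfolded rels_def assms(2-4)] by Groebner_Basis.algebra+
  have "(1-\<alpha>) * (w X3 - - \<kappa> * w X2) = 0" using e(1) k by Groebner_Basis.algebra
  then show "w X3 = - \<kappa> * w X2" by (simp add: eq_neg_iff_add_eq_0)
  have "2 * (w X0 - - \<eta> * w X1) = 0" using e(2) l by Groebner_Basis.algebra
  then show "w X0 = - \<eta> * w X1" using two_nz mult_eq_0_iff by (metis right_minus_eq)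
qed

text \<open>The line \<open>x\<^sub>1 = x\<^sub>3 - s x\<^sub>2 = 0\<close> takes care of two of the four points of \<open>E\<close> in the plane
  \<open>x\<^sub>1 = 0\<close>; what remains is \<open>x\<^sub>3 - s x\<^sub>2\<close> times an element vanishing at the \<open>\<sigma>\<close>-images of the other two.\<close>

lemma vanish_plane:
  assumes s: "(1-\<beta>) * s\<^sup>2 = - (1+\<gamma>)" and r: "r\<^sup>2 = - (1 + s\<^sup>2)"
    and f: "homog (Suc (Suc n)) f" "\<And>p. p \<in> E \<Longrightarrow> ev_seq (orbit p) (Suc (Suc n)) f = 0"
  shows "\<exists>g. homog (Suc n) g \<and> f - var X1 * g \<in> I"
proof -
  define z where "z r s = (\<lambda>i. case i of X0 \<Rightarrow> r | X1 \<Rightarrow> 0 | X2 \<Rightarrow> 1 | X3 \<Rightarrow> s)" for r s :: 'a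
  have z: "z r s X0 = r" "z r s X1 = 0" "z r s X2 = 1" "z r s X3 = s" for r s by (simp_all add: z_def)
  have s0: "s \<noteq> 0" using s by auto
  have C: "cone (z r' s')" if "r'\<^sup>2 = r\<^sup>2" "s'\<^sup>2 = s\<^sup>2" for r' s'
  proof -
    have "(1+\<alpha>)*(1-\<beta>) * s\<^sup>2 + (1+\<gamma>)*(1+\<alpha>) = 0" using s by Groebner_Basis.algebra
    then show ?thesis using that r unfolding cone_def z by simp
  qed
  note C = C[of r s] C[of "- r" s] C[of r "- s"] C[of "- r" "- s"]
  note C = C[simplified]
  have nz: "z r' s' \<noteq> (\<lambda>_. 0)" for r' s' using z(3)[of r' s'] by auto
  have r0: "r \<noteq> 0"
  proof
    assume "r = 0"
    then have "z r s = (\<lambda>_. 0)" using cone_two_zeros[OF C(1), of X0 X1] z by simp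
    then show False using nz by blast
  qed
  let ?l = "\<lambda>k. unit X3 k - s * unit X2 k"
  obtain g h where gh: "homog (Suc n) g" "homog (Suc n) h" "f - (var X1 * g + lform ?l * h) \<in> I"
  proof -
    have P: "proj (z r s) \<in> E" "proj (z (- r) s) \<in> E" using proj_in_E[OF C(1) nz] proj_in_E[OF C(2) nz] by auto
    have "\<exists>g h. homog (Suc n) g \<and> homog (Suc n) h \<and> f - (var X1 * g + lform ?l * h) \<in> I"
      by (rule vanish_line1[OF C(1,2) z(2) z(2) z(3) z(3) z(4) z(4) _ _ s f(1) f(2)[OF P(1)] f(2)[OF P(2)]])
        (simp_all add: z r0)
    then show ?thesis using that by blast
  qed
  define \<kappa> where "\<kappa> = s * (1+\<alpha>) / (1-\<alpha>)"
  define \<eta> where "\<eta> = s * (1-\<beta>) / 2"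
  have k: "(1-\<alpha>) * \<kappa> = s * (1+\<alpha>)" and l: "2 * \<eta> = s * (1-\<beta>)" by (simp_all add: \<kappa>_def \<eta>_def)
  define q q' where "q = proj (z r (- s))" and "q' = proj (z (- r) (- s))"
  have q: "q \<in> E" "q' \<in> E" unfolding q_def q'_def using proj_in_E C nz by blast+
  have "q \<noteq> q'"
  proof
    assume "q = q'"
    then obtain d where "z r (- s) = (\<lambda>i. d * z (- r) (- s) i)"
      using self_in_proj[of "z r (- s)"] by (auto simp: proj_def[of "z (- r) (- s)"] q_def q'_def)
    then have "z r (- s) X2 = d * z (- r) (- s) X2" "z r (- s) X0 = d * z (- r) (- s) X0" by metis+
    then have "2 * r = 0" using z by simp
    then show False using r0 two_nz mult_eq_0_iff by blast
  qed
  then have ne: "\<sigma> q \<noteq> \<sigma> q'" using sigma_inj q by blast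
  have sq: "\<sigma> q \<in> E" "\<sigma> q' \<in> E" using sigma_E q by auto
  define w w' where "w = orbit (\<sigma> q) 0" and "w' = orbit (\<sigma> q') 0"
  have rw: "rels (z r (- s)) w" "rels (z (- r) (- s)) w'"
    using rels_step[OF q(1), of _ w] rels_step[OF q(2), of _ w'] self_in_proj rep(1)[OF sq(1)] rep(1)[OF sq(2)]
    by (auto simp: w_def w'_def orbit_def q_def q'_def)
  have w: "w X3 = - \<kappa> * w X2" "w X0 = - \<eta> * w X1" "w' X3 = - \<kappa> * w' X2" "w' X0 = - \<eta> * w' X1"
    using rels_line2[OF rw(1) z(2-4) k l] rels_line2[OF rw(2) z(2-4) k l] by auto
  \<comment> \<open>On that line the coordinates 1 and 2 determine the other two, hence separate the
    two distinct image points.\<close>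
  have wdet: "w X1 * w' X2 - w X2 * w' X1 \<noteq> 0"
  proof
    assume d: "w X1 * w' X2 - w X2 * w' X1 = 0"
    have "parallel w w'" by (rule parI) (use d w in Groebner_Basis.algebra)+
    then obtain c where c: "w = (\<lambda>i. c * w' i)" using parD orbit(2)[OF sq(2), of 0] by (auto simp: w'_def)
    then have "c \<noteq> 0" using orbit(2)[OF sq(1), of 0] by (auto simp: w_def)
    then have "proj w = proj w'" using c proj_scale by blast
    then show False using orbit(3)[OF sq(1), of 0] orbit(3)[OF sq(2), of 0] ne by (simp add: w_def w'_def)
  qed
  let ?S = "perp {w, w'}"
  have S: "(\<lambda>k. unit X3 k - (- \<kappa>) * unit X2 k) \<in> ?S" "(\<lambda>k. unit X0 k - (- \<eta>) * unit X1 k) \<in> ?S"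
    by (simp_all add: perp_def dot_simps unit_def w)
  have hvan: "h \<in> rspan ?S n"
  proof -
    have fh: "ev_seq (orbit p) (Suc (Suc n)) (f - (var X1 * g + lform ?l * h)) = 0" if "p \<in> E" for p
      using ev_seq_relI[OF that gh(3)] .
    have *: "ev_seq (orbit (\<sigma> p)) (Suc n) h = 0" if p: "p = proj (z r' (- s))" "cone (z r' (- s))" "p \<in> E"
      for p r'
    proof -
      obtain c where c: "c \<noteq> 0" "orbit p 0 = (\<lambda>i. c * z r' (- s) i)" using rep_proj[OF p(2) nz]
        by (auto simp: orbit_def p(1))
      have "ev_seq (orbit p) (Suc (Suc n)) (var X1 * g) = 0"
        unfolding ev_seq_var_mult c by (simp add: z)
      then have "dot ?l (orbit p 0) * ev_seq (orbit (\<sigma> p)) (Suc n) h = 0"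
        using fh[OF p(3)] f(2)[OF p(3)] by (simp add: ev_seq_orb_lform)
      \<comment> \<open>On the second pair x3 - s x2 takes the value -2 s, up to scaling, and can be
        cancelled.\<close>
      moreover have "dot ?l (orbit p 0) = - (2 * (c * s))" unfolding c by (simp add: dot_simps unit_def z)
      ultimately show ?thesis using c s0 by simp
    qed
    have hz: "ev_seq (orbit (\<sigma> q)) (Suc n) h = 0" "ev_seq (orbit (\<sigma> q')) (Suc n) h = 0"
      using *[OF q_def C(3) q(1)] *[OF q'_def C(4) q(2)] by auto
    have cond: "M X3 j = - \<kappa> * M X2 j" "M X0 j = - \<eta> * M X1 j"
      if "\<And>a j. a \<in> perp {orbit (\<sigma> q) 0, orbit (\<sigma> q') 0} \<Longrightarrow> dot a (\<lambda>i. M i j) = 0" for M :: "gen \<Rightarrow> gen \<Rightarrow> 'a" and j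
      using that[OF S(1)[unfolded w_def w'_def], of j] that[OF S(2)[unfolded w_def w'_def], of j]
      by (simp_all add: dot_simps unit_def eq_neg_iff_add_eq_0 add.commute)
    \<comment> \<open>The nonzero coefficient of \<open>line2_relation\<close> decides which entry
      joins \<open>M X2 X1\<close> as a test entry.\<close>
    show ?thesis unfolding w_def w'_def
    proof (cases "(1-\<beta>)\<^sup>2 * (1-\<alpha>)\<^sup>2 + 4*\<beta>*(1+\<alpha>)\<^sup>2 = 0")
      case False
      show "h \<in> rspan (perp {orbit (\<sigma> q) 0, orbit (\<sigma> q') 0}) n"
      proof (rule vanish_line[OF sq ne _ gh(2) hz])
        fix M assume M: "mat_rels M" and A: "\<And>a j. a \<in> perp {orbit (\<sigma> q) 0, orbit (\<sigma> q') 0} \<Longrightarrow> dot a (\<lambda>i. M i j)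
          = 0"
          and T: "M X2 X1 = 0" "M X2 X2 = 0"
        have c: "\<And>j. M X3 j = - \<kappa> * M X2 j" "\<And>j. M X0 j = - \<eta> * M X1 j"
          by (rule cond(1), erule A) (rule cond(2), erule A)
        have "M X2 X3 = 0" using line2_relation[OF M c k l s] T(2) False s0 by simp
        then show "\<forall>i j. M i j = 0" using line2_zero[OF M c k l s T] by blast
      qed
    next
      case True
      then have G: "(1+\<gamma>)\<^sup>2 * (1+\<alpha>)\<^sup>2 - 4*\<gamma>*(1-\<alpha>)\<^sup>2 \<noteq> 0" using line2_nondegenerate by blast
      show "h \<in> rspan (perp {orbit (\<sigma> q) 0, orbit (\<sigma> q') 0}) n"
      proof (rule vanish_line[OF sq ne _ gh(2) hz])
        fix M assume M: "mat_rels M" and A: "\<And>a j. a \<in> perp {orbit (\<sigma> q) 0, orbit (\<sigma> q') 0} \<Longrightarrow> dot a (\<lambda>i. M i j)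
          = 0"
          and T: "M X2 X1 = 0" "M X2 X3 = 0"
        have c: "\<And>j. M X3 j = - \<kappa> * M X2 j" "\<And>j. M X0 j = - \<eta> * M X1 j"
          by (rule cond(1), erule A) (rule cond(2), erule A)
        have "(1-\<beta>) * ((1+\<gamma>)\<^sup>2 * (1+\<alpha>)\<^sup>2 - 4*\<gamma>*(1-\<alpha>)\<^sup>2) * M X2 X2 = 0"
          using line2_relation[OF M c k l s] T(2) by simp
        then have "M X2 X2 = 0" using G mult_eq_0_iff param_nz(8) by metis
        then show "\<forall>i j. M i j = 0" using line2_zero[OF M c k l s T(1) _ T(2)] by blast
      qed
    qed
  qed
  \<comment> \<open>If a functional kills x1 in the first slot, its row \<psi> at x3 - s x2
    satisfies the equations of the line through \<open>w\<close> and \<open>w'\<close>, on which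
    \<open>b\<close> vanishes.\<close>
  have "lform ?l * lform b \<in> rspan {unit X1} 1" if b: "b \<in> ?S" for b
  proof (rule rspan_functional)
    fix M assume M: "mat_rels M" and A: "\<And>a j. a \<in> {unit X1} \<Longrightarrow> dot a (\<lambda>i. M i j) = 0"
    have 1: "M X1 j = 0" for j using A[of "unit X1" j] by (simp add: dot_simps unit_def)
    define \<psi> where "\<psi> j = M X3 j - s * M X2 j" for j
    have e: "(1-\<alpha>) * M X2 X3 = (1+\<alpha>) * M X3 X2" "2 * M X2 X0 = (1-\<beta>) * M X3 X1"
      "2 * M X3 X0 = - (1+\<gamma>) * M X2 X1" "(1+\<alpha>)*(1+\<gamma>) * M X2 X2 + (1-\<alpha>)*(1-\<beta>) * M X3 X3 = 0"
      using M[unfolded mat_rels_def 1] by Groebner_Basis.algebra+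
    have "(1-\<beta>) * ((1-\<alpha>) * \<psi> X3 + s * (1+\<alpha>) * \<psi> X2) = 0"
      unfolding \<psi>_def using e s by Groebner_Basis.algebra
    then have "(1-\<alpha>) * \<psi> X3 + s * (1+\<alpha>) * \<psi> X2 = 0" by (metis mult_eq_0_iff param_nz(8))
    then have "(1-\<alpha>) * (\<psi> X3 + \<kappa> * \<psi> X2) = 0" using k by Groebner_Basis.algebra
    then have p3: "\<psi> X3 = - \<kappa> * \<psi> X2" by (simp add: eq_neg_iff_add_eq_0)
    have "2 * \<psi> X0 + s * (1-\<beta>) * \<psi> X1 = 0"
      unfolding \<psi>_def using e s by Groebner_Basis.algebra
    then have "2 * (\<psi> X0 + \<eta> * \<psi> X1) = 0" using l by Groebner_Basis.algebra
    then have "\<psi> X0 + \<eta> * \<psi> X1 = 0" using two_nz mult_eq_0_iff by blast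
    then have p0: "\<psi> X0 = - \<eta> * \<psi> X1" by (simp add: eq_neg_iff_add_eq_0)
    define B1 B2 where "B1 = b X1 - \<eta> * b X0" and "B2 = b X2 - \<kappa> * b X3"
    have db: "dot b x = B1 * x X1 + B2 * x X2" if "x X3 = - \<kappa> * x X2" "x X0 = - \<eta> * x X1" for x
      unfolding dot_simps that B1_def B2_def by (simp add: algebra_simps)
    have "B1 * w X1 + B2 * w X2 = 0" "B1 * w' X1 + B2 * w' X2 = 0"
      using b db[OF w(1,2)] db[OF w(3,4)] by (simp_all add: perp_def)
    then have "(w X1 * w' X2 - w X2 * w' X1) * B1 = 0" "(w X1 * w' X2 - w X2 * w' X1) * B2 = 0"
      by Groebner_Basis.algebra+
    then have "B1 = 0" "B2 = 0" using wdet by simp_all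
    then have "dot b \<psi> = 0" using db[OF p3 p0] by simp
    moreover have "dot ?l (\<lambda>i. dot b (M i)) = dot b \<psi>"
      by (simp add: dot_simps unit_def \<psi>_def algebra_simps)
    ultimately show "dot ?l (\<lambda>i. dot b (M i)) = 0" by simp
  qed
  then have "lform ?l * h \<in> rspan {unit X1} (Suc n)" using hvan by (rule rspan_lift)
  then have "\<exists>g'. homog (Suc n) g' \<and> lform ?l * h - var X1 * g' \<in> I"
  proof (induction rule: rspan.induct)
    case (rel f)
    then have "f - var X1 * 0 \<in> I" by simp
    then show ?case using homog_zero by blast
  next
    case (gen a g)
    then have "lform a * g - var X1 * g \<in> I" by (simp add: lform_unit relI_closed(1))
    then show ?case using gen by blast
  next
    case (add f f')
    then obtain g g' where "homog (Suc n) g" "homog (Suc n) g'" "f - var X1 * g \<in> I" "f' - var X1 * g' \<in> I"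
      by blast
    then have "homog (Suc n) (g + g')" "f + f' - var X1 * (g + g') \<in> I"
      using relI_closed(2)[of "f - var X1 * g" "f' - var X1 * g'"] by (auto intro: homog_add simp: algebra_simps)
    then show ?case by blast
  qed
  then obtain g' where g': "homog (Suc n) g'" "lform ?l * h - var X1 * g' \<in> I" by blast
  have "f - var X1 * (g + g') \<in> I"
    using relI_closed(2)[OF gh(3) g'(2)] by (simp add: algebra_simps)
  then show ?thesis using homog_add gh(1) g'(1) by blast
qed

text \<open>Induction on the degree. Since \<open>vanish_plane\<close> starts in degree two, degree
  one is settled through the symmetry of E.\<close>

theorem vanish_relI:
  assumes "homog n f" "\<And>p. p \<in> E \<Longrightarrow> ev_seq (orbit p) n f = 0"
  shows "f \<in> I"
proof -
  obtain s where s: "s\<^sup>2 = - (1+\<gamma>) / (1-\<beta>)" using nth_root_exists[of 2] by auto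
  then have s: "(1-\<beta>) * s\<^sup>2 = - (1+\<gamma>)" by simp
  obtain r where r: "r\<^sup>2 = - (1 + s\<^sup>2)" using nth_root_exists[of 2] by auto
  obtain y where y: "cone y" "y X1 \<noteq> 0" using cone_point by blast
  then have ynz: "y \<noteq> (\<lambda>_. 0)" by auto
  show ?thesis using assms
  proof (induction n arbitrary: f)
    case 0
    then obtain c where "f = const c" using homog_0E by metis
    moreover have "proj y \<in> E" using proj_in_E y ynz by blast
    ultimately have "f = 0" using 0(2)[of "proj y"] by simp
    then show ?case by (simp add: relI_closed(1))
  next
    case (Suc n)
    show ?case
    proof (cases n)
      case 0
      obtain g where g: "\<And>i. homog 0 (g i)" "f = (\<Sum>i\<in>UNIV. var i * g i)" using homog_SucE Suc(2) 0 by metis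
      have "\<forall>i. \<exists>c. g i = const c" using g(1) homog_0E by metis
      then obtain a where a: "\<And>i. g i = const (a i)" by metis
      have fa: "f = lform a * const 1" unfolding g(2) a lform_def by (simp add: const_central)
      have dz: "dot a v = 0" if v: "cone v" "v \<noteq> (\<lambda>_. 0)" for v
      proof -
        obtain c where c: "c \<noteq> 0" "orbit (proj v) 0 = (\<lambda>i. c * v i)" using rep_proj[OF v]
          by (auto simp: orbit_def)
        have "ev_seq (orbit (proj v)) (Suc 0) (lform a * const 1) = 0"
          using Suc(3)[OF proj_in_E[OF v]] 0 fa by simp
        then have "dot a (orbit (proj v) 0) = 0" unfolding ev_seq_orb_lform ev_seq_const by simp
        then have "c * dot a v = 0" unfolding c by (simp add: dot_simps algebra_simps)
        then show ?thesis using c by simp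
      qed
      have "a i * v i = 0" if v: "cone v" "v \<noteq> (\<lambda>_. 0)" for v i
      proof -
        \<comment> \<open>E is stable under changing the sign of a coordinate, so a linear form
          vanishing on E vanishes term by term.\<close>
        define v' where "v' = (\<lambda>k. if k = i then - v k else v k)"
        have "cone v'" using v(1) unfolding cone_def v'_def by (cases i) simp_all
        moreover have "v' \<noteq> (\<lambda>_. 0)"
        proof
          assume "v' = (\<lambda>_. 0)"
          then have "v' k = 0" for k by simp
          then have "v k = 0" for k unfolding v'_def by (metis neg_equal_0_iff_equal)
          then show False using v(2) by auto
        qed
        ultimately have "dot a v - dot a v' = 0" using dz v by simp
        moreover have "dot a v - dot a v' = 2 * (a i * v i)"
          unfolding v'_def by (cases i) (simp_all add: dot_simps)
        ultimately show ?thesis by simp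
      qed
      note av = this
      define z where "z = (\<lambda>i. case i of X0 \<Rightarrow> r | X1 \<Rightarrow> 0 | X2 \<Rightarrow> 1 | X3 \<Rightarrow> s)"
      have zc: "cone z"
      proof -
        have "(1+\<alpha>)*(1-\<beta>) * s\<^sup>2 + (1+\<gamma>)*(1+\<alpha>) = 0" using s by Groebner_Basis.algebra
        then show ?thesis using r unfolding cone_def z_def by simp
      qed
      have zn: "z \<noteq> (\<lambda>_. 0)" by (auto simp: z_def fun_eq_iff intro!: exI[of _ X2])
      have "z i \<noteq> 0" if "i \<noteq> X1" for i
        using cone_two_zeros[OF zc that] zn by (auto simp: z_def)
      then have "a i = 0" for i using av[OF zc zn, of i] av[OF y(1) ynz, of i] y(2) by (cases "i = X1") auto
      then have "lform a = 0" by (simp add: lform_def)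
      then show ?thesis by (simp add: fa relI_closed(1))
    next
      case (Suc m)
      then obtain g where g: "homog n g" "f - var X1 * g \<in> I"
        using vanish_plane[OF s r, of m f] Suc.prems by auto
      have e: "ev_seq (orbit p) (Suc n) (var X1 * g) = 0" if "p \<in> E" for p
        using ev_seq_relI[OF that g(2), of "Suc n"] Suc.prems(2)[OF that] by simp
      have "ev_seq (orbit (\<sigma> p)) n g = 0" if p: "p \<in> E" for p
      proof -
        \<comment> \<open>Density concerns evaluations starting at \<open>p\<close>, whereas
          \<open>g\<close> is evaluated from \<sigma> p; multiplying by a coordinate that is nonzero
          at \<open>p\<close> bridges the gap.\<close>
        have "ev_seq (orbit p) (Suc n) (var i * g) = 0" for i
        proof (rule ev_seq_dense[where F = "\<lambda>v. v X1" and ?v0.0 = y])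
          fix v :: "gen \<Rightarrow> 'a" assume v: "cone v" "v \<noteq> (\<lambda>_. 0)" "v X1 \<noteq> 0"
          obtain c where c: "c \<noteq> 0" "orbit (proj v) 0 = (\<lambda>i. c * v i)" using rep_proj[OF v(1,2)]
            by (auto simp: orbit_def)
          have "c * v X1 * ev_seq (orbit (\<sigma> (proj v))) n g = 0"
            using e[OF proj_in_E[OF v(1,2)]] unfolding ev_seq_var_mult orbit_Suc c by simp
          then show "ev_seq (orbit (proj v)) (Suc n) (var i * g) = 0"
            unfolding ev_seq_var_mult orbit_Suc using c v by simp
        qed (use y p in \<open>auto intro: polyfun.intros\<close>)
        moreover obtain i where "orbit p 0 i \<noteq> 0" using nonzero_coord[OF orbit(2)[OF p]] by blast
        ultimately show ?thesis unfolding ev_seq_var_mult orbit_Suc by (metis mult_eq_0_iff)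
      qed
      then have "ev_seq (orbit q) n g = 0" if "q \<in> E" for q using sigma_surj[OF that] by metis
      then have "g \<in> I" using Suc.IH g(1) by blast
      then show ?thesis using relI_closed(2)[OF g(2) relI_closed(3)[of g "var X1"]] by simp
    qed
  qed
qed

end

section \<open>Quasi-central elements and the order of the automorphism\<close>

context sklyanin_translation begin

lemma quasi_central_vanishes:
  assumes inf: "infinite_order_on E \<sigma>" and n: "n > 0"
    and eps: "\<And>i. \<epsilon> i * \<epsilon> i = 1"
    and f: "\<And>p i. p \<in> E \<Longrightarrow> ev_seq (orbit p) (Suc n) (f * var i) = \<epsilon> i * ev_seq (orbit p) (Suc n) (var i * f)"
    and p: "p \<in> E"
  shows "ev_seq (orbit p) n f = 0"
proof (rule ccontr)
  assume p1: "ev_seq (orbit p) n f \<noteq> 0"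
  have e: "ev_seq (orbit p) n f * orbit p n i = \<epsilon> i * orbit p 0 i * ev_seq (orbit (\<sigma> p)) n f" if "p \<in> E" for p i
    using f[OF that, of i] by (simp add: ev_seq_mult_var ev_seq_var_mult orbit_Suc)
  have s1: "ev_seq (orbit (\<sigma> p)) n f \<noteq> 0" if pp: "p \<in> E" "ev_seq (orbit p) n f \<noteq> 0" for p
  proof -
    obtain i where "orbit p n i \<noteq> 0" using nonzero_coord[OF orbit(2)[OF pp(1)]] by blast
    then show ?thesis using e[OF pp(1), of i] pp(2) by auto
  qed
  have sk: "ev_seq (orbit ((\<sigma> ^^ k) p)) n f \<noteq> 0" if "p \<in> E" "ev_seq (orbit p) n f \<noteq> 0" for p k
    by (induction k) (use that s1 sigma_pow_E in auto)
  have d: "\<exists>d. \<forall>i. orbit p n i = d * \<epsilon> i * orbit p 0 i" if "p \<in> E" "ev_seq (orbit p) n f \<noteq> 0" for p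
  proof -
    have "orbit p n i = ev_seq (orbit (\<sigma> p)) n f / ev_seq (orbit p) n f * \<epsilon> i * orbit p 0 i" for i
      using e[OF that(1), of i] that(2) by (simp add: field_simps)
    then show ?thesis by blast
  qed
  \<comment> \<open>The second pass of length \<open>n\<close> starts at \<sigma>^n p, where
    \<open>f\<close> is still nonzero by \<open>sk\<close>; over both passes the signs square to
    one.\<close>
  have d2: "\<exists>d. \<forall>i. orbit p (2 * n) i = d * orbit p 0 i" if pp: "p \<in> E" "ev_seq (orbit p) n f \<noteq> 0" for p
  proof -
    obtain d1 where d1: "orbit p n i = d1 * \<epsilon> i * orbit p 0 i" for i using d[OF pp] by blast
    obtain d2 where d2: "orbit ((\<sigma> ^^ n) p) n i = d2 * \<epsilon> i * orbit ((\<sigma> ^^ n) p) 0 i" for i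
      using d[OF sigma_pow_E[OF pp(1)] sk[OF pp]] by blast
    have "orbit p (2 * n) i = d2 * \<epsilon> i * orbit p n i" for i
      using d2[of i] orbit_shift(1)[of p n n] orbit_shift(1)[of p n 0] by (simp add: mult_2)
    then have "orbit p (2 * n) i = d2 * d1 * (\<epsilon> i * \<epsilon> i) * orbit p 0 i" for i
      unfolding d1 by (simp add: mult.assoc mult.left_commute)
    then show ?thesis unfolding eps by auto
  qed
  obtain T1 where T1: "\<And>j i. (\<lambda>v. T1 v j i) \<in> polyfun" 
      "\<And>v' j. cone v' \<Longrightarrow> v' \<noteq> (\<lambda>_. 0) \<Longrightarrow> \<exists>c. T1 v' j = (\<lambda>i. c * orbit (proj v') j i)"
      "\<And>j. T1 (rep p) j \<noteq> (\<lambda>_. 0)"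
    using local_orbit[OF rep(2,3)[OF p]] by blast
  have sc: "\<exists>c. ev_seq (T1 v) n f = c * ev_seq (orbit (proj v)) n f \<and> ((\<forall>j. T1 v j \<noteq> (\<lambda>_. 0)) \<longrightarrow> c \<noteq> 0)"
    if v: "cone v" "v \<noteq> (\<lambda>_. 0)" for v
  proof -
    have "\<forall>j. \<exists>c. T1 v j = (\<lambda>i. c * orbit (proj v) j i)" using T1(2)[OF v] by blast
    from choice[OF this] obtain c where c: "\<And>j. T1 v j = (\<lambda>i. c j * orbit (proj v) j i)" by blast
    then have "ev_seq (T1 v) n f = (\<Prod>j<n. c j) * ev_seq (orbit (proj v)) n f" by (intro ev_seq_scale) simp
    moreover have "(\<Prod>j<n. c j) \<noteq> 0" if "\<forall>j. T1 v j \<noteq> (\<lambda>_. 0)"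
    proof -
      have "c j \<noteq> 0" for j using that c[of j] by auto
      then show ?thesis by simp
    qed
    ultimately show ?thesis by blast
  qed
  have F0: "ev_seq (T1 (rep p)) n f \<noteq> 0"
    using sc[OF rep(2,3)[OF p]] T1(3) p1 rep(4)[OF p] by auto
  have "(\<sigma> ^^ (2 * n)) q = q" if q: "q \<in> E" for q
  proof -
    note r = rep[OF q]
    obtain T where T: "\<And>j i. (\<lambda>v. T v j i) \<in> polyfun"
        "\<And>v' j. cone v' \<Longrightarrow> v' \<noteq> (\<lambda>_. 0) \<Longrightarrow> \<exists>c. T v' j = (\<lambda>i. c * orbit (proj v') j i)"
        "\<And>j. T (rep q) j \<noteq> (\<lambda>_. 0)"
      using local_orbit[OF r(2,3)] by blast
    have "rep q i * T (rep q) (2 * n) j - rep q j * T (rep q) (2 * n) i = 0" for i j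
    proof -
      \<comment> \<open>Two local descriptions meet here: \<open>T1\<close>, around
        \<open>p\<close>, witnesses that \<open>f\<close> is not identically zero; \<open>T\<close>,
        around \<open>q\<close>, describes \<sigma>^(2n) where the conclusion is wanted.\<close>
      have "(\<forall>v. cone v \<longrightarrow> ev_seq (T1 v) n f = 0) \<or> (\<forall>v. cone v \<longrightarrow> v i * T v (2 * n) j - v j * T v (2 * n) i = 0)"
      proof (rule cone_irreducible_nz[OF polyfun_EV[OF T1(1)]])
        show "(\<lambda>v. v i * T v (2 * n) j - v j * T v (2 * n) i) \<in> polyfun"
          by (intro polyfun_intros T)
        fix v assume v: "cone v" "v \<noteq> (\<lambda>_. 0)"
        show "ev_seq (T1 v) n f * (v i * T v (2 * n) j - v j * T v (2 * n) i) = 0"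
        proof (cases "ev_seq (T1 v) n f = 0")
          case False
          then have "ev_seq (orbit (proj v)) n f \<noteq> 0" using sc[OF v] by auto
          then obtain d where d: "\<And>i. orbit (proj v) (2 * n) i = d * orbit (proj v) 0 i"
            using d2[OF proj_in_E[OF v]] by blast
          obtain c where c: "T v (2 * n) = (\<lambda>i. c * orbit (proj v) (2 * n) i)" using T(2)[OF v] by blast
          obtain c' where "orbit (proj v) 0 = (\<lambda>i. c' * v i)" using rep_proj[OF v] by (auto simp: orbit_def)
          then have "T v (2 * n) k = c * d * c' * v k" for k using c d by simp
          then show ?thesis by simp
        qed simp
      qed
      then show ?thesis using F0 rep(2)[OF p] r(2) by blast
    qed
    then have "parallel (rep q) (T (rep q) (2 * n))" by (auto simp: parallel_def mult.commute)
    then obtain c where c: "rep q = (\<lambda>i. c * T (rep q) (2 * n) i)" using parD T(3) by blast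
    obtain c' where c': "T (rep q) (2 * n) = (\<lambda>i. c' * orbit q (2 * n) i)" using T(2)[OF r(2,3)] r(4) by metis
    have eq: "rep q = (\<lambda>i. (c * c') * orbit q (2 * n) i)" by (subst c, subst c') (simp add: mult.assoc)
    then have "c * c' \<noteq> 0" using r(3) by auto
    then have "proj (rep q) = proj (orbit q (2 * n))" using proj_scale eq by metis
    then show ?thesis using r(4) orbit(3)[OF q] by simp
  qed
  moreover have "2 * n > 0" using n by simp
  ultimately show False using inf unfolding infinite_order_on_def by blast
qed

end

section \<open>The twist\<close>

definition word_sign :: "G \<Rightarrow> word \<Rightarrow> 'k::field" where "word_sign g w = prod_list (map (gen_sign g) w)"

fun gen_deg :: "gen \<Rightarrow> G" where "gen_deg X0 = (0, 0)" | "gen_deg X1 = (1, 0)" | "gen_deg X2 = (0, 1)" | "gen_deg X3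
  = (1, 1)"

definition word_deg :: "word \<Rightarrow> G" where "word_deg w = sum_list (map gen_deg w)"

lemma bit_cases: "(b :: bit) = 0 \<or> b = 1" by (cases b) auto

lemma sign_simps [simp]: "sign 0 = 1" "sign 1 = - 1" by (simp_all add: sign_def)

lemma sign_add: "sign (a + b) = sign a * (sign b :: 'k::field)"
  using bit_cases[of a] bit_cases[of b] by auto

lemma sign_sq [simp]: "sign a * sign a = (1 :: 'k::field)"
  using bit_cases[of a] by auto

lemma gen_sign_chi: "gen_sign g i = chi (gen_deg i) g"
proof -
  obtain a b where "g = (a, b)" by (cases g)
  then show ?thesis using bit_cases[of a] bit_cases[of b] by (cases i) auto
qed

lemma chi_add: "chi (h + h') g = chi h g * (chi h' g :: 'k::field)"
  by (cases h; cases h'; cases g) (simp only: add_Pair chi.simps sign_add[symmetric], simp only: algebra_simps)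

lemma chi_sq [simp]: "chi h g * chi h g = (1 :: 'k::field)"
  by (cases h; cases g) simp

lemma chi_zero: "chi 0 g = (1 :: 'k::field)"
  by (cases g) (simp add: zero_prod_def)

lemma word_sign_chi: "word_sign g w = chi (word_deg w) g"
  by (induction w) (simp_all add: word_sign_def word_deg_def chi_zero chi_add gen_sign_chi)

lemma word_deg_append: "word_deg (u @ w) = word_deg u + word_deg w"
  by (simp add: word_deg_def)

lemma lookup_act: "Poly_Mapping.lookup (act_free g f) w = word_sign g w * Poly_Mapping.lookup f w"
  by (simp add: act_free_def lookup_mapp word_sign_def when_def in_keys_iff)

lemma act_simps [simp]:
  "act_free g 0 = 0" "act_free g (a + b) = act_free g a + act_free g b"
  "act_free g (a - b) = act_free g a - act_free g b" "act_free g (- a) = - act_free g a"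
  by (rule poly_mapping_eqI; simp add: lookup_act lookup_add lookup_minus algebra_simps)+

lemma act_wmono: "act_free g (wmono w c) = wmono w (word_sign g w * c)"
  by (rule poly_mapping_eqI) (simp add: lookup_act lookup_single when_def)

lemma act_mult [simp]: "act_free g (a * b) = act_free g a * act_free g b"
proof (induction a rule: fa_induct)
  case (wmono u c)
  show ?case
    by (induction b rule: fa_induct) (simp_all add: act_wmono word_sign_def algebra_simps)
qed (simp_all add: distrib_right)

lemma act_var: "act_free g (var i) = const (gen_sign g i) * var i"
  by (simp add: var_def act_wmono word_sign_def const_mono)

lemma act_const: "act_free g (const c) = const c"
  by (simp add: const_def act_wmono word_sign_def)

lemma act_act: "act_free g (act_free g f) = f"
  by (rule poly_mapping_eqI) (simp add: lookup_act word_sign_chi mult.assoc[symmetric])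

lemma twosided_act: "twosided J \<Longrightarrow> twosided {f. act_free g f \<in> J}"
  by (auto simp: twosided_def)

text \<open>The action is an involution, so stability of \<open>J\<close> gives both
  inclusions.\<close>

lemma act_image:
  assumes "\<And>f. f \<in> J \<Longrightarrow> act_free g f \<in> J"
  shows "act_free g ` {h. h - f \<in> J} = {h. h - act_free g f \<in> J}"
proof
  show "act_free g ` {h. h - f \<in> J} \<subseteq> {h. h - act_free g f \<in> J}"
    using assms by (force simp flip: act_simps(3))
  show "{h. h - act_free g f \<in> J} \<subseteq> act_free g ` {h. h - f \<in> J}"
  proof
    fix h assume "h \<in> {h. h - act_free g f \<in> J}"
    then have "act_free g (h - act_free g f) \<in> J" using assms by blast
    then have "act_free g h - f \<in> J" by (simp add: act_act)
    then show "h \<in> act_free g ` {h. h - f \<in> J}" by (intro image_eqI[of _ _ "act_free g h"]) (simp_all add: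
      act_act)
  qed
qed

context sklyanin_algebra begin

text \<open>Every generator is an eigenvector with eigenvalue 1 or -1, which makes both ideals
  stable under G.\<close>

lemma act_gens:
  assumes "r \<in> gens"
  shows "act_free g r = r \<or> act_free g r = - r"
proof -
  obtain a b where g: "g = (a, b)" by (cases g)
  consider "g = (0,0)" | "g = (0,1)" | "g = (1,0)" | "g = (1,1)"
    using bit_cases[of a] bit_cases[of b] g by auto
  then have "\<forall>r \<in> gens. act_free g r = r \<or> act_free g r = - r"
    unfolding sklyanin_relations_def Omega1_def Omega2_def comm_def acomm_def power2_eq_square
    by cases (simp_all add: act_var act_const algebra_simps)
  then show ?thesis using assms by blast
qed

lemma act_relI: "f \<in> relI \<Longrightarrow> act_free g f \<in> relI"
proof -
  note D = twosidedD[OF twosided_relI]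
  have "relI \<subseteq> {f. act_free g f \<in> relI}"
  proof (rule relI_min[OF twosided_act[OF twosided_relI]], rule subsetI)
    fix r assume r: "r \<in> gens"
    then have "r \<in> relI" using relI_gens by blast
    then show "r \<in> {f. act_free g f \<in> relI}" using act_gens[OF r, of g] D(5) by auto
  qed
  then show "f \<in> relI \<Longrightarrow> act_free g f \<in> relI" by blast
qed

lemma act_sklyanin: "f \<in> \<S> \<Longrightarrow> act_free g f \<in> \<S>"
proof -
  note D = twosidedD[OF twosided_sklyanin_ideal]
  have "\<S> \<subseteq> {f. act_free g f \<in> \<S>}"
  proof (rule sklyanin_ideal_min[OF twosided_act[OF twosided_sklyanin_ideal]], rule subsetI)
    fix r assume r: "r \<in> \<R>"
    then have "r \<in> \<S>" using sklyanin_relations_sub by blast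
    then show "r \<in> {f. act_free g f \<in> \<S>}" using act_gens[of r g] r D(5) by auto
  qed
  then show "f \<in> \<S> \<Longrightarrow> act_free g f \<in> \<S>" by blast
qed

lemma clsA_coset: "clA f = {h. h - f \<in> \<S>}"
proof -
  have "x = h + f \<longleftrightarrow> x - f = h" for x h by auto
  then show ?thesis unfolding clsA_def a_r_coset_def' by auto
qed

lemma actB_clsB: "actB g (clB f) = clB (act_free g f)"
proof -
  have "act_free g ` clA h = clA (act_free g h)" for h
    unfolding clsA_coset by (rule act_image) (rule act_sklyanin)
  then have "actB g (clB f) = clA ` (act_free g ` {h. h - f \<in> relI})"
    unfolding actB_def clsB_coset by (simp add: image_image)
  also have "act_free g ` {h. h - f \<in> relI} = {h. h - act_free g f \<in> relI}"
    by (rule act_image) (rule act_relI)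
  finally show ?thesis by (simp add: clsB_coset)
qed

lemma partB_clsB:
  "clB f \<in> partB \<alpha> \<beta> \<gamma> h \<longleftrightarrow> (\<forall>g. act_free g f - const (chi h g) * f \<in> relI)"
  by (simp add: partB_def actB_clsB clsB_simps clsB_eq)

end

section \<open>The grading by G and the twisted product\<close>

definition gpart :: "G \<Rightarrow> 'k::field fa \<Rightarrow> 'k fa" where
  "gpart h f = Poly_Mapping.mapp (\<lambda>w c. if word_deg w = h then c else 0) f"

lemma lookup_gpart: "Poly_Mapping.lookup (gpart h f) w = (if word_deg w = h then Poly_Mapping.lookup f w else 0)"
  by (simp add: gpart_def lookup_mapp when_def in_keys_iff)

lemma gpart_simps [simp]:
  "gpart h 0 = 0" "gpart h (a + b) = gpart h a + gpart h b" "gpart h (a - b) = gpart h a - gpart h b"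
  by (rule poly_mapping_eqI; simp add: lookup_gpart lookup_add lookup_minus)+

lemma gpart_wmono: "gpart h (wmono w c) = (if word_deg w = h then wmono w c else 0)"
  by (rule poly_mapping_eqI) (auto simp: lookup_gpart lookup_single when_def)

lemma gpart_gpart: "gpart k (gpart h f) = (if k = h then gpart h f else 0)"
  by (rule poly_mapping_eqI) (auto simp: lookup_gpart)

lemma gpart_const_mult: "gpart h (const c * f) = const c * gpart h f"
  by (induction f rule: fa_induct) (auto simp: const_mono gpart_wmono algebra_simps)

lemma gpart_sum: "gpart h (sum F A) = (\<Sum>x\<in>A. gpart h (F x))"
  by (induction A rule: infinite_finite_induct) auto

lemma gpart_mult_var: "gpart (h + gen_deg i) (f * var i) = gpart h f * var i"
  by (induction f rule: fa_induct) (auto simp: gpart_wmono var_def word_deg_append word_deg_def algebra_simps)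

lemma gpart_var_mult: "gpart (h + gen_deg i) (var i * f) = var i * gpart h f"
  by (induction f rule: fa_induct) (auto simp: gpart_wmono var_def word_deg_append word_deg_def algebra_simps)

lemma gpart_var: "gpart h (var i) = (if h = gen_deg i then var i else 0)"
  by (simp add: var_def gpart_wmono word_deg_def)

lemma gpart_const: "gpart h (const c) = (if h = 0 then const c else 0)"
  by (simp add: const_def gpart_wmono word_deg_def)

lemma G_UNIV: "(UNIV :: G set) = {(0,0), (0,1), (1,0), (1,1)}"
proof -
  have "x \<in> {(0,0), (0,1), (1,0), (1,1)}" for x :: G
    using bit_cases[of "fst x"] bit_cases[of "snd x"] by (cases x) auto
  then show ?thesis by blast
qed

lemma finite_G [simp]: "finite (UNIV :: G set)"
  by (simp add: G_UNIV)

lemma sum_gpart: "(\<Sum>h\<in>UNIV. gpart h f) = f"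
  by (rule poly_mapping_eqI) (simp add: lookup_sum lookup_gpart)

lemma act_gpart: "act_free g (gpart h f) = const (chi h g) * gpart h f"
  by (induction f rule: fa_induct) (auto simp: act_wmono gpart_wmono word_sign_chi const_mono algebra_simps)

lemma gpart_act: "gpart h (act_free g f) = const (chi h g) * gpart h f"
  by (induction f rule: fa_induct) (auto simp: act_wmono gpart_wmono word_sign_chi const_mono algebra_simps)

lemma chi_separates: "k \<noteq> h \<Longrightarrow> \<exists>g. chi k g - chi h g \<in> {2, - 2 :: 'k::field}"
proof -
  assume "k \<noteq> h"
  obtain a b c d where kh: "k = (a, b)" "h = (c, d)" by (cases k; cases h)
  with \<open>k \<noteq> h\<close> have "chi k (0,1) - chi h (0,1) \<in> {2, - 2 :: 'k} \<or> chi k (1,0) - chi h (1,0) \<in> {2, - 2 :: 'k}"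
    using bit_cases[of a] bit_cases[of b] bit_cases[of c] bit_cases[of d] by auto
  then show ?thesis by blast
qed

context sklyanin begin

lemma chi_sum: "(\<Sum>g\<in>UNIV. chi h g * chi k g) = (if h = k then 4 else (0::'k))"
proof -
  obtain a b c d where kh: "k = (a, b)" "h = (c, d)" by (cases k; cases h)
  show ?thesis unfolding kh G_UNIV
    using bit_cases[of a] bit_cases[of b] bit_cases[of c] bit_cases[of d] by auto
qed

lemma const_relI_cancel: "c \<noteq> 0 \<Longrightarrow> const c * f \<in> I \<Longrightarrow> f \<in> I"
proof -
  assume c: "c \<noteq> 0" "const c * f \<in> I"
  have "const (1 / c) * (const c * f) = const (1 / c * c) * f"
    unfolding const_simps by (simp add: mult.assoc)
  then have "const (1 / c) * (const c * f) = f" using c(1) by simp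
  then show "f \<in> I" using relI_closed(3)[OF c(2), of "const (1 / c)"] by simp
qed

lemma relI_sum: "(\<And>x. x \<in> A \<Longrightarrow> F x \<in> I) \<Longrightarrow> sum F A \<in> I"
  by (induction A rule: infinite_finite_induct) (auto intro: relI_closed)

text \<open>Character orthogonality: four times the projection to degree \<open>h\<close> is the sum
  of the actions weighted by \<open>chi h\<close>, and each summand preserves
  \<open>I\<close>.\<close>

lemma gpart_relI:
  assumes "f \<in> I"
  shows "gpart h f \<in> I"
proof -
  have "(\<Sum>g\<in>UNIV. const (chi h g) * act_free g f) = const 4 * gpart h f"
  proof (rule poly_mapping_eqI)
    fix w
    have "Poly_Mapping.lookup (const c * f) w = c * Poly_Mapping.lookup f w" for c and f :: "'k fa"
      by (induction f rule: fa_induct) (simp_all add: const_mono lookup_add lookup_single when_def algebra_simps)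
    then have "Poly_Mapping.lookup (\<Sum>g\<in>UNIV. const (chi h g) * act_free g f) w
        = (\<Sum>g\<in>UNIV. chi h g * chi (word_deg w) g) * Poly_Mapping.lookup f w"
      and "Poly_Mapping.lookup (const 4 * gpart h f) w = 4 * Poly_Mapping.lookup (gpart h f) w"
      by (simp_all add: lookup_sum lookup_act word_sign_chi sum_distrib_right mult.assoc)
    then show "Poly_Mapping.lookup (\<Sum>g\<in>UNIV. const (chi h g) * act_free g f) w
        = Poly_Mapping.lookup (const 4 * gpart h f) w"
      unfolding chi_sum lookup_gpart by auto
  qed
  then have "const 4 * gpart h f \<in> I"
    using relI_sum[of UNIV "\<lambda>g. const (chi h g) * act_free g f"] act_relI[OF assms] relI_closed(3) by metis
  then show ?thesis using const_relI_cancel four_nz by blast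
qed

lemma finsum_clsB: "finite A \<Longrightarrow> (\<Oplus>\<^bsub>\<B>\<^esub>h\<in>A. clB (F h)) = clB (\<Sum>h\<in>A. F h)"
proof (induction A rule: finite_induct)
  case empty
  interpret B: ring "\<B>" by (rule ring_algB)
  show ?case by (simp add: clsB_zero)
next
  case (insert x A)
  interpret B: ring "\<B>" by (rule ring_algB)
  show ?case using insert by (simp add: B.finsum_insert Pi_def clsB_simps)
qed

text \<open>For uniqueness, lift a given component of degree h to \<open>u h\<close>. It is an
  eigenvector modulo \<open>I\<close>, and distinct characters differ by an invertible scalar
  somewhere, so its parts of other degrees lie in \<open>I\<close>.\<close>

lemma components_clsB: "components \<alpha> \<beta> \<gamma> (clB f) = (\<lambda>h. clB (gpart h f))"
  unfolding components_def
proof (rule the_equality, intro conjI allI)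
  show "clB (gpart h f) \<in> partB \<alpha> \<beta> \<gamma> h" for h
    by (simp add: partB_clsB act_gpart relI_closed(1))
  show "clB f = (\<Oplus>\<^bsub>\<B>\<^esub>h\<in>UNIV. clB (gpart h f))"
    by (simp add: finsum_clsB sum_gpart)
next
  fix c assume c: "(\<forall>h. c h \<in> partB \<alpha> \<beta> \<gamma> h) \<and> clB f = (\<Oplus>\<^bsub>\<B>\<^esub>h\<in>UNIV. c h)"
  have "\<forall>h. \<exists>u. c h = clB u"
  proof
    fix h
    have "c h \<in> carrier (\<B>)" using c unfolding partB_def by blast
    then show "\<exists>u. c h = clB u" unfolding carrier_algB by blast
  qed
  from choice[OF this] obtain u where u: "\<And>h. c h = clB (u h)" by blast
  have part: "act_free g (u h) - const (chi h g) * u h \<in> I" for g h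
    using c unfolding u partB_clsB by blast
  have "clB f = clB (\<Sum>h\<in>UNIV. u h)" using c unfolding u finsum_clsB[OF finite_G] by blast
  then have fu: "f - (\<Sum>h\<in>UNIV. u h) \<in> I" by (simp add: clsB_eq)
  have off: "gpart k (u h) \<in> I" if "k \<noteq> h" for k h
  proof -
    obtain g where g: "chi k g - chi h g \<in> {2, - 2 :: 'k}" using chi_separates[OF \<open>k \<noteq> h\<close>] by blast
    have "const (chi k g - chi h g) * gpart k (u h) \<in> I"
      using gpart_relI[OF part[of g h], of k] by (simp add: gpart_act gpart_const_mult algebra_simps)
    moreover have "chi k g - chi h g \<noteq> (0 :: 'k)" using g two_nz
      by (metis insertE neg_equal_0_iff_equal singletonD)
    ultimately show ?thesis using const_relI_cancel by blast
  qed
  have "c k = clB (gpart k f)" for k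
  proof -
    have s: "(\<Sum>h\<in>UNIV. F h) = F k + (\<Sum>h\<in>UNIV - {k}. F h)" for F :: "G \<Rightarrow> 'k fa"
      by (rule sum.remove) simp_all
    have "gpart k (f - (\<Sum>h\<in>UNIV. u h)) \<in> I" by (rule gpart_relI[OF fu])
    then have "gpart k f - gpart k (u k) - (\<Sum>h\<in>UNIV - {k}. gpart k (u h)) \<in> I"
      by (simp add: gpart_sum s algebra_simps)
    moreover have "(\<Sum>h\<in>UNIV - {k}. gpart k (u h)) \<in> I" by (rule relI_sum) (use off in auto)
    ultimately have 1: "gpart k f - gpart k (u k) \<in> I" using relI_closed(2) by fastforce
    have "(\<Sum>h\<in>UNIV - {k}. gpart h (u k)) \<in> I" by (rule relI_sum) (use off in auto)
    moreover have "u k = gpart k (u k) + (\<Sum>h\<in>UNIV - {k}. gpart h (u k))"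
      using s[of "\<lambda>h. gpart h (u k)"] by (simp add: sum_gpart)
    ultimately have 2: "u k - gpart k (u k) \<in> I" by (metis add_diff_cancel_left')
    have "u k - gpart k f \<in> I" using relI_closed(6)[OF 2 1] by simp
    then show ?thesis by (simp add: u clsB_eq)
  qed
  then show "c = (\<lambda>h. clB (gpart h f))" by blast
qed

lemma twisted_mult_clsB:
  "twisted_mult \<alpha> \<beta> \<gamma> (clB a) (clB b)
    = clB (\<Sum>g\<in>UNIV. \<Sum>h\<in>UNIV. const (mu g h) * (gpart g a * gpart h b))"
  unfolding twisted_mult_def components_clsB by (simp add: clsB_simps finsum_clsB)

lemma carrier_twistB: "carrier (\<T>) = range (clB)"
  by (simp add: twistB_def carrier_algB)

lemma mult_twistB: "x \<otimes>\<^bsub>\<T>\<^esub> y = twisted_mult \<alpha> \<beta> \<gamma> x y"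
  by (simp add: twistB_def)

lemma sum_single: "(\<Sum>h\<in>UNIV. if h = k then F h else 0) = (F k :: 'b :: comm_monoid_add)" for k :: G
  by (simp add: sum.delta)

lemma twisted_mult_homogeneous:
  assumes "\<And>h. gpart h b = (if h = d then b else 0)"
  shows "twisted_mult \<alpha> \<beta> \<gamma> (clB a) (clB b)
      = clB (\<Sum>g\<in>UNIV. const (mu g d) * (gpart g a * b))"
    "twisted_mult \<alpha> \<beta> \<gamma> (clB b) (clB a)
      = clB (\<Sum>g\<in>UNIV. const (mu d g) * (b * gpart g a))"
proof -
  have "(\<Sum>h\<in>UNIV. const (mu g h) * (gpart g a * gpart h b)) = const (mu g d) * (gpart g a * b)" for g
  proof -
    have "(\<Sum>h\<in>UNIV. const (mu g h) * (gpart g a * gpart h b))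
      = (\<Sum>h\<in>UNIV. if h = d then const (mu g h) * (gpart g a * b) else 0)"
      by (rule sum.cong) (use assms in auto)
    then show ?thesis by (simp only: sum_single)
  qed
  then show "twisted_mult \<alpha> \<beta> \<gamma> (clB a) (clB b)
      = clB (\<Sum>g\<in>UNIV. const (mu g d) * (gpart g a * b))"
    unfolding twisted_mult_clsB by (simp only:)
  have "(\<Sum>g\<in>UNIV. \<Sum>h\<in>UNIV. const (mu g h) * (gpart g b * gpart h a))
    = (\<Sum>g\<in>UNIV. if g = d then (\<Sum>h\<in>UNIV. const (mu g h) * (b * gpart h a)) else 0)"
    by (rule sum.cong) (use assms in auto)
  then show "twisted_mult \<alpha> \<beta> \<gamma> (clB b) (clB a)
      = clB (\<Sum>g\<in>UNIV. const (mu d g) * (b * gpart g a))"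
    unfolding twisted_mult_clsB by (simp only: sum_single)
qed

lemma mu_zero: "mu g 0 = (1::'k)" "mu 0 g = (1::'k)"
  by (cases g; simp add: zero_prod_def)+

lemma mu_sq: "mu g h * mu g h = (1::'k)"
  by (cases g; cases h) simp

lemma const_in_centre: "clB (const c) \<in> centre (\<T>)"
proof -
  note t = twisted_mult_homogeneous[OF gpart_const]
  have "twisted_mult \<alpha> \<beta> \<gamma> (clB (const c)) (clB a)
    = twisted_mult \<alpha> \<beta> \<gamma> (clB a) (clB (const c))" for a
    unfolding t mu_zero const_central[of c] by (rule refl)
  then show ?thesis by (auto simp: centre_def carrier_twistB mult_twistB)
qed

text \<open>Commutation with x_i in the twist is projected to degree \<open>g + gen_deg i\<close>,
  where the component of \<open>f\<close> in degree \<open>g\<close> alone contributes.\<close>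

lemma centre_commutes_var:
  assumes "clB f \<in> centre (\<T>)"
  shows "const (mu g (gen_deg i)) * (gpart g f * var i) - const (mu (gen_deg i) g) * (var i * gpart g f) \<in> I"
proof -
  note t = twisted_mult_homogeneous[OF gpart_var]
  have "twisted_mult \<alpha> \<beta> \<gamma> (clB f) (clB (var i))
    = twisted_mult \<alpha> \<beta> \<gamma> (clB (var i)) (clB f)"
    using assms by (auto simp: centre_def carrier_twistB mult_twistB)
  then have "(\<Sum>g\<in>UNIV. const (mu g (gen_deg i)) * (gpart g f * var i))
      - (\<Sum>g\<in>UNIV. const (mu (gen_deg i) g) * (var i * gpart g f)) \<in> I"
    unfolding t clsB_eq .
  from gpart_relI[OF this, of "g + gen_deg i"]
  have "(\<Sum>h\<in>UNIV. const (mu h (gen_deg i)) * (gpart g (gpart h f) * var i))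
      - (\<Sum>h\<in>UNIV. const (mu (gen_deg i) h) * (var i * gpart g (gpart h f))) \<in> I"
    by (simp only: gpart_simps gpart_sum gpart_const_mult gpart_mult_var gpart_var_mult)
  moreover have "(\<Sum>h\<in>UNIV. const (mu h (gen_deg i)) * (gpart g (gpart h f) * var i))
    = (\<Sum>h\<in>UNIV. if h = g then const (mu h (gen_deg i)) * (gpart h f * var i) else 0)"
    by (rule sum.cong) (auto simp: gpart_gpart)
  moreover have "(\<Sum>h\<in>UNIV. const (mu (gen_deg i) h) * (var i * gpart g (gpart h f)))
    = (\<Sum>h\<in>UNIV. if h = g then const (mu (gen_deg i) h) * (var i * gpart h f) else 0)"
    by (rule sum.cong) (auto simp: gpart_gpart)
  ultimately show ?thesis by (simp only: sum_single)
qed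

end

theorem (in sklyanin_translation) centre_trivial:
  assumes inf: "infinite_order_on E \<sigma>"
  shows "centre (\<T>) = range (\<lambda>c. clB (const c))"
proof
  show "range (\<lambda>c. clB (const c)) \<subseteq> centre (\<T>)"
    using const_in_centre by blast
  show "centre (\<T>) \<subseteq> range (\<lambda>c. clB (const c))"
  proof
    fix z assume z: "z \<in> centre (\<T>)"
    then have "z \<in> carrier (\<T>)" by (simp add: centre_def)
    then obtain f where f: "z = clB f" unfolding carrier_twistB by blast
    note cv = centre_commutes_var[OF z[unfolded f]]
    have pos: "lpart n (gpart g f) \<in> I" if n: "n > 0" for n g
    proof (rule vanish_relI[OF homog_lpart])
      fix p assume p: "p \<in> E"
      \<comment> \<open>\<open>gpart g f\<close> may mix word lengths, but \<open>ev_seq\<close> at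
        \<open>n\<close> sees only words of length \<open>n\<close>.\<close>
      have "ev_seq (orbit p) n (gpart g f) = 0"
      proof (rule quasi_central_vanishes[OF inf n _ _ p])
        show "mu (gen_deg i) g * mu g (gen_deg i) * (mu (gen_deg i) g * mu g (gen_deg i)) = (1::'a)" for i
          using mu_sq[of "gen_deg i" g] mu_sq[of g "gen_deg i"] by (metis mult.assoc mult.commute mult_1)
        fix q i assume q: "q \<in> E"
        have "mu g (gen_deg i) * ev_seq (orbit q) (Suc n) (gpart g f * var i) = mu (gen_deg i) g * ev_seq (orbit
          q) (Suc n) (var i * gpart g f)"
          using ev_seq_relI[OF q cv[of g i], of "Suc n"] by simp
        then have "mu g (gen_deg i) * (mu g (gen_deg i) * ev_seq (orbit q) (Suc n) (gpart g f * var i))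
          = mu g (gen_deg i) * (mu (gen_deg i) g * ev_seq (orbit q) (Suc n) (var i * gpart g f))" by simp
        then show "ev_seq (orbit q) (Suc n) (gpart g f * var i) = mu (gen_deg i) g * mu g (gen_deg i) * ev_seq
          (orbit q) (Suc n) (var i * gpart g f)"
          unfolding mult.assoc[symmetric] mu_sq by (simp add: mult.commute mult.left_commute)
      qed
      then show "ev_seq (orbit p) n (lpart n (gpart g f)) = 0" by (simp add: ev_seq_lpart)
    qed
    have "\<exists>c. gpart g f - const c \<in> I" for g
    proof -
      obtain c where c: "lpart 0 (gpart g f) = const c" using homog_0E[OF homog_lpart] by metis
      obtain N where N: "gpart g f = (\<Sum>n<N. lpart n (gpart g f))" using sum_lpart by blast
      \<comment> \<open>For \<open>N = 0\<close> the sum is empty and the constant has to be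
        zero.\<close>
      have "(\<Sum>n<N. lpart n (gpart g f)) - const (if N = 0 then 0 else c) \<in> I"
      proof (cases N)
        case (Suc N')
        have "(\<Sum>n<N'. lpart (Suc n) (gpart g f)) \<in> I" by (rule relI_sum) (rule pos, simp)
        moreover have "(\<Sum>n<N. lpart n (gpart g f)) = const c + (\<Sum>n<N'. lpart (Suc n) (gpart g f))"
          unfolding Suc sum.lessThan_Suc_shift c ..
        ultimately show ?thesis by (simp add: Suc)
      qed (simp add: relI_closed(1))
      then show ?thesis using N by metis
    qed
    then have "\<forall>g. \<exists>c. gpart g f - const c \<in> I" ..
    from choice[OF this] obtain c where c: "\<And>g. gpart g f - const (c g) \<in> I" by blast
    have "const (sum c A) = (\<Sum>g\<in>A. const (c g))" for A
      by (induction A rule: infinite_finite_induct) simp_all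
    then have "f - const (\<Sum>g\<in>UNIV. c g) = (\<Sum>g\<in>UNIV. gpart g f - const (c g))"
      by (simp only: sum_subtractf sum_gpart)
    then have "f - const (\<Sum>g\<in>UNIV. c g) \<in> I" using relI_sum[of UNIV, OF c] by (simp only:)
    then have "z = clB (const (\<Sum>g\<in>UNIV. c g))" by (simp only: f clsB_eq)
    then show "z \<in> range (\<lambda>c. clB (const c))" by blast
  qed
qed

section \<open>From point modules to the bilinear relations\<close>

locale algA_module = sklyanin_algebra \<alpha> \<beta> \<gamma> for \<alpha> \<beta> \<gamma> :: "'k::field" +
  fixes N :: "('k elA, 'm) grmod"
  assumes rm: "right_module (\<A>) N"
begin

abbreviation app :: "'m \<Rightarrow> 'k fa \<Rightarrow> 'm" where "app m f \<equiv> ract N m (clA f)"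

sublocale N: abelian_group N using rm by (simp add: right_module_def)

lemma app_closed [simp]: "m \<in> carrier N \<Longrightarrow> app m f \<in> carrier N"
  using rm by (simp add: right_module_def)

lemma app_add: "m \<in> carrier N \<Longrightarrow> app m (f + g) = app m f \<oplus>\<^bsub>N\<^esub> app m g"
  using rm unfolding right_module_def clsA_simps(2)[symmetric] by simp

lemma app_add_left: "m \<in> carrier N \<Longrightarrow> m' \<in> carrier N \<Longrightarrow> app (m \<oplus>\<^bsub>N\<^esub> m') f = app m f \<oplus>\<^bsub>N\<^esub> app m' f"
  using rm unfolding right_module_def by simp

lemma app_mult: "m \<in> carrier N \<Longrightarrow> app m (f * g) = app (app m f) g"
  using rm unfolding right_module_def clsA_simps(1)[symmetric] by simp

lemma app_one: "m \<in> carrier N \<Longrightarrow> app m 1 = m"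
  using rm unfolding right_module_def clsA_simps(3)[symmetric] by simp

lemma app_zero: "m \<in> carrier N \<Longrightarrow> app m 0 = \<zero>\<^bsub>N\<^esub>"
  using app_add[of m 0 0] by (simp add: N.add.l_cancel_one')

lemma app_zero_left: "app \<zero>\<^bsub>N\<^esub> f = \<zero>\<^bsub>N\<^esub>"
  using app_add_left[of "\<zero>\<^bsub>N\<^esub>" "\<zero>\<^bsub>N\<^esub>" f] by (simp add: N.add.l_cancel_one')

lemma app_const_mult: "m \<in> carrier N \<Longrightarrow> app m (const c * f) = app (app m f) (const c)"
  by (simp add: const_central app_mult)

lemma app_const_zero:
  assumes "m \<in> carrier N" "app m (const c) = \<zero>\<^bsub>N\<^esub>" "m \<noteq> \<zero>\<^bsub>N\<^esub>"
  shows "c = 0"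
proof (rule ccontr)
  assume "c \<noteq> 0"
  then have "const c * const (1 / c) = 1" by (simp flip: const_simps(4))
  then have "m = app (app m (const c)) (const (1 / c))"
    using app_mult[of m "const c" "const (1 / c)"] app_one assms(1) by simp
  then show False using assms app_zero_left by simp
qed

lemma app_relation: "m \<in> carrier N \<Longrightarrow> f \<in> \<R> \<Longrightarrow> app m f = \<zero>\<^bsub>N\<^esub>"
  using sklyanin_relations_sub clsA_eq[of f 0] app_zero by auto

lemma app_diff: "m \<in> carrier N \<Longrightarrow> app m (f - g) = app m f \<ominus>\<^bsub>N\<^esub> app m g"
proof -
  assume m: "m \<in> carrier N"
  then have "app m f = app m (f - g) \<oplus>\<^bsub>N\<^esub> app m g" using app_add[of m "f - g" g] by simp
  then show ?thesis using m by (simp add: N.minus_eq N.add.m_assoc N.r_neg)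
qed

text \<open>On \<open>m\<close> every generator acts as a multiple of \<open>var t\<close>, because
  the remaining forms vanish at \<open>v\<close>; one degree higher the same holds for
  \<open>var s\<close> and \<open>w\<close>.\<close>

lemma app_quadratic:
  assumes m: "m \<in> carrier N"
    and v: "\<forall>a. dot a v = 0 \<longrightarrow> app m (lform a) = \<zero>\<^bsub>N\<^esub>"
    and w: "\<forall>a i. dot a w = 0 \<longrightarrow> app (app m (var i)) (lform a) = \<zero>\<^bsub>N\<^esub>"
    and t: "v t \<noteq> 0" and s: "w s \<noteq> 0"
  shows "app m (var i * var j) = app (app m (var t * var s)) (const (v i * w j / (v t * w s)))"
proof -
  have lin_ext: "app x (var i) = app (app x (var t)) (const (u i / u t))"
    if x: "x \<in> carrier N" and u: "\<And>a. dot a u = 0 \<Longrightarrow> app x (lform a) = \<zero>\<^bsub>N\<^esub>" "u t \<noteq> 0" for x i t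
      and u :: "gen \<Rightarrow> 'k"
  proof -
    have "dot (\<lambda>k. unit i k - u i / u t * unit t k) u = 0"
      using u(2) by (cases i; cases t) (simp_all add: dot_simps unit_def)
    from u(1)[OF this] have "app x (var i - const (u i / u t) * var t) = \<zero>\<^bsub>N\<^esub>"
      unfolding lform_diff lform_unit .
    then have "app x (var i) = app x (const (u i / u t) * var t)"
      using app_add[OF x, of "var i - const (u i / u t) * var t" "const (u i / u t) * var t"] x by simp
    then show ?thesis using x by (simp add: app_const_mult)
  qed
  have "app m (var i * var j) = app (app m (var i)) (var j)" using m by (simp add: app_mult)
  also have "\<dots> = app (app (app m (var i)) (var s)) (const (w j / w s))"
    by (rule lin_ext) (use m w s in auto)
  also have "app m (var i) = app (app m (var t)) (const (v i / v t))"
    by (rule lin_ext) (use m v t in auto)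
  also have "app (app (app m (var t)) (const (v i / v t))) (var s) = app (app (app m (var t)) (var s)) (const (v i
    / v t))"
    using m by (metis app_closed app_mult const_central)
  also have "app (app (app (app m (var t)) (var s)) (const (v i / v t))) (const (w j / w s))
    = app (app (app m (var t)) (var s)) (const (v i / v t) * const (w j / w s))"
    using m by (simp add: app_mult)
  also have "const (v i / v t) * const (w j / w s) = const (v i * w j / (v t * w s))"
    by (simp flip: const_simps(4))
  finally show ?thesis using m by (simp add: app_mult)
qed

text \<open>A defining relation sends \<open>m\<close> to its bilinear value at
  \<open>(v, w)\<close>, up to a common nonzero scalar, times one nonzero vector; it also sends
  \<open>m\<close> to zero.\<close>

lemma relations_bilinear:
  assumes m: "m \<in> carrier N"
    and v: "\<forall>a. dot a v = 0 \<longrightarrow> app m (lform a) = \<zero>\<^bsub>N\<^esub>"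
    and w: "\<forall>a i. dot a w = 0 \<longrightarrow> app (app m (var i)) (lform a) = \<zero>\<^bsub>N\<^esub>"
    and t: "v t \<noteq> 0" and s: "w s \<noteq> 0" and nz: "app m (var t * var s) \<noteq> \<zero>\<^bsub>N\<^esub>"
  shows "v X0 * w X1 - v X1 * w X0 = \<alpha> * (v X2 * w X3 + v X3 * w X2)"
    "v X0 * w X1 + v X1 * w X0 = v X2 * w X3 - v X3 * w X2"
    "v X0 * w X2 - v X2 * w X0 = \<beta> * (v X3 * w X1 + v X1 * w X3)"
    "v X0 * w X2 + v X2 * w X0 = v X3 * w X1 - v X1 * w X3"
    "v X0 * w X3 - v X3 * w X0 = \<gamma> * (v X1 * w X2 + v X2 * w X1)"
    "v X0 * w X3 + v X3 * w X0 = v X1 * w X2 - v X2 * w X1"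
proof -
  define x where "x = app m (var t * var s)"
  have x: "x \<in> carrier N" using m by (simp add: x_def)
  define K where "K = v t * w s"
  have K: "K \<noteq> 0" using t s by (simp add: K_def)
  define P where "P f c \<longleftrightarrow> app m f = app x (const (c / K))" for f c
  have P: "P (var i * var j) (v i * w j)" for i j
    unfolding P_def x_def K_def by (rule app_quadratic[OF m v w t s])
  have Padd: "P (f + g) (c + d)" if "P f c" "P g d" for f g c d
    using that m x unfolding P_def by (simp add: app_add add_divide_distrib)
  have Pdiff: "P (f - g) (c - d)" if "P f c" "P g d" for f g c d
    using that m x unfolding P_def by (simp add: app_diff diff_divide_distrib)
  have Pconst: "P (const a * f) (a * c)" if "P f c" for a f c
  proof -
    have "app m (const a * f) = app (app x (const (c / K))) (const a)"
      using that m unfolding P_def by (simp add: app_const_mult)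
    also have "\<dots> = app x (const (c / K) * const a)" using x by (simp add: app_mult)
    also have "const (c / K) * const a = const (a * c / K)" by (simp flip: const_simps(4) add: mult.commute)
    finally show ?thesis by (simp add: P_def)
  qed
  have zero: "c = 0" if "P f c" "f \<in> \<R>" for f c
    using that app_relation[OF m] app_const_zero[OF x, of "c / K"] nz K unfolding P_def x_def[symmetric] by simp
  have Pc: "P (comm (var i) (var j)) (v i * w j - v j * w i)" "P (acomm (var i) (var j)) (v i * w j + v j * w i)"
    for i j
    unfolding comm_def acomm_def by (intro Pdiff Padd P)+
  note S = sklyanin_relations_def
  have "v X0 * w X1 - v X1 * w X0 - \<alpha> * (v X2 * w X3 + v X3 * w X2) = 0"
    by (rule zero[OF Pdiff[OF Pc(1) Pconst[OF Pc(2)]]]) (simp add: S)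
  moreover have "v X0 * w X1 + v X1 * w X0 - (v X2 * w X3 - v X3 * w X2) = 0"
    by (rule zero[OF Pdiff[OF Pc(2) Pc(1)]]) (simp add: S)
  moreover have "v X0 * w X2 - v X2 * w X0 - \<beta> * (v X3 * w X1 + v X1 * w X3) = 0"
    by (rule zero[OF Pdiff[OF Pc(1) Pconst[OF Pc(2)]]]) (simp add: S)
  moreover have "v X0 * w X2 + v X2 * w X0 - (v X3 * w X1 - v X1 * w X3) = 0"
    by (rule zero[OF Pdiff[OF Pc(2) Pc(1)]]) (simp add: S)
  moreover have "v X0 * w X3 - v X3 * w X0 - \<gamma> * (v X1 * w X2 + v X2 * w X1) = 0"
    by (rule zero[OF Pdiff[OF Pc(1) Pconst[OF Pc(2)]]]) (simp add: S)
  moreover have "v X0 * w X3 + v X3 * w X0 - (v X1 * w X2 - v X2 * w X1) = 0"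
    by (rule zero[OF Pdiff[OF Pc(2) Pc(1)]]) (simp add: S)
  ultimately show "v X0 * w X1 - v X1 * w X0 = \<alpha> * (v X2 * w X3 + v X3 * w X2)"
    "v X0 * w X1 + v X1 * w X0 = v X2 * w X3 - v X3 * w X2"
    "v X0 * w X2 - v X2 * w X0 = \<beta> * (v X3 * w X1 + v X1 * w X3)"
    "v X0 * w X2 + v X2 * w X0 = v X3 * w X1 - v X1 * w X3"
    "v X0 * w X3 - v X3 * w X0 = \<gamma> * (v X1 * w X2 + v X2 * w X1)"
    "v X0 * w X3 + v X3 * w X0 = v X1 * w X2 - v X2 * w X1"
    by (simp_all only: right_minus_eq)
qed

lemma app_sum: "finite A \<Longrightarrow> m \<in> carrier N \<Longrightarrow> app m (sum F A) = (\<Oplus>\<^bsub>N\<^esub>x\<in>A. app m (F x))"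
  by (induction A rule: finite_induct) (simp_all add: app_zero app_add N.finsum_insert Pi_def)

end

locale graded_algA_module = algA_module +
  assumes gr: "graded_right_module (\<A>) (partA \<alpha> \<beta> \<gamma>) N"
begin

lemma hpart_carrier: "m \<in> hpart N n \<Longrightarrow> m \<in> carrier N"
  using gr additive_subgroup.a_Hcarr unfolding graded_right_module_def by metis

lemma hpart_zero: "\<zero>\<^bsub>N\<^esub> \<in> hpart N n"
  using gr additive_subgroup.zero_closed unfolding graded_right_module_def by metis

lemma app_hpart: "m \<in> hpart N i \<Longrightarrow> homog j f \<Longrightarrow> app m f \<in> hpart N (i + j)"
  using gr unfolding graded_right_module_def partA_def homog_def by blast

text \<open>In \<open>point_module\<close> the element \<open>e\<close> need not lie in the carrier, so its last clause does not make the
  homogeneous parts one-dimensional.  They are controlled through the cyclic generator instead.\<close>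

lemma cyclic_hpart:
  assumes g: "g \<in> hpart N 0" and x: "x \<in> hpart N n" and gx: "x = app g f"
  shows "x = app g (lpart n f)"
proof -
  have gc: "g \<in> carrier N" and xc: "x \<in> carrier N" using g x hpart_carrier by auto
  define D where "D c \<longleftrightarrow> (\<forall>n. c n \<in> hpart N n) \<and> finite {n. c n \<noteq> \<zero>\<^bsub>N\<^esub>} \<and>
        x = (\<Oplus>\<^bsub>N\<^esub>n\<in>{n. c n \<noteq> \<zero>\<^bsub>N\<^esub>}. c n)" for c
  have uniq: "c = c'" if "D c" "D c'" for c c'
    using gr xc that unfolding graded_right_module_def D_def by blast
  have "D (\<lambda>k. if k = n then x else \<zero>\<^bsub>N\<^esub>)"
  proof (cases "x = \<zero>\<^bsub>N\<^esub>")
    case True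
    then show ?thesis using hpart_zero by (simp add: D_def)
  next
    case False
    then have "{k. (if k = n then x else \<zero>\<^bsub>N\<^esub>) \<noteq> \<zero>\<^bsub>N\<^esub>} = {n}" by auto
    then show ?thesis using x xc hpart_zero unfolding D_def by (simp add: N.finsum_insert)
  qed
  moreover have "D (\<lambda>k. app g (lpart k f))"
  proof -
    obtain K where K: "f = (\<Sum>k<K. lpart k f)" "\<And>k. k \<ge> K \<Longrightarrow> lpart k f = 0"
      using sum_lpart by metis
    let ?c = "\<lambda>k. app g (lpart k f)"
    have sub: "{k. ?c k \<noteq> \<zero>\<^bsub>N\<^esub>} \<subseteq> {..<K}" using K(2) app_zero[OF gc] by (force simp: not_less[symmetric])
    have "x = (\<Oplus>\<^bsub>N\<^esub>k\<in>{..<K}. ?c k)"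
      using gx K(1) app_sum[OF _ gc, of "{..<K}" "\<lambda>k. lpart k f"] by simp
    also have "\<dots> = (\<Oplus>\<^bsub>N\<^esub>k\<in>{k. ?c k \<noteq> \<zero>\<^bsub>N\<^esub>}. ?c k)"
      by (rule N.add.finprod_mono_neutral_cong_right) (use sub gc in auto)
    finally show ?thesis
      using sub finite_subset app_hpart[OF g homog_lpart] unfolding D_def by auto
  qed
  ultimately have "(\<lambda>k. if k = n then x else \<zero>\<^bsub>N\<^esub>) = (\<lambda>k. app g (lpart k f))" by (rule uniq)
  then show ?thesis by (metis (mono_tags))
qed

end

lemma lform_explicit: "lform a = const (a X0) * var X0 + const (a X1) * var X1 + const (a X2) * var X2
  + const (a X3) * var X3"
  by (simp add: lform_def sum_gen)

lemma (in sklyanin_algebra) point_module_of_lform: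
  assumes "point_module_of \<alpha> \<beta> \<gamma> p N" "v \<in> p"
  shows "(\<forall>m \<in> hpart N 0. ract N m (clA (lform a)) = \<zero>\<^bsub>N\<^esub>) \<longleftrightarrow> dot a v = 0"
  using assms unfolding point_module_of_def lform_explicit dot_simps by blast

text \<open>The isomorphism matches degree one of \<open>N\<close> with degree zero of
  \<open>N'\<close> and is injective; a linear form moves degree one to degree two, inside the
  truncation.\<close>

lemma (in sklyanin_algebra) shifted_annihilator:
  assumes G: "graded_algA_module \<alpha> \<beta> \<gamma> N" and G': "graded_algA_module \<alpha> \<beta> \<gamma> N'"
    and iso: "graded_iso (\<A>) (shift_trunc N) N'"
  shows "(\<forall>m \<in> hpart N 1. ract N m (clA (lform a)) = \<zero>\<^bsub>N\<^esub>)
    \<longleftrightarrow> (\<forall>m \<in> hpart N' 0. ract N' m (clA (lform a)) = \<zero>\<^bsub>N'\<^esub>)"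
proof -
  interpret N: graded_algA_module \<alpha> \<beta> \<gamma> N by (rule G)
  interpret N': graded_algA_module \<alpha> \<beta> \<gamma> N' by (rule G')
  obtain f where f: "bij_betw f (carrier (shift_trunc N)) (carrier N')"
      "\<And>m m'. m \<in> carrier (shift_trunc N) \<Longrightarrow> m' \<in> carrier (shift_trunc N) \<Longrightarrow>
        f (m \<oplus>\<^bsub>N\<^esub> m') = f m \<oplus>\<^bsub>N'\<^esub> f m'"
      "\<And>m r. m \<in> carrier (shift_trunc N) \<Longrightarrow> r \<in> carrier (\<A>) \<Longrightarrow> f (ract N m r) = ract N' (f m) r"
      "\<And>n. f ` hpart N (Suc n) = hpart N' n"
    using iso unfolding graded_iso_def by (auto simp: shift_trunc_def)
  have sub: "m \<in> carrier (shift_trunc N)" if "m \<in> hpart N (Suc n)" for m n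
  proof -
    have "m = (\<Oplus>\<^bsub>N\<^esub>k\<in>{Suc n}. m)" using N.hpart_carrier[OF that] by simp
    then show ?thesis using that unfolding shift_trunc_def by (auto intro!: exI[of _ "{Suc n}"] exI[of _ "\<lambda>_. m"])
  qed
  have z: "\<zero>\<^bsub>N\<^esub> \<in> carrier (shift_trunc N)" using sub[OF N.hpart_zero[of "Suc 0"]] .
  have fc: "f m \<in> carrier N'" if "m \<in> carrier (shift_trunc N)" for m
    using f(1) that by (auto simp: bij_betw_def)
  have f0: "f \<zero>\<^bsub>N\<^esub> = \<zero>\<^bsub>N'\<^esub>"
    using f(2)[OF z z] fc[OF z] by (simp add: N'.N.add.l_cancel_one')
  have "ract N m (clA (lform a)) = \<zero>\<^bsub>N\<^esub> \<longleftrightarrow> ract N' (f m) (clA (lform a)) = \<zero>\<^bsub>N'\<^esub>"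
    if m: "m \<in> hpart N 1" for m
  proof -
    have c: "m \<in> carrier (shift_trunc N)" using sub[of m 0] m by simp
    have "ract N m (clA (lform a)) \<in> hpart N (Suc 1)" using N.app_hpart[OF m homog_lform[of a]] by simp
    then have "ract N m (clA (lform a)) \<in> carrier (shift_trunc N)" by (rule sub)
    then have "ract N m (clA (lform a)) = \<zero>\<^bsub>N\<^esub> \<longleftrightarrow> f (ract N m (clA (lform a))) = f \<zero>\<^bsub>N\<^esub>"
      using inj_on_eq_iff[OF bij_betw_imp_inj_on[OF f(1)] _ z] by metis
    then show ?thesis unfolding f0 f(3)[OF c clsA_in] .
  qed
  moreover have "hpart N' 0 = f ` hpart N 1" using f(4)[of 0] by simp
  ultimately show ?thesis by simp
qed

text \<open>The forms killing degree zero of \<open>M p\<close> vanish at \<open>v\<close>; those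
  killing degree one vanish at \<open>w\<close>, by the shift isomorphism. So the relations of A,
  applied to the cyclic generator, hold bilinearly at \<open>(v, w)\<close>.\<close>

lemma (in sklyanin) associated_automorphism_rels:
  assumes A: "associated_automorphism \<alpha> \<beta> \<gamma> M \<sigma>"
    and p: "p \<in> curveE \<alpha> \<beta> \<gamma>" and v: "v \<in> p" and w: "w \<in> \<sigma> p"
  shows "rels v w"
proof -
  have sp: "\<sigma> p \<in> curveE \<alpha> \<beta> \<gamma>" using A p by (auto simp: associated_automorphism_def bij_betw_def)
  have pm: "point_module_of \<alpha> \<beta> \<gamma> p (M p)" "point_module_of \<alpha> \<beta> \<gamma> (\<sigma> p) (M (\<sigma> p))"
    and iso: "graded_iso (algA \<alpha> \<beta> \<gamma>) (shift_trunc (M p)) (M (\<sigma> p))"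
    using A p sp by (auto simp: associated_automorphism_def)
  have gm: "graded_algA_module \<alpha> \<beta> \<gamma> N" if "point_module_of \<alpha> \<beta> \<gamma> q N" for q and N :: "('k elA, 'b) grmod"
    using that by unfold_locales (auto simp: point_module_of_def point_module_def graded_right_module_def)
  interpret N: graded_algA_module \<alpha> \<beta> \<gamma> "M p" by (rule gm[OF pm(1)])
  note ann0 = point_module_of_lform[OF pm(1) v]
  have ann1: "(\<forall>m \<in> hpart (M p) 1. N.app m (lform a) = \<zero>\<^bsub>M p\<^esub>) \<longleftrightarrow> dot a w = 0" for a
    using shifted_annihilator[OF gm[OF pm(1)] gm[OF pm(2)] iso, of a] point_module_of_lform[OF pm(2) w, of a]
      by blast
  obtain t where t: "v t \<noteq> 0" using nonzero_coord[OF E_memD(2)[OF p v]] by blast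
  obtain s where s: "w s \<noteq> 0" using nonzero_coord[OF E_memD(2)[OF sp w]] by blast
  have du: "dot (unit i) u = u i" for i and u :: "gen \<Rightarrow> 'k" by (cases i) (simp_all add: dot_simps unit_def)
  obtain g where g: "g \<in> hpart (M p) 0" "carrier (M p) = ract (M p) g ` carrier (algA \<alpha> \<beta> \<gamma>)"
    using pm(1) by (auto simp: point_module_of_def point_module_def)
  have gc: "g \<in> carrier (M p)" by (rule N.hpart_carrier[OF g(1)])
  have g0: "\<forall>a. dot a v = 0 \<longrightarrow> N.app g (lform a) = \<zero>\<^bsub>M p\<^esub>" using ann0 g(1) by blast
  have "N.app g (var i) \<in> hpart (M p) 1" for i using N.app_hpart[OF g(1) homog_var[of i]] by simp
  then have g1: "\<forall>a i. dot a w = 0 \<longrightarrow> N.app (N.app g (var i)) (lform a) = \<zero>\<^bsub>M p\<^esub>"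
    using ann1 by blast
  have "\<exists>x\<in>hpart (M p) 1. N.app x (lform (unit s)) \<noteq> \<zero>\<^bsub>M p\<^esub>" using ann1[of "unit s"] s du by auto
  then obtain x where x: "x \<in> hpart (M p) 1" "N.app x (var s) \<noteq> \<zero>\<^bsub>M p\<^esub>" by (auto simp: lform_unit)
  obtain f where "x = N.app g f"
    using N.hpart_carrier[OF x(1)] unfolding g(2) carrier_algA by blast
  then have xf: "x = N.app g (lpart 1 f)" by (rule N.cyclic_hpart[OF g(1) x(1)])
  \<comment> \<open>Otherwise x_s kills all g x_i, which span degree one by
    \<open>cyclic_hpart\<close>, although \<open>w s\<close> is nonzero.\<close>
  have nz: "N.app g (var t * var s) \<noteq> \<zero>\<^bsub>M p\<^esub>"
  proof
    assume z: "N.app g (var t * var s) = \<zero>\<^bsub>M p\<^esub>"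
    have iz: "N.app g (var i * var s) = \<zero>\<^bsub>M p\<^esub>" for i
      using N.app_quadratic[OF gc g0 g1 t s, of i s] z N.app_zero_left by simp
    obtain c where c: "\<And>i. homog 0 (c i)" "lpart 1 f = (\<Sum>i\<in>UNIV. var i * c i)"
      using homog_SucE[of 0 "lpart 1 f"] homog_lpart[of 1 f] by auto
    have "\<forall>i. \<exists>k. c i = const k" using c(1) homog_0E by metis
    from choice[OF this] obtain k where k: "\<And>i. c i = const (k i)" by blast
    have "lpart 1 f * var s = (\<Sum>i\<in>UNIV. const (k i) * (var i * var s))"
      unfolding c(2) k sum_distrib_right by (intro sum.cong refl) (simp add: const_central mult.assoc)
    then have "N.app g (lpart 1 f * var s) = (\<Oplus>\<^bsub>M p\<^esub>i\<in>UNIV. N.app g (const (k i) * (var i * var s)))"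
      using N.app_sum[OF finite_gen gc] by simp
    also have "\<dots> = (\<Oplus>\<^bsub>M p\<^esub>i\<in>(UNIV :: gen set). \<zero>\<^bsub>M p\<^esub>)"
      using iz gc N.app_zero_left by (simp add: N.app_const_mult)
    also have "\<dots> = \<zero>\<^bsub>M p\<^esub>" by simp
    finally show False using x(2) xf gc N.app_mult by simp
  qed
  have h: "2 * b = (k + 1) * x + (k - 1) * y" "2 * c = (1 - k) * x - (1 + k) * y"
    if "b - c = k * (x + y)" "b + c = x - y" for b c x y k :: 'k
    using that by Groebner_Basis.algebra+
  note R = N.relations_bilinear[OF gc g0 g1 t s nz]
  show ?thesis unfolding rels_def
    using h[OF R(1,2)] h[OF R(3,4)] h[OF R(5,6)] by (simp add: mult.assoc)
qed

theorem proposition5p1p10: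
  fixes \<alpha> \<beta> \<gamma> :: "'k :: alg_closed_field"
    and M :: "'k pt \<Rightarrow> ('k elA, 'm) grmod"
    and \<sigma> :: "'k pt \<Rightarrow> 'k pt"
  assumes "CHAR('k) \<noteq> 2"
    and "sklyanin_parameters \<alpha> \<beta> \<gamma>"
    and "associated_automorphism \<alpha> \<beta> \<gamma> M \<sigma>"
    and "infinite_order_on (curveE \<alpha> \<beta> \<gamma>) \<sigma>"
  shows "centre (twistB \<alpha> \<beta> \<gamma>) = range (\<lambda>c. clsB \<alpha> \<beta> \<gamma> (const c))"
proof -
  interpret sklyanin \<alpha> \<beta> \<gamma> by unfold_locales (rule assms(1), rule assms(2))
  interpret sklyanin_translation \<alpha> \<beta> \<gamma> \<sigma>
  proof
    show "bij_betw \<sigma> E E" using assms(3) by (simp add: associated_automorphism_def)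
  qed (rule associated_automorphism_rels[OF assms(3)])
  show ?thesis by (rule centre_trivial[OF assms(4)])
qed

end
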